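(* Let $G$ be a finite abelian group of order $N$, and let $p:\widetilde{X}\to X$ be a harmonic $G$-cover of graphs, with $\widetilde{X}$ (hence $X$) connected. The $X$-specialized Jacobian polynomial $J_{\widetilde X}(x_e)$ of $\widetilde X$ factors as $$J_{\widetilde{X}}(x_e)=\frac{1}{N}\left(\prod_{v\in V(X)}|D(v)|^{N/|D(v)|}\right)J_X(x_e)\prod_{\rho\in \widehat{G}'}P_{\widetilde{X}/X,\rho}(x_e),$$ where $D(v)$ is the dilation group at the vertex $v\in V(X)$, $J_X$ is the Jacobian polynomial of $X$, $\widehat{G}'$ is the set of nontrivial characters $\rho:G\to\mathbb{C}^*$, and $P_{\widetilde{X}/X,\rho}(x_e)$ is the weight polynomial of the matroid $\mathcal{M}^*(\widetilde{X}/X,\rho)$.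
   Context: **Graphs.** A graph $X$ consists of a finite set $V(X)$ of vertices, a finite set $H(X)$ of half-edges, a fixed-point-free involution $h\mapsto\overline{h}$ on $H(X)$, and a root map $r:H(X)\to V(X)$. An edge is an orbit $e=\{h,\overline{h}\}$; $E(X)$ is the set of edges; loops and multiple edges are allowed. An orientation orders the two half-edges of each edge $e=(h,\overline h)$ and gives source and target maps $s(e)=r(h)$, $t(e)=r(\overline{h})$. The genus of a connected graph is $g(X)=|E(X)|-|V(X)|+1$. For $v\in V(X)$, $T_v(X)=\{h\in H(X): r(h)=v\}$. A morphism of graphs is a pair of maps on vertices and half-edges commuting with the root maps and involutions. **Jacobian polynomial.** For a connected graph $X$ with a variable $x_e$ for each edge $e\in E(X)$, $J_X(x_e)=\sum_{T}\prod_{e\in E(X)\setminus E(T)}x_e\in\mathbb{Z}[x_e]_{e\in E(X)}$, the sum being over all spanning trees $T$ of $X$. Given a morphism $p:\widetilde X\to X$, the $X$-specialized Jacobian polynomial $J_{\widetilde X}(x_e)$ of $\widetilde X$ is obtained from $J_{\widetilde X}(x_{\tilde e})$ by setting $x_{\tilde e}=x_{p(\tilde e)}$ for all $\tilde e\in E(\widetilde X)$. **Harmonic covers.** A morphism $f:\widetilde{X}\to X$ is harmonic if there is a function $d_f:V(\widetilde{X})\to\mathbb{Z}_{>0}$ with $d_f(\tilde v)=|T_{\tilde v}(\widetilde X)\cap f^{-1}(h)|$ for all $\tilde v\in V(\widetilde X)$ and all $h\in T_{f(\tilde v)}(X)$. If $X$ is connected its degree is $\sum_{\tilde v\in f^{-1}(v)}d_f(\tilde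 v)$ (equal to $|f^{-1}(e)|$), independent of $v$ and $e$. A harmonic $G$-cover is a harmonic morphism $p:\widetilde X\to X$ of degree $|G|$ together with an action of $G$ on $\widetilde X$ by graph automorphisms (such that no group element exchanges the two half-edges of an edge) with $p\circ g=p$ and $d_p\circ g=d_p$ for all $g\in G$, such that $G$ acts transitively on $p^{-1}(v)$ for each $v\in V(X)$, and freely and transitively on $p^{-1}(e)$ for each $e\in E(X)$. For $G$ abelian (written additively), the dilation group $D(v)\subseteq G$ of $v\in V(X)$ is the common stabilizer of all the vertices in $p^{-1}(v)$. **Voltages.** Fix an orientation on $X$. Any harmonic $G$-cover with dilation groups $D(v)$ is, up to $G$-equivariant isomorphism over $X$, obtained from a dilated voltage assignment $\eta=(\eta_e)_{e\in E(X)}$, $\eta_e\in G/(D(s(e))+D(t(e)))$, as follows (after lifting each $\eta_e$ to $G$): $p^{-1}(v)=\{\tilde v_{[g]}:[g]\in G/D(v)\}$, $p^{-1}(e)=\{\tilde e_g:g\in G\}$, $G$ acts by translation on the indices, $s(\tilde e_g)=\widetilde{s(e)}_{[g]}$, $t(\tilde e_g)=\widetilde{t(e)}_{[g+\eta_e]}$. The assignment $\eta$ is determined by $p$ up to changing it to $\eta_e+\xi(t(e))-\xi(s(e))$ with $\xi(v)\in G/D(v)$. Set $\eta_{\overline e}=-\eta_e$ for the reversed edge. **Matroids and weight polynomials.** Let $\rho:G\to\mathbb{C}^*$ be a nontrivial character. For $F\subseteq E(X)$, $X\setminus F$ is the graph with all the vertices of $X$ and edge set $E(X)\setminus F$. The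 matroid $\mathcal{M}^*(\widetilde X/X,\rho)$ on the ground set $E(X)$ has as bases those $F\subseteq E(X)$ such that each connected component $X_i$ of $X\setminus F=X_1\sqcup\cdots\sqcup X_k$ is one of the following: (a) a graph of genus one with $\rho(D(v))=\{1\}$ for all $v\in V(X_i)$ and $\rho(\eta(X_i))\neq1$, where $\eta(X_i)$ is the oriented sum of the voltages $\eta_e$ along the unique cycle of $X_i$ (so $\rho(\eta(X_i))$ is well-defined up to inversion); (b) a tree containing exactly one vertex $v$ with $\rho(D(v))\neq\{1\}$. The weight of a basis is $w_\rho(F)=\prod_i w_\rho(X_i)$, where $w_\rho(X_i)=|1-\rho(\eta(X_i))|^2$ in case (a) and $w_\rho(X_i)=1$ in case (b). The weight polynomial is $P_{\widetilde X/X,\rho}(x_e)=\sum_F w_\rho(F)\prod_{e\in F}x_e$, the sum being over all bases $F$. *)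

theory Defs
  imports Complex_Main "HOL-Library.Poly_Mapping" "HOL-Algebra.Group_Action" "HOL-Algebra.FiniteProduct"
begin

section \<open>Graphs with half-edges\<close>

record ('v, 'h) hgraph =
  verts :: "'v set"
  half_edges :: "'h set"
  opp :: "'h \<Rightarrow> 'h"
  root :: "'h \<Rightarrow> 'v"

locale half_edge_graph =
  fixes X :: "('v, 'h) hgraph"
  assumes finite_verts: "finite (verts X)"
    and finite_half_edges: "finite (half_edges X)"
    and opp_closed: "h \<in> half_edges X \<Longrightarrow> opp X h \<in> half_edges X"
    and opp_opp: "h \<in> half_edges X \<Longrightarrow> opp X (opp X h) = h"
    and opp_neq: "h \<in> half_edges X \<Longrightarrow> opp X h \<noteq> h"
    and root_closed: "h \<in> half_edges X \<Longrightarrow> root X h \<in> verts X"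

definition edges :: "('v, 'h) hgraph \<Rightarrow> 'h set set" where
  "edges X = (\<lambda>h. {h, opp X h}) ` half_edges X"

definition tangent :: "('v, 'h) hgraph \<Rightarrow> 'v \<Rightarrow> 'h set" where
  "tangent X v = {h \<in> half_edges X. root X h = v}"

definition genus :: "('v, 'h) hgraph \<Rightarrow> int" where
  "genus X = int (card (edges X)) - int (card (verts X)) + 1"

text \<open>An orientation is given by the set of source half-edges: \<open>h \<in> Or\<close> means that the edge
  \<open>{h, opp X h}\<close> runs from \<open>root X h\<close> to \<open>root X (opp X h)\<close>.\<close>

definition orientation :: "('v, 'h) hgraph \<Rightarrow> 'h set \<Rightarrow> bool" where
  "orientation X Or \<longleftrightarrow>
     Or \<subseteq> half_edges X \<and> (\<forall>h \<in> half_edges X. h \<in> Or \<longleftrightarrow> opp X h \<notin> Or)"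

definition adjacency :: "('v, 'h) hgraph \<Rightarrow> ('v \<times> 'v) set" where
  "adjacency X = {(root X h, root X (opp X h)) | h. h \<in> half_edges X}"

definition connected_graph :: "('v, 'h) hgraph \<Rightarrow> bool" where
  "connected_graph X \<longleftrightarrow>
     verts X \<noteq> {} \<and> (\<forall>u \<in> verts X. \<forall>v \<in> verts X. (u, v) \<in> (adjacency X)\<^sup>*)"

definition components :: "('v, 'h) hgraph \<Rightarrow> ('v, 'h) hgraph set" where
  "components X =
     (\<lambda>v. let C = {u. (v, u) \<in> (adjacency X)\<^sup>*}
          in X\<lparr>verts := C, half_edges := {h \<in> half_edges X. root X h \<in> C}\<rparr>) ` verts X"

text \<open>A simple closed path, given by its consecutive half-edges in the direction of travel.
  Distinctness of the edges (not only of the half-edges) excludes \<open>[h, opp X h]\<close>; a loop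
  is a cycle of length one.\<close>

definition is_cycle :: "('v, 'h) hgraph \<Rightarrow> 'h list \<Rightarrow> bool" where
  "is_cycle X c \<longleftrightarrow>
     c \<noteq> [] \<and> set c \<subseteq> half_edges X \<and>
     distinct (map (root X) c) \<and> distinct (map (\<lambda>h. {h, opp X h}) c) \<and>
     (\<forall>i < length c. root X (opp X (c ! i)) = root X (c ! ((i + 1) mod length c)))"

definition is_tree :: "('v, 'h) hgraph \<Rightarrow> bool" where
  "is_tree X \<longleftrightarrow> connected_graph X \<and> (\<nexists>c. is_cycle X c)"

definition delete_edges :: "('v, 'h) hgraph \<Rightarrow> 'h set set \<Rightarrow> ('v, 'h) hgraph" where
  "delete_edges X F = X\<lparr>half_edges := half_edges X - \<Union>F\<rparr>"

text \<open>A spanning tree is identified with its edge set.\<close>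

definition spanning_trees :: "('v, 'h) hgraph \<Rightarrow> 'h set set set" where
  "spanning_trees X = {T. T \<subseteq> edges X \<and> is_tree (delete_edges X (edges X - T))}"


section \<open>Polynomials and the Jacobian polynomial\<close>

text \<open>Polynomials with coefficients in \<open>'a\<close> and variables indexed by \<open>'e\<close>;
  the multiplication of \<^theory>\<open>HOL-Library.Poly_Mapping\<close> is convolution.\<close>

type_synonym ('e, 'a) mpoly = "('e \<Rightarrow>\<^sub>0 nat) \<Rightarrow>\<^sub>0 'a"

definition Var :: "'e \<Rightarrow> ('e, 'a :: zero_neq_one) mpoly" where
  "Var e = Poly_Mapping.single (Poly_Mapping.single e 1) 1"

definition Const :: "'a :: zero \<Rightarrow> ('e, 'a) mpoly" where
  "Const c = Poly_Mapping.single 0 c"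

definition substitute :: "('e \<Rightarrow> 'b :: comm_ring_1) \<Rightarrow> ('e, int) mpoly \<Rightarrow> 'b" where
  "substitute \<sigma> P =
     (\<Sum>m \<in> Poly_Mapping.keys P. of_int (Poly_Mapping.lookup P m) *
        (\<Prod>e \<in> Poly_Mapping.keys m. \<sigma> e ^ Poly_Mapping.lookup m e))"

definition real_mpoly :: "('e, int) mpoly \<Rightarrow> ('e, real) mpoly" where
  "real_mpoly P = Poly_Mapping.map real_of_int P"

definition jacobian_poly :: "('v, 'h) hgraph \<Rightarrow> ('h set, int) mpoly" where
  "jacobian_poly X = (\<Sum>T \<in> spanning_trees X. \<Prod>e \<in> edges X - T. Var e)"

text \<open>\<open>pH\<close> is the half-edge part of a morphism; it maps the edge \<open>e\<close> to \<open>pH ` e\<close>.\<close>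

definition specialized_jacobian_poly ::
    "('w, 'k) hgraph \<Rightarrow> ('k \<Rightarrow> 'h) \<Rightarrow> ('h set, int) mpoly" where
  "specialized_jacobian_poly Xt pH = substitute (\<lambda>e. Var (pH ` e)) (jacobian_poly Xt)"


section \<open>Harmonic covers\<close>

definition graph_morphism ::
    "('w, 'k) hgraph \<Rightarrow> ('v, 'h) hgraph \<Rightarrow> ('w \<Rightarrow> 'v) \<Rightarrow> ('k \<Rightarrow> 'h) \<Rightarrow> bool" where
  "graph_morphism Xt X pV pH \<longleftrightarrow>
     pV ` verts Xt \<subseteq> verts X \<and> pH ` half_edges Xt \<subseteq> half_edges X \<and>
     (\<forall>k \<in> half_edges Xt. root X (pH k) = pV (root Xt k) \<and> pH (opp Xt k) = opp X (pH k))"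

definition vertex_fiber :: "('w, 'k) hgraph \<Rightarrow> ('w \<Rightarrow> 'v) \<Rightarrow> 'v \<Rightarrow> 'w set" where
  "vertex_fiber Xt pV v = {w \<in> verts Xt. pV w = v}"

definition edge_fiber :: "('w, 'k) hgraph \<Rightarrow> ('k \<Rightarrow> 'h) \<Rightarrow> 'h set \<Rightarrow> 'k set set" where
  "edge_fiber Xt pH e = {f \<in> edges Xt. pH ` f = e}"

text \<open>The local degree function \<open>d\<close> is part of the data: it is not determined by the morphism at
  vertices lying over isolated vertices.\<close>

definition harmonic_morphism ::
    "('w, 'k) hgraph \<Rightarrow> ('v, 'h) hgraph \<Rightarrow> ('w \<Rightarrow> 'v) \<Rightarrow> ('k \<Rightarrow> 'h) \<Rightarrow> ('w \<Rightarrow> nat) \<Rightarrow> bool" where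
  "harmonic_morphism Xt X pV pH d \<longleftrightarrow>
     graph_morphism Xt X pV pH \<and>
     (\<forall>w \<in> verts Xt. 0 < d w \<and>
        (\<forall>h \<in> tangent X (pV w). d w = card {k \<in> tangent Xt w. pH k = h}))"

locale harmonic_G_cover =
  fixes G :: "('g, 'm) monoid_scheme" (structure)
    and Xt :: "('w, 'k) hgraph" and X :: "('v, 'h) hgraph"
    and pV :: "'w \<Rightarrow> 'v" and pH :: "'k \<Rightarrow> 'h"
    and actV :: "'g \<Rightarrow> 'w \<Rightarrow> 'w" and actH :: "'g \<Rightarrow> 'k \<Rightarrow> 'k"
  assumes cover_graph: "half_edge_graph Xt"
    and base_graph: "half_edge_graph X"
    and action_verts: "group_action G (verts Xt) actV"
    and action_half_edges: "group_action G (half_edges Xt) actH"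
    and action_root: "\<lbrakk>g \<in> carrier G; k \<in> half_edges Xt\<rbrakk> \<Longrightarrow> root Xt (actH g k) = actV g (root Xt k)"
    and action_opp: "\<lbrakk>g \<in> carrier G; k \<in> half_edges Xt\<rbrakk> \<Longrightarrow> opp Xt (actH g k) = actH g (opp Xt k)"
    and action_no_flip: "\<lbrakk>g \<in> carrier G; k \<in> half_edges Xt\<rbrakk> \<Longrightarrow> actH g k \<noteq> opp Xt k"
    and proj_verts: "\<lbrakk>g \<in> carrier G; w \<in> verts Xt\<rbrakk> \<Longrightarrow> pV (actV g w) = pV w"
    and proj_half_edges: "\<lbrakk>g \<in> carrier G; k \<in> half_edges Xt\<rbrakk> \<Longrightarrow> pH (actH g k) = pH k"
    and harmonic: "\<exists>d. harmonic_morphism Xt X pV pH d \<and>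
          (\<forall>v \<in> verts X. (\<Sum>w \<in> vertex_fiber Xt pV v. d w) = order G) \<and>
          (\<forall>g \<in> carrier G. \<forall>w \<in> verts Xt. d (actV g w) = d w)"
    and transitive_verts: "\<lbrakk>v \<in> verts X; w \<in> vertex_fiber Xt pV v; w' \<in> vertex_fiber Xt pV v\<rbrakk>
          \<Longrightarrow> \<exists>g \<in> carrier G. actV g w = w'"
    and transitive_edges: "\<lbrakk>e \<in> edges X; f \<in> edge_fiber Xt pH e; f' \<in> edge_fiber Xt pH e\<rbrakk>
          \<Longrightarrow> \<exists>g \<in> carrier G. actH g ` f = f'"
    and free_edges: "\<lbrakk>e \<in> edges X; f \<in> edge_fiber Xt pH e; g \<in> carrier G; actH g ` f = f\<rbrakk>
          \<Longrightarrow> g = \<one>"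

text \<open>For abelian \<open>G\<close> all the stabilizers occurring here coincide.\<close>

definition dilation_group ::
    "('g, 'm) monoid_scheme \<Rightarrow> ('w, 'k) hgraph \<Rightarrow> ('w \<Rightarrow> 'v) \<Rightarrow> ('g \<Rightarrow> 'w \<Rightarrow> 'w) \<Rightarrow> 'v \<Rightarrow> 'g set" where
  "dilation_group G Xt pV actV v = (\<Inter>w \<in> vertex_fiber Xt pV v. stabilizer G actV w)"


section \<open>Voltages\<close>

text \<open>\<open>\<eta>\<close> assigns to each oriented edge (given by its source half-edge \<open>h \<in> Or\<close>) a lift to \<open>G\<close> of its
  voltage in \<open>G/(D(s(e)) + D(t(e)))\<close>. The cover is obtained from \<open>\<eta>\<close> if it is \<open>G\<close>-equivariantly
  isomorphic over \<open>X\<close> to the explicit model; such an isomorphism is the same as indexings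
  \<open>\<nu> v\<close> of the fiber of the vertex \<open>v\<close> by \<open>G/D(v)\<close> and \<open>\<epsilon> h\<close> of the fiber of the
  oriented edge \<open>h\<close> by \<open>G\<close>. The group is written multiplicatively.\<close>

definition obtained_from_voltage ::
    "('g, 'm) monoid_scheme \<Rightarrow> ('w, 'k) hgraph \<Rightarrow> ('v, 'h) hgraph \<Rightarrow> ('w \<Rightarrow> 'v) \<Rightarrow> ('k \<Rightarrow> 'h) \<Rightarrow>
     ('g \<Rightarrow> 'w \<Rightarrow> 'w) \<Rightarrow> ('g \<Rightarrow> 'k \<Rightarrow> 'k) \<Rightarrow> 'h set \<Rightarrow> ('h \<Rightarrow> 'g) \<Rightarrow> bool" where
  "obtained_from_voltage G Xt X pV pH actV actH Or \<eta> \<longleftrightarrow>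
     (let D = dilation_group G Xt pV actV in
      \<eta> \<in> Or \<rightarrow> carrier G \<and>
      (\<exists>\<nu> \<epsilon>.
        (\<forall>v \<in> verts X.
           bij_betw (\<nu> v) (carrier (G Mod D v)) (vertex_fiber Xt pV v) \<and>
           (\<forall>g \<in> carrier G. \<forall>a \<in> carrier G.
              actV g (\<nu> v (D v #>\<^bsub>G\<^esub> a)) = \<nu> v (D v #>\<^bsub>G\<^esub> (g \<otimes>\<^bsub>G\<^esub> a)))) \<and>
        (\<forall>h \<in> Or.
           bij_betw (\<epsilon> h) (carrier G) {k \<in> half_edges Xt. pH k = h} \<and>
           (\<forall>g \<in> carrier G. \<forall>a \<in> carrier G. actH g (\<epsilon> h a) = \<epsilon> h (g \<otimes>\<^bsub>G\<^esub> a)) \<and>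
           (\<forall>a \<in> carrier G.
              root Xt (\<epsilon> h a) = \<nu> (root X h) (D (root X h) #>\<^bsub>G\<^esub> a) \<and>
              root Xt (opp Xt (\<epsilon> h a)) =
                \<nu> (root X (opp X h)) (D (root X (opp X h)) #>\<^bsub>G\<^esub> (a \<otimes>\<^bsub>G\<^esub> \<eta> h))))))"

definition half_edge_voltage ::
    "('g, 'm) monoid_scheme \<Rightarrow> ('v, 'h) hgraph \<Rightarrow> 'h set \<Rightarrow> ('h \<Rightarrow> 'g) \<Rightarrow> 'h \<Rightarrow> 'g" where
  "half_edge_voltage G X Or \<eta> h = (if h \<in> Or then \<eta> h else inv\<^bsub>G\<^esub> (\<eta> (opp X h)))"

text \<open>Only used for graphs of genus one, where the cycle is unique up to starting point and
  direction; reversing the direction inverts the value.\<close>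

definition cycle_voltage ::
    "('g, 'm) monoid_scheme \<Rightarrow> ('v, 'h) hgraph \<Rightarrow> 'h set \<Rightarrow> ('h \<Rightarrow> 'g) \<Rightarrow> 'g" where
  "cycle_voltage G Y Or \<eta> =
     finprod G (half_edge_voltage G Y Or \<eta>) (set (SOME c. is_cycle Y c))"


section \<open>Characters and weight polynomials\<close>

definition complex_units :: "complex monoid" where
  "complex_units = \<lparr>carrier = UNIV - {0}, monoid.mult = (*), one = 1\<rparr>"

text \<open>Extensionality makes distinct elements of this set distinct as characters.\<close>

definition nontrivial_characters :: "('g, 'm) monoid_scheme \<Rightarrow> ('g \<Rightarrow> complex) set" where
  "nontrivial_characters G =
     hom G complex_units \<inter> extensional (carrier G) - {\<lambda>g \<in> carrier G. 1}"

context
  fixes G :: "('g, 'm) monoid_scheme" and D :: "'v \<Rightarrow> 'g set"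
    and Or :: "'h set" and \<eta> :: "'h \<Rightarrow> 'g" and \<rho> :: "'g \<Rightarrow> complex"
begin

definition cyclic_type :: "('v, 'h) hgraph \<Rightarrow> bool" where
  "cyclic_type Y \<longleftrightarrow>
     genus Y = 1 \<and> (\<forall>v \<in> verts Y. \<rho> ` D v = {1}) \<and> \<rho> (cycle_voltage G Y Or \<eta>) \<noteq> 1"

definition tree_type :: "('v, 'h) hgraph \<Rightarrow> bool" where
  "tree_type Y \<longleftrightarrow> is_tree Y \<and> (\<exists>!v. v \<in> verts Y \<and> \<rho> ` D v \<noteq> {1})"

definition matroid_bases :: "('v, 'h) hgraph \<Rightarrow> 'h set set set" where
  "matroid_bases X =
     {F. F \<subseteq> edges X \<and> (\<forall>Y \<in> components (delete_edges X F). cyclic_type Y \<or> tree_type Y)}"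

definition component_weight :: "('v, 'h) hgraph \<Rightarrow> real" where
  "component_weight Y =
     (if cyclic_type Y then (cmod (1 - \<rho> (cycle_voltage G Y Or \<eta>)))\<^sup>2 else 1)"

definition basis_weight :: "('v, 'h) hgraph \<Rightarrow> 'h set set \<Rightarrow> real" where
  "basis_weight X F = (\<Prod>Y \<in> components (delete_edges X F). component_weight Y)"

definition weight_poly :: "('v, 'h) hgraph \<Rightarrow> ('h set, real) mpoly" where
  "weight_poly X =
     (\<Sum>F \<in> matroid_bases X. Const (basis_weight X F) * (\<Prod>e \<in> F. Var e))"

end


section \<open>Existence of voltages\<close>

text \<open>Every harmonic \<open>G\<close>-cover is obtained from a voltage assignment, for any orientation.\<close>

lemma (in harmonic_G_cover) voltage_exists:
  assumes comm: "comm_group G" and fin: "finite (carrier G)" and Or: "orientation X Or"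
  shows "\<exists>\<eta>. obtained_from_voltage G Xt X pV pH actV actH Or \<eta>"
proof -
  interpret G: comm_group G by (rule comm)
  interpret Xt: half_edge_graph Xt by (rule cover_graph)
  interpret X: half_edge_graph X by (rule base_graph)
  interpret AV: group_action G "verts Xt" actV by (rule action_verts)
  interpret AH: group_action G "half_edges Xt" actH by (rule action_half_edges)
  define D where "D = dilation_group G Xt pV actV"
  obtain d where d: "harmonic_morphism Xt X pV pH d"
      "\<And>v. v \<in> verts X \<Longrightarrow> (\<Sum>w \<in> vertex_fiber Xt pV v. d w) = order G"
    using harmonic by blast
  have mor: "\<And>w. w \<in> verts Xt \<Longrightarrow> pV w \<in> verts X"
      "\<And>k. k \<in> half_edges Xt \<Longrightarrow> pH k \<in> half_edges X"
      "\<And>k. k \<in> half_edges Xt \<Longrightarrow> root X (pH k) = pV (root Xt k)"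
      "\<And>k. k \<in> half_edges Xt \<Longrightarrow> pH (opp Xt k) = opp X (pH k)"
    using d(1) by (auto simp: harmonic_morphism_def graph_morphism_def)
  have ord: "order G > 0" using G.order_gt_0_iff_finite fin by simp
  have ne: "vertex_fiber Xt pV v \<noteq> {}" if "v \<in> verts X" for v
  proof
    assume "vertex_fiber Xt pV v = {}"
    then show False using d(2)[OF that] ord by simp
  qed
  define b where "b = (\<lambda>v. SOME w. w \<in> vertex_fiber Xt pV v)"
  have b: "b v \<in> vertex_fiber Xt pV v" if "v \<in> verts X" for v
    unfolding b_def using ne[OF that] by (metis ex_in_conv someI)
  have bX: "b v \<in> verts Xt" "pV (b v) = v" if "v \<in> verts X" for v
    using b[OF that] by (auto simp: vertex_fiber_def)
  have actfib: "actV g w \<in> vertex_fiber Xt pV v" if "g \<in> carrier G" "w \<in> vertex_fiber Xt pV v" for g w v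
    using that AV.element_image[OF that(1) _ refl] proj_verts by (auto simp: vertex_fiber_def)
  have compV: "actV (g \<otimes> a) w = actV g (actV a w)"
    if "g \<in> carrier G" "a \<in> carrier G" "w \<in> verts Xt" for g a w
    using AV.composition_rule[OF that(3,1,2)] .
  have compH: "actH (g \<otimes> a) w = actH g (actH a w)"
    if "g \<in> carrier G" "a \<in> carrier G" "w \<in> half_edges Xt" for g a w
    using AH.composition_rule[OF that(3,1,2)] .
  have idV: "actV \<one> w = w" if "w \<in> verts Xt" for w
    unfolding AV.id_eq_one[symmetric] using that by simp
  have idH: "actH \<one> k = k" if "k \<in> half_edges Xt" for k
    unfolding AH.id_eq_one[symmetric] using that by simp
  have Dsub: "D v \<subseteq> carrier G" if "v \<in> verts X" for v
    using b[OF that] by (auto simp: D_def dilation_group_def stabilizer_def)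
  have D: "D v = stabilizer G actV (b v)" if v: "v \<in> verts X" for v
  proof
    show "D v \<subseteq> stabilizer G actV (b v)"
      using b[OF v] by (auto simp: D_def dilation_group_def)
    show "stabilizer G actV (b v) \<subseteq> D v"
    proof
      fix g assume g: "g \<in> stabilizer G actV (b v)"
      then have gc: "g \<in> carrier G" and gb: "actV g (b v) = b v" by (auto simp: stabilizer_def)
      have "actV g w = w" if w: "w \<in> vertex_fiber Xt pV v" for w
      proof -
        obtain a where a: "a \<in> carrier G" "actV a (b v) = w"
          using transitive_verts[OF v b[OF v] w] by blast
        have "actV g w = actV (g \<otimes> a) (b v)" using compV[OF gc a(1) bX(1)[OF v]] a by simp
        also have "\<dots> = actV (a \<otimes> g) (b v)" using G.m_comm gc a by simp
        also have "\<dots> = w" using compV[OF a(1) gc bX(1)[OF v]] a gb by simp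
        finally show ?thesis .
      qed
      then show "g \<in> D v" using gc by (auto simp: D_def dilation_group_def stabilizer_def)
    qed
  qed
  have Dsg: "subgroup (D v) G" if "v \<in> verts X" for v
    using D[OF that] AV.stabilizer_subgroup[OF bX(1)[OF that]] by simp
  define \<nu> where "\<nu> = (\<lambda>v C. actV (SOME g. g \<in> C) (b v))"
  have nu: "\<nu> v (D v #> a) = actV a (b v)" if v: "v \<in> verts X" and a: "a \<in> carrier G" for v a
  proof -
    have "a \<in> D v #> a" using G.rcos_self[OF a Dsg[OF v]] .
    then have "(SOME g. g \<in> D v #> a) \<in> D v #> a" by (rule someI)
    then obtain k where k: "k \<in> D v" "(SOME g. g \<in> D v #> a) = k \<otimes> a"
      by (auto simp: r_coset_def)
    have kc: "k \<in> carrier G" using Dsub[OF v] k by auto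
    have "actV (k \<otimes> a) (b v) = actV (a \<otimes> k) (b v)" using G.m_comm kc a by simp
    also have "\<dots> = actV a (b v)"
      using compV[OF a kc bX(1)[OF v]] k D[OF v] by (simp add: stabilizer_def)
    finally show ?thesis using k by (simp add: \<nu>_def)
  qed
  have nu_bij: "bij_betw (\<nu> v) (carrier (G Mod D v)) (vertex_fiber Xt pV v)" if v: "v \<in> verts X" for v
    unfolding bij_betw_def
  proof
    show "inj_on (\<nu> v) (carrier (G Mod D v))"
    proof (rule inj_onI)
      fix C C' assume C: "C \<in> carrier (G Mod D v)" "C' \<in> carrier (G Mod D v)" and eq: "\<nu> v C = \<nu> v C'"
      obtain a where a: "a \<in> carrier G" "C = D v #> a" using C(1) by (auto simp: FactGroup_def RCOSETS_def)
      obtain a' where a': "a' \<in> carrier G" "C' = D v #> a'" using C(2) by (auto simp: FactGroup_def RCOSETS_def)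
      have e: "actV a (b v) = actV a' (b v)" using eq nu[OF v] a a' by simp
      have "actV (inv a' \<otimes> a) (b v) = actV (inv a' \<otimes> a') (b v)"
        by (simp only: e compV[OF G.inv_closed[OF a'(1)] a(1) bX(1)[OF v]]
          compV[OF G.inv_closed[OF a'(1)] a'(1) bX(1)[OF v]])
      then have "inv a' \<otimes> a \<in> D v"
        using D[OF v] a a' idV[OF bX(1)[OF v]] by (simp add: stabilizer_def)
      then have "a \<otimes> inv a' \<in> D v" using G.m_comm a a' by simp
      then have "a \<in> D v #> a'"
        using subgroup.rcos_module_rev[OF Dsg[OF v] G.group_axioms a'(1) a(1)] by simp
      then show "C = C'" using G.repr_independence[OF _ a'(1) Dsg[OF v]] a a' by simp
    qed
    show "\<nu> v ` carrier (G Mod D v) = vertex_fiber Xt pV v"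
    proof
      show "\<nu> v ` carrier (G Mod D v) \<subseteq> vertex_fiber Xt pV v"
        using nu[OF v] actfib b[OF v] by (auto simp: FactGroup_def RCOSETS_def)
      show "vertex_fiber Xt pV v \<subseteq> \<nu> v ` carrier (G Mod D v)"
      proof
        fix w assume "w \<in> vertex_fiber Xt pV v"
        then obtain a where a: "a \<in> carrier G" "actV a (b v) = w"
          using transitive_verts[OF v b[OF v]] by blast
        then show "w \<in> \<nu> v ` carrier (G Mod D v)"
          using nu[OF v a(1)] by (intro image_eqI[of _ _ "D v #> a"]) (auto simp: FactGroup_def RCOSETS_def)
      qed
    qed
  qed
  have OrX: "h \<in> half_edges X" "root X h \<in> verts X" "root X (opp X h) \<in> verts X" if "h \<in> Or" for h
    using that Or X.opp_closed X.root_closed by (auto simp: orientation_def)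
  have "\<exists>k. k \<in> half_edges Xt \<and> root Xt k = b (root X h) \<and> pH k = h" if h: "h \<in> Or" for h
  proof -
    have "h \<in> tangent X (pV (b (root X h)))"
      using bX[OF OrX(2)[OF h]] OrX(1)[OF h] by (simp add: tangent_def)
    then have "card {k \<in> tangent Xt (b (root X h)). pH k = h} \<noteq> 0"
      using d(1) bX(1)[OF OrX(2)[OF h]] unfolding harmonic_morphism_def
      by (metis less_numeral_extra(3))
    then have "{k \<in> tangent Xt (b (root X h)). pH k = h} \<noteq> {}"
      by (metis card.empty)
    then show ?thesis by (auto simp: tangent_def)
  qed
  then obtain c where c: "\<And>h. h \<in> Or \<Longrightarrow> c h \<in> half_edges Xt"
      "\<And>h. h \<in> Or \<Longrightarrow> root Xt (c h) = b (root X h)" "\<And>h. h \<in> Or \<Longrightarrow> pH (c h) = h"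
    by metis
  have "\<exists>g \<in> carrier G. actV g (b (root X (opp X h))) = root Xt (opp Xt (c h))" if h: "h \<in> Or" for h
  proof (rule transitive_verts[OF OrX(3)[OF h] b[OF OrX(3)[OF h]]])
    have o: "opp Xt (c h) \<in> half_edges Xt" using Xt.opp_closed c(1)[OF h] .
    show "root Xt (opp Xt (c h)) \<in> vertex_fiber Xt pV (root X (opp X h))"
      using Xt.root_closed[OF o] mor(3)[OF o] mor(4)[OF c(1)[OF h]] c(3)[OF h]
      by (auto simp: vertex_fiber_def)
  qed
  then obtain \<eta> where eta: "\<And>h. h \<in> Or \<Longrightarrow> \<eta> h \<in> carrier G"
      "\<And>h. h \<in> Or \<Longrightarrow> actV (\<eta> h) (b (root X (opp X h))) = root Xt (opp Xt (c h))"
    by metis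
  define \<epsilon> where "\<epsilon> = (\<lambda>h a. actH a (c h))"
  have eps_bij: "bij_betw (\<epsilon> h) (carrier G) {k \<in> half_edges Xt. pH k = h}" if h: "h \<in> Or" for h
  proof -
    have cf: "{c h, opp Xt (c h)} \<in> edge_fiber Xt pH {h, opp X h}"
      using c[OF h] mor(4)[OF c(1)[OF h]] by (auto simp: edge_fiber_def edges_def)
    have eX: "{h, opp X h} \<in> edges X" using OrX(1)[OF h] by (auto simp: edges_def)
    have "inj_on (\<epsilon> h) (carrier G)"
    proof (rule inj_onI)
      fix a a' assume a: "a \<in> carrier G" "a' \<in> carrier G" and eq: "\<epsilon> h a = \<epsilon> h a'"
      have "actH (inv a' \<otimes> a) (c h) = actH (inv a' \<otimes> a') (c h)"
        using eq by (simp only: \<epsilon>_def compH[OF G.inv_closed[OF a(2)] a(1) c(1)[OF h]]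
          compH[OF G.inv_closed[OF a(2)] a(2) c(1)[OF h]])
      then have fx: "actH (inv a' \<otimes> a) (c h) = c h"
        using a idH[OF c(1)[OF h]] by simp
      have "actH (inv a' \<otimes> a) (opp Xt (c h)) = opp Xt (c h)"
        using fx action_opp[OF _ c(1)[OF h], of "inv a' \<otimes> a"] a by simp
      then have "actH (inv a' \<otimes> a) ` {c h, opp Xt (c h)} = {c h, opp Xt (c h)}" using fx by simp
      then have "inv a' \<otimes> a = \<one>" using free_edges[OF eX cf] a by simp
      then show "a = a'" using a G.inv_solve_left'[of \<one> a' a] by simp
    qed
    moreover have "\<epsilon> h ` carrier G \<subseteq> {k \<in> half_edges Xt. pH k = h}"
      using AH.element_image[OF _ c(1)[OF h] refl] c[OF h] proj_half_edges by (auto simp: \<epsilon>_def)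
    moreover have "k \<in> \<epsilon> h ` carrier G" if k: "k \<in> half_edges Xt" "pH k = h" for k
    proof -
      have kf: "{k, opp Xt k} \<in> edge_fiber Xt pH {h, opp X h}"
        using k mor(4)[OF k(1)] by (auto simp: edge_fiber_def edges_def)
      obtain g where g: "g \<in> carrier G" "actH g ` {c h, opp Xt (c h)} = {k, opp Xt k}"
        using transitive_edges[OF eX cf kf] by blast
      have "pH (actH g (c h)) = h" using proj_half_edges[OF g(1) c(1)[OF h]] c(3)[OF h] by simp
      moreover have "pH (opp Xt k) \<noteq> h" using mor(4)[OF k(1)] k X.opp_neq OrX(1)[OF h] by simp
      ultimately have "actH g (c h) = k" using g(2) by auto
      then show ?thesis using g(1) by (auto simp: \<epsilon>_def)
    qed
    ultimately show ?thesis unfolding bij_betw_def by blast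
  qed
  have "obtained_from_voltage G Xt X pV pH actV actH Or \<eta>"
    unfolding obtained_from_voltage_def Let_def D_def[symmetric]
  proof (intro conjI exI[of _ \<nu>] exI[of _ \<epsilon>] ballI)
    show "\<eta> \<in> Or \<rightarrow> carrier G" using eta(1) by auto
  next
    fix v assume v: "v \<in> verts X"
    show "bij_betw (\<nu> v) (carrier (G Mod D v)) (vertex_fiber Xt pV v)" by (rule nu_bij[OF v])
    fix g a assume "g \<in> carrier G" "a \<in> carrier G"
    then show "actV g (\<nu> v (D v #> a)) = \<nu> v (D v #> (g \<otimes> a))"
      using nu[OF v] compV[OF _ _ bX(1)[OF v]] by simp
  next
    fix h assume h: "h \<in> Or"
    show "bij_betw (\<epsilon> h) (carrier G) {k \<in> half_edges Xt. pH k = h}" by (rule eps_bij[OF h])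
    show "actH g (\<epsilon> h a) = \<epsilon> h (g \<otimes> a)" if "g \<in> carrier G" "a \<in> carrier G" for g a
      using compH[OF that c(1)[OF h]] by (simp add: \<epsilon>_def)
    fix a assume a: "a \<in> carrier G"
    show "root Xt (\<epsilon> h a) = \<nu> (root X h) (D (root X h) #> a)"
      using action_root[OF a c(1)[OF h]] c(2)[OF h] nu[OF OrX(2)[OF h] a] by (simp add: \<epsilon>_def)
    have "root Xt (opp Xt (\<epsilon> h a)) = actV a (actV (\<eta> h) (b (root X (opp X h))))"
      using action_opp[OF a c(1)[OF h]] action_root[OF a Xt.opp_closed[OF c(1)[OF h]]] eta(2)[OF h]
      by (simp add: \<epsilon>_def)
    also have "\<dots> = actV (a \<otimes> \<eta> h) (b (root X (opp X h)))"
      using compV[OF a eta(1)[OF h] bX(1)[OF OrX(3)[OF h]]] by simp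
    finally show "root Xt (opp Xt (\<epsilon> h a)) =
        \<nu> (root X (opp X h)) (D (root X (opp X h)) #> (a \<otimes> \<eta> h))"
      using nu[OF OrX(3)[OF h]] a eta(1)[OF h] by simp
  qed
  then show ?thesis by blast
qed

end

theory Submission
  imports Defs "HOL-Combinatorics.Permutations" "HOL-Algebra.Multiplicative_Group"
begin

text \<open>
  Both sides are compared at positive real points \<open>x\<close>. With the edge weights \<open>y = 1/x\<close> and up to a power of
  \<open>\<Prod>e. x e\<close>, the polynomials \<open>J\<close> become spanning tree sums, which are reduced determinants of weighted
  Laplacians, and \<open>P_\<rho>\<close> becomes the determinant of the Laplacian twisted by the voltages \<open>\<rho> (\<eta> e)\<close>,
  restricted to the vertices \<open>v\<close> with \<open>\<rho>\<close> trivial on \<open>D(v)\<close>. Both statements follow from the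
  Cauchy-Binet formula: a maximal minor of the incidence matrix is a product over connected
  components, a unit for a tree with one deleted row, and \<open>1 - \<rho> (\<eta> c)\<close> up to a unit for a
  component with the unique cycle \<open>c\<close>.

  The functions \<open>[a] \<mapsto> \<rho> a\<close> on the fibres, for \<open>v\<close> and \<open>\<rho>\<close> with \<open>\<rho>\<close> trivial on \<open>D(v)\<close>, are an
  orthogonal basis of the functions on the vertices of the cover, in which its Laplacian becomes
  block diagonal with one twisted Laplacian for every character. To cope with the kernel of
  the Laplacian, the all-ones matrix is added; this changes only the block of the trivial character.
\<close>


section \<open>Determinants over finite index sets\<close>

text \<open>Deleting a row and a column, as the matrix-tree theorem does, destroys the symmetry
  under G, so the reduced Laplacian of the cover cannot be decomposed by characters. The all-ones
  matrix is invariant under G, and adding it gives the reduced determinant times the squared number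
  of vertices of the cover; the trivial block on the base produces the same factor, and the two
  cancel.

  The dilation factor comes from a Gram determinant: carried to the fibre of v, a character that is
  trivial on D(v) has squared norm N / |D(v)|, and there are N / |D(v)| such characters. The factor
  1 / N is what remains when powers of N are compared: there is one for each vertex of the cover on
  one side, and one less from the blocks, since the trivial block loses a row.

  Determinants are indexed by sets because vertices and edges have no natural order. Another
  matching of rows with columns changes a minor by a sign only, and minors enter through their
  squared moduli.\<close>

definition det_on :: "'a set \<Rightarrow> ('a \<Rightarrow> 'a \<Rightarrow> 'b :: comm_ring_1) \<Rightarrow> 'b" where
  "det_on A M = (\<Sum>p | p permutes A. of_int (sign p) * (\<Prod>i \<in> A. M i (p i)))"

lemma det_on_cong:
  assumes "\<And>i j. i \<in> A \<Longrightarrow> j \<in> A \<Longrightarrow> M i j = M' i j"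
  shows "det_on A M = det_on A M'"
  unfolding det_on_def
  by (intro sum.cong refl arg_cong2[where f = "(*)"] prod.cong) (auto simp: assms permutes_in_image)

lemma det_on_empty [simp]: "det_on {} M = 1"
  by (simp add: det_on_def)

section \<open>Column permutations and the Cauchy-Binet formula\<close>

lemma det_on_transpose:
  assumes "finite A"
  shows "det_on A (\<lambda>i j. M j i) = det_on A M"
proof -
  have "(\<Prod>i \<in> A. M (inv_into UNIV p i) i) = (\<Prod>i \<in> A. M i (p i))" if p: "p permutes A" for p
  proof -
    have "(\<Prod>i \<in> A. M (inv_into UNIV p i) i) = (\<Prod>i \<in> A. M (inv_into UNIV p (p i)) (p i))"
      using prod.permute[OF p, of "\<lambda>i. M (inv_into UNIV p i) i"] by (simp add: o_def)
    then show ?thesis using p by (simp add: permutes_inverses)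
  qed
  moreover have "sign (inv_into UNIV p) = sign p" if "p permutes A" for p
    using permutes_imp_permutation[OF assms that] by (rule sign_inverse)
  ultimately show ?thesis
    unfolding det_on_def by (subst sum_permutations_inverse) (auto intro!: sum.cong)
qed

lemma det_on_permute_columns:
  assumes fin: "finite A" and q: "q permutes A"
  shows "det_on A (\<lambda>i j. M i (q j)) = of_int (sign q) * det_on A M"
proof -
  have "sign p = sign q * sign (q \<circ> p)" if "p permutes A" for p
    using sign_compose[OF permutes_imp_permutation[OF fin q] permutes_imp_permutation[OF fin that]]
    by (simp add: mult.assoc[symmetric])
  then have "det_on A (\<lambda>i j. M i (q j)) =
      (\<Sum>p | p permutes A. of_int (sign q) * (of_int (sign (q \<circ> p)) * (\<Prod>i \<in> A. M i ((q \<circ> p) i))))"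
    unfolding det_on_def by (intro sum.cong refl) (auto simp: mult.assoc)
  also have "\<dots> = (\<Sum>p | p permutes A. of_int (sign q) * (of_int (sign p) * (\<Prod>i \<in> A. M i (p i))))"
    by (rule setum_permutations_compose_left[OF q, symmetric])
  finally show ?thesis by (simp add: det_on_def sum_distrib_left)
qed

lemma bij_betw_permutes:
  assumes f: "bij_betw f A S" and g: "bij_betw g A S"
  obtains q where "q permutes A" "\<And>i. i \<in> A \<Longrightarrow> g i = f (q i)"
proof
  define q where "q = (\<lambda>i. if i \<in> A then inv_into A f (g i) else i)"
  have "bij_betw (inv_into A f \<circ> g) A A"
    using bij_betw_trans[OF g bij_betw_inv_into[OF f]] .
  then have "bij_betw q A A" by (rule bij_betw_cong[THEN iffD1, rotated]) (simp add: q_def)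
  then show "q permutes A" by (rule bij_imp_permutes) (simp add: q_def)
  show "g i = f (q i)" if "i \<in> A" for i
    using bij_betw_inv_into_right[OF f] bij_betwE[OF g] that by (simp add: q_def)
qed

text \<open>The two indexings differ by a permutation of \<open>A\<close>, hence by a sign, which
  the modulus forgets. Each minor below can therefore be computed with the indexing that makes it
  triangular or block diagonal.\<close>

lemma norm_det_on_column_indexing:
  fixes P :: "'a \<Rightarrow> 'e \<Rightarrow> complex"
  assumes fin: "finite A" and f: "bij_betw f A S" and g: "bij_betw g A S"
  shows "cmod (det_on A (\<lambda>i j. P i (g j))) = cmod (det_on A (\<lambda>i j. P i (f j)))"
proof -
  obtain q where q: "q permutes A" "\<And>i. i \<in> A \<Longrightarrow> g i = f (q i)"
    using bij_betw_permutes[OF f g] by blast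
  have "det_on A (\<lambda>i j. P i (g j)) = det_on A (\<lambda>i j. P i (f (q j)))"
    by (rule det_on_cong) (simp add: q)
  also have "\<dots> = of_int (sign q) * det_on A (\<lambda>i j. P i (f j))"
    by (rule det_on_permute_columns[OF fin q(1), where M = "\<lambda>i j. P i (f j)"])
  finally show ?thesis by (cases q rule: sign_cases) (simp_all add: norm_mult)
qed

text \<open>Swapping the two equal columns changes the sign of the determinant but not the matrix;
  characteristic zero allows the division by 2.\<close>

lemma det_on_eq_columns:
  fixes P :: "'a \<Rightarrow> 'e \<Rightarrow> 'b :: {idom, ring_char_0}"
  assumes fin: "finite A" and "\<not> inj_on f A"
  shows "det_on A (\<lambda>i j. P i (f j)) = 0"
proof -
  obtain a b where ab: "a \<in> A" "b \<in> A" "a \<noteq> b" "f a = f b"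
    using assms(2) by (auto simp: inj_on_def)
  define q where "q = Transposition.transpose a b"
  have q: "q permutes A" using ab by (simp add: q_def permutes_swap_id)
  have "f (q j) = f j" for j using ab by (simp add: q_def Transposition.transpose_def)
  then have "det_on A (\<lambda>i j. P i (f j)) = det_on A (\<lambda>i j. P i (f (q j)))" by simp
  also have "\<dots> = of_int (sign q) * det_on A (\<lambda>i j. P i (f j))"
    by (rule det_on_permute_columns[OF fin q, where M = "\<lambda>i j. P i (f j)"])
  also have "sign q = - 1" using ab by (simp add: q_def sign_swap_id)
  finally have "2 * det_on A (\<lambda>i j. P i (f j)) = 0" by simp
  then show ?thesis by simp
qed

text \<open>Every row of the product is a combination of rows of \<open>Q\<close>; by multilinearity
  the determinant expands over all ways \<open>g\<close> of choosing one row of \<open>Q\<close> for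
  each \<open>i\<close>.\<close>

lemma det_on_column_selections:
  fixes P Q :: "_ \<Rightarrow> _ \<Rightarrow> 'b :: comm_ring_1"
  assumes fin: "finite A" and finE: "finite E"
  shows "det_on A (\<lambda>i j. \<Sum>e \<in> E. P i e * Q e j) =
    (\<Sum>g \<in> A \<rightarrow>\<^sub>E E. (\<Prod>i \<in> A. P i (g i)) * det_on A (\<lambda>i j. Q (g i) j))"
proof -
  have "det_on A (\<lambda>i j. \<Sum>e \<in> E. P i e * Q e j) =
      (\<Sum>p | p permutes A. of_int (sign p) * (\<Sum>g \<in> A \<rightarrow>\<^sub>E E. \<Prod>i \<in> A. P i (g i) * Q (g i) (p i)))"
    unfolding det_on_def using fin finE by (simp add: prod_sum_PiE)
  also have "\<dots> = (\<Sum>p | p permutes A. \<Sum>g \<in> A \<rightarrow>\<^sub>E E.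
      (\<Prod>i \<in> A. P i (g i)) * (of_int (sign p) * (\<Prod>i \<in> A. Q (g i) (p i))))"
    by (simp add: sum_distrib_left prod.distrib mult_ac)
  also have "\<dots> = (\<Sum>g \<in> A \<rightarrow>\<^sub>E E. (\<Prod>i \<in> A. P i (g i)) * det_on A (\<lambda>i j. Q (g i) j))"
    unfolding det_on_def by (subst sum.swap) (simp add: sum_distrib_left)
  finally show ?thesis .
qed

text \<open>A selection that is not injective repeats a row of \<open>Q\<close> and contributes 0.
  The injective ones are grouped by their image \<open>S\<close>: they are \<open>f S\<close>
  composed with the permutations of \<open>A\<close>, and their signs assemble the minor of
  \<open>P\<close>. The bijections \<open>f S\<close> only match \<open>A\<close> with
  \<open>S\<close>; another choice changes both minors by the same sign.\<close>

theorem det_on_Cauchy_Binet: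
  fixes P :: "'a \<Rightarrow> 'e \<Rightarrow> 'b :: {idom, ring_char_0}" and Q :: "'e \<Rightarrow> 'a \<Rightarrow> 'b"
  assumes fin: "finite A" and finE: "finite E"
    and f: "\<And>S. S \<subseteq> E \<Longrightarrow> card S = card A \<Longrightarrow> bij_betw (f S) A S"
  shows "det_on A (\<lambda>i j. \<Sum>e \<in> E. P i e * Q e j) =
    (\<Sum>S | S \<subseteq> E \<and> card S = card A.
       det_on A (\<lambda>i j. P i (f S j)) * det_on A (\<lambda>i j. Q (f S i) j))"
proof -
  define T where "T = (\<lambda>g. (\<Prod>i \<in> A. P i (g i)) * det_on A (\<lambda>i j. Q (g i) j))"
  define I where "I = {g \<in> A \<rightarrow>\<^sub>E E. inj_on g A}"
  define \<S> where "\<S> = {S. S \<subseteq> E \<and> card S = card A}"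
  have finPi: "finite (A \<rightarrow>\<^sub>E E)" using fin finE by (simp add: finite_PiE)
  have "T g = 0" if "\<not> inj_on g A" for g
    using det_on_eq_columns[OF fin that, of "\<lambda>j e. Q e j"]
      det_on_transpose[OF fin, of "\<lambda>j i. Q (g i) j"] by (simp add: T_def)
  then have "(\<Sum>g \<in> A \<rightarrow>\<^sub>E E. T g) = (\<Sum>g \<in> I. T g)"
    using finPi by (intro sum.mono_neutral_right) (auto simp: I_def)
  also have "\<dots> = (\<Sum>S \<in> \<S>. \<Sum>g \<in> {g \<in> I. g ` A = S}. T g)"
    using finPi finE by (intro sum.group[symmetric]) (auto simp: I_def \<S>_def card_image)
  also have "\<dots> = (\<Sum>S \<in> \<S>. det_on A (\<lambda>i j. P i (f S j)) * det_on A (\<lambda>i j. Q (f S i) j))"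
  proof (rule sum.cong[OF refl])
    fix S assume "S \<in> \<S>"
    then have S: "S \<subseteq> E" and fS: "bij_betw (f S) A S" using f by (auto simp: \<S>_def)
    \<comment> \<open>The permutation recovered from a selection must be the identity outside
      \<open>A\<close>, whereas the selection itself is undefined there.\<close>
    define e where "e = (\<lambda>g i. if i \<in> A then inv_into A (f S) (g i) else i)"
    have "(\<Sum>p | p permutes A. T (restrict (f S \<circ> p) A)) = (\<Sum>g \<in> {g \<in> I. g ` A = S}. T g)"
    proof (rule sum.reindex_bij_witness[where i = e and j = "\<lambda>p. restrict (f S \<circ> p) A"])
      fix p assume "p \<in> {p. p permutes A}"
      then have p: "p permutes A" by simp
      show "e (restrict (f S \<circ> p) A) = p"
      proof
        fix i show "e (restrict (f S \<circ> p) A) i = p i"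
          using bij_betw_inv_into_left[OF fS] permutes_in_image[OF p] permutes_not_in[OF p]
          by (cases "i \<in> A") (simp_all add: e_def)
      qed
      have "bij_betw (restrict (f S \<circ> p) A) A S"
        using bij_betw_trans[OF permutes_imp_bij[OF p] fS] by (rule bij_betw_cong[THEN iffD1, rotated]) simp
      then show "restrict (f S \<circ> p) A \<in> {g \<in> I. g ` A = S}"
        using S by (auto simp: I_def bij_betw_def)
    next
      fix g assume "g \<in> {g \<in> I. g ` A = S}"
      then have gS: "bij_betw g A S" and ext: "g \<in> extensional A" by (auto simp: I_def bij_betw_def PiE_def)
      show "restrict (f S \<circ> e g) A = g"
      proof
        fix i show "restrict (f S \<circ> e g) A i = g i"
          using bij_betw_inv_into_right[OF fS] bij_betwE[OF gS] extensional_arb[OF ext]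
          by (cases "i \<in> A") (simp_all add: e_def)
      qed
      have "bij_betw (inv_into A (f S) \<circ> g) A A"
        using bij_betw_trans[OF gS bij_betw_inv_into[OF fS]] .
      then have "bij_betw (e g) A A"
        by (rule bij_betw_cong[THEN iffD1, rotated]) (simp add: e_def)
      then show "e g \<in> {p. p permutes A}"
        using bij_imp_permutes[of "e g" A] by (simp add: e_def)
    qed simp
    moreover have "T (restrict (f S \<circ> p) A) =
        of_int (sign p) * (\<Prod>i \<in> A. P i (f S (p i))) * det_on A (\<lambda>i j. Q (f S i) j)"
      if p: "p permutes A" for p
    proof -
      have "det_on A (\<lambda>i j. Q (restrict (f S \<circ> p) A i) j) = det_on A (\<lambda>i j. Q (f S (p i)) j)"
        by (rule det_on_cong) simp
      also have "\<dots> = det_on A (\<lambda>j i. Q (f S (p i)) j)"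
        by (rule det_on_transpose[OF fin])
      also have "\<dots> = of_int (sign p) * det_on A (\<lambda>i j. Q (f S i) j)"
        using det_on_permute_columns[OF fin p, of "\<lambda>j i. Q (f S i) j"]
          det_on_transpose[OF fin, of "\<lambda>j i. Q (f S i) j"] by simp
      finally show ?thesis by (simp add: T_def mult_ac)
    qed
    ultimately show "(\<Sum>g \<in> {g \<in> I. g ` A = S}. T g) =
        det_on A (\<lambda>i j. P i (f S j)) * det_on A (\<lambda>i j. Q (f S i) j)"
      by (simp add: det_on_def[of A "\<lambda>i j. P i (f S j)"] sum_distrib_right)
  qed
  finally show ?thesis
    using det_on_column_selections[OF fin finE, of P Q] by (simp add: T_def \<S>_def)
qed

lemma det_on_mult:
  fixes P Q :: "_ \<Rightarrow> _ \<Rightarrow> 'b :: {idom, ring_char_0}"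
  assumes fin: "finite A"
  shows "det_on A (\<lambda>i j. \<Sum>k \<in> A. P i k * Q k j) = det_on A P * det_on A Q"
proof -
  have *: "S \<subseteq> A \<and> card S = card A \<longleftrightarrow> S = A" for S
    using card_subset_eq[OF fin] by auto
  show ?thesis
    by (subst det_on_Cauchy_Binet[OF fin fin, where f = "\<lambda>_ i. i"]) (use * in \<open>auto simp: bij_betw_def\<close>)
qed

section \<open>Block, triangular and elementary matrices\<close>

lemma det_on_reindex:
  assumes fin: "finite A" and f: "bij_betw f A B"
  shows "det_on A (\<lambda>i j. M (f i) (f j)) = det_on B M"
proof -
  have inj: "inj_on f A" using f by (simp add: bij_betw_def)
  have f': "bij_betw (inv_into A f) B A" using f by (rule bij_betw_inv_into)
  have 1: "map_permutation B (inv_into A f) (map_permutation A f p) = p" if "p permutes A" for p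
    using that f by (intro map_permutation_compose_inv) (auto simp: bij_betw_inv_into_left)
  have 2: "map_permutation A f (map_permutation B (inv_into A f) p) = p" if "p permutes B" for p
    using that f f' by (intro map_permutation_compose_inv) (auto simp: bij_betw_inv_into_right)
  have "(\<Prod>i \<in> B. M i (map_permutation A f p i)) = (\<Prod>i \<in> A. M (f i) (f (p i)))" for p
    using prod.reindex_bij_betw[OF f, of "\<lambda>i. M i (map_permutation A f p i)"]
    by (simp add: map_permutation_apply[OF inj])
  then show ?thesis
    unfolding det_on_def
    by (intro sum.reindex_bij_witness[where i = "map_permutation B (inv_into A f)" and j = "map_permutation A f"])
      (auto simp: 1 2 map_permutation_permutes[OF f] map_permutation_permutes[OF f']
        sign_map_permutation[OF inj _ fin])
qed

text \<open>A permutation that moves some element of \<open>A\<close> into \<open>B\<close> picks a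
  zero entry. The others map \<open>A\<close> onto itself by finiteness, hence also
  \<open>B\<close>, and are exactly the compositions of a permutation of \<open>A\<close> with one
  of \<open>B\<close>.\<close>

lemma det_on_block_triangular:
  assumes fin: "finite A" "finite B" and disj: "A \<inter> B = {}"
    and zero: "\<And>i j. i \<in> A \<Longrightarrow> j \<in> B \<Longrightarrow> M i j = 0"
  shows "det_on (A \<union> B) M = det_on A M * det_on B M"
proof -
  define T where "T = (\<lambda>p. of_int (sign p) * (\<Prod>i \<in> A \<union> B. M i (p i)))"
  define \<P> where "\<P> = {p. p permutes A \<union> B \<and> p ` A \<subseteq> A}"
  have "(\<Sum>p | p permutes A \<union> B. T p) = (\<Sum>p \<in> \<P>. T p)"
  proof (rule sum.mono_neutral_right)
    show "finite {p. p permutes A \<union> B}" using fin by (simp add: finite_permutations)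
    show "\<forall>p \<in> {p. p permutes A \<union> B} - \<P>. T p = 0"
    proof
      fix p assume p: "p \<in> {p. p permutes A \<union> B} - \<P>"
      then obtain i where i: "i \<in> A" "p i \<notin> A" by (auto simp: \<P>_def)
      then have "p i \<in> B" using p permutes_in_image[of p "A \<union> B" i] by auto
      then have "(\<Prod>i \<in> A \<union> B. M i (p i)) = 0"
        using zero i fin by (intro prod_zero) auto
      then show "T p = 0" by (simp add: T_def)
    qed
  qed (auto simp: \<P>_def)
  also have "\<dots> = (\<Sum>(p, q) \<in> {p. p permutes A} \<times> {q. q permutes B}. T (p \<circ> q))"
  proof (rule sum.reindex_bij_witness[where
        j = "\<lambda>r. (\<lambda>i. if i \<in> A then r i else i, \<lambda>i. if i \<in> B then r i else i)" and i = "\<lambda>(p, q). p \<circ> q"])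
    fix r assume r: "r \<in> \<P>"
    then have rp: "r permutes A \<union> B" by (simp add: \<P>_def)
    have rA: "r ` A = A"
      using r fin by (intro card_subset_eq) (auto simp: \<P>_def card_image permutes_inj_on)
    have rB: "r ` B \<subseteq> B"
    proof
      fix y assume "y \<in> r ` B"
      then obtain x where x: "x \<in> B" "y = r x" by auto
      then have "y \<in> A \<union> B" using permutes_in_image[OF rp, of x] by auto
      moreover have "y \<notin> A"
      proof
        assume "y \<in> A"
        then obtain z where "z \<in> A" "r z = r x" using rA x by (metis imageE)
        then show False using permutes_inj[OF rp] x disj by (auto dest: injD)
      qed
      ultimately show "y \<in> B" by auto
    qed
    have pA: "(\<lambda>i. if i \<in> A then r i else i) permutes A"
      using rA fin by (intro inj_imp_permutes) (auto simp: inj_on_def dest: injD[OF permutes_inj[OF rp]])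
    have pB: "(\<lambda>i. if i \<in> B then r i else i) permutes B"
      using rB fin by (intro inj_imp_permutes) (auto simp: inj_on_def dest: injD[OF permutes_inj[OF rp]])
    show "(\<lambda>i. if i \<in> A then r i else i, \<lambda>i. if i \<in> B then r i else i)
        \<in> {p. p permutes A} \<times> {q. q permutes B}"
      using pA pB by simp
    show *: "(case (\<lambda>i. if i \<in> A then r i else i, \<lambda>i. if i \<in> B then r i else i) of (p, q) \<Rightarrow> p \<circ> q) = r"
    proof
      fix i
      consider "i \<in> A" | "i \<in> B" "i \<notin> A" | "i \<notin> A \<union> B" by blast
      then show "(case (\<lambda>i. if i \<in> A then r i else i, \<lambda>i. if i \<in> B then r i else i) of
          (p, q) \<Rightarrow> p \<circ> q) i = r i"
      proof cases
        case 1
        then have "i \<notin> B" using disj by blast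
        then show ?thesis using 1 by simp
      next
        case 2
        then have "r i \<notin> A" using rB disj by blast
        then show ?thesis using 2 by simp
      next
        case 3
        then show ?thesis using permutes_not_in[OF rp 3] by simp
      qed
    qed
    then show "(case (\<lambda>i. if i \<in> A then r i else i, \<lambda>i. if i \<in> B then r i else i) of
        (p, q) \<Rightarrow> T (p \<circ> q)) = T r" by simp
  next
    fix pq assume "pq \<in> {p. p permutes A} \<times> {q. q permutes B}"
    then obtain p q where pq: "pq = (p, q)" "p permutes A" "q permutes B" by auto
    have B: "i \<in> B \<Longrightarrow> q i \<in> B \<and> q i \<notin> A" for i
      using pq(3) disj permutes_in_image by fastforce
    have "p permutes A \<union> B" "q permutes A \<union> B"
      using pq by (auto intro: permutes_subset)
    moreover have A: "q i = i" if "i \<in> A" for i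
      using that disj permutes_not_in[OF pq(3), of i] by (auto simp: disjoint_iff)
    ultimately show "(case pq of (p, q) \<Rightarrow> p \<circ> q) \<in> \<P>"
      using pq(1) permutes_in_image[OF pq(2)] by (auto simp: \<P>_def intro!: permutes_compose)
    show "(\<lambda>i. if i \<in> A then (case pq of (p, q) \<Rightarrow> p \<circ> q) i else i,
        \<lambda>i. if i \<in> B then (case pq of (p, q) \<Rightarrow> p \<circ> q) i else i) = pq"
    proof -
      have "(if i \<in> A then (p \<circ> q) i else i) = p i" for i
        using A permutes_not_in[OF pq(2), of i] by (cases "i \<in> A") simp_all
      moreover have "(if i \<in> B then (p \<circ> q) i else i) = q i" for i
        using B[of i] permutes_not_in[OF pq(2), of "q i"] permutes_not_in[OF pq(3), of i]
        by (cases "i \<in> B") simp_all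
      ultimately show ?thesis by (simp only: pq(1) prod.case)
    qed
  qed
  also have "\<dots> = (\<Sum>(p, q) \<in> {p. p permutes A} \<times> {q. q permutes B}.
      (of_int (sign p) * (\<Prod>i \<in> A. M i (p i))) * (of_int (sign q) * (\<Prod>i \<in> B. M i (q i))))"
  proof (rule sum.cong[OF refl], clarify)
    fix p q assume p: "p permutes A" and q: "q permutes B"
    have "sign (p \<circ> q) = sign p * sign q"
      using permutes_imp_permutation fin p q by (intro sign_compose) blast+
    moreover have "(\<Prod>i \<in> A. M i ((p \<circ> q) i)) = (\<Prod>i \<in> A. M i (p i))"
    proof (intro prod.cong refl)
      fix i assume "i \<in> A"
      then have "i \<notin> B" using disj by blast
      then show "M i ((p \<circ> q) i) = M i (p i)" using q by (simp add: permutes_not_in)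
    qed
    moreover have "(\<Prod>i \<in> B. M i ((p \<circ> q) i)) = (\<Prod>i \<in> B. M i (q i))"
    proof (intro prod.cong refl)
      fix i assume "i \<in> B"
      then have "q i \<notin> A" using q disj permutes_in_image[OF q, of i] by auto
      then show "M i ((p \<circ> q) i) = M i (q i)" using p by (simp add: permutes_not_in)
    qed
    ultimately show "T (p \<circ> q) =
        (of_int (sign p) * (\<Prod>i \<in> A. M i (p i))) * (of_int (sign q) * (\<Prod>i \<in> B. M i (q i)))"
      using fin disj by (simp add: T_def prod.union_disjoint mult_ac)
  qed
  also have "\<dots> = det_on A M * det_on B M"
    by (simp add: det_on_def sum_product sum.cartesian_product)
  finally show ?thesis by (simp add: det_on_def T_def)
qed

text \<open>One class is split off at a time. \<open>K\<close> may contain labels that no index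
  carries, as happens for components without vertices in the row set and for characters without a
  block; such a class contributes the empty determinant 1.\<close>

lemma det_on_block_diagonal:
  assumes fin: "finite A" and K: "finite K" "\<kappa> ` A \<subseteq> K"
    and zero: "\<And>i j. i \<in> A \<Longrightarrow> j \<in> A \<Longrightarrow> \<kappa> i \<noteq> \<kappa> j \<Longrightarrow> M i j = 0"
  shows "det_on A M = (\<Prod>k \<in> K. det_on {i \<in> A. \<kappa> i = k} M)"
  using K(1) fin K(2) zero
proof (induction K arbitrary: A)
  case (insert k K)
  have A: "A = {i \<in> A. \<kappa> i = k} \<union> {i \<in> A. \<kappa> i \<noteq> k}" by auto
  have "det_on A M = det_on {i \<in> A. \<kappa> i = k} M * det_on {i \<in> A. \<kappa> i \<noteq> k} M"
    by (subst A, rule det_on_block_triangular) (use insert.prems in auto)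
  also have "det_on {i \<in> A. \<kappa> i \<noteq> k} M = (\<Prod>l \<in> K. det_on {i \<in> {i \<in> A. \<kappa> i \<noteq> k}. \<kappa> i = l} M)"
    by (rule insert.IH) (use insert.prems in auto)
  also have "\<dots> = (\<Prod>l \<in> K. det_on {i \<in> A. \<kappa> i = l} M)"
    using insert.hyps by (intro prod.cong refl arg_cong2[where f = det_on]) auto
  finally show ?case using insert.hyps by simp
qed simp

text \<open>The rank \<open>r\<close> replaces a linear order and may take equal values. If a
  permutation other than the identity had a nonzero product, then \<open>r\<close> would increase
  along it wherever it moves an index, yet the sum of \<open>r\<close> over \<open>A\<close> is
  invariant under permutations.\<close>

lemma det_on_triangular:
  fixes r :: "'a \<Rightarrow> nat" and M :: "'a \<Rightarrow> 'a \<Rightarrow> 'b :: idom"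
  assumes fin: "finite A"
    and tri: "\<And>i j. i \<in> A \<Longrightarrow> j \<in> A \<Longrightarrow> i \<noteq> j \<Longrightarrow> M i j \<noteq> 0 \<Longrightarrow> r i < r j"
  shows "det_on A M = (\<Prod>i \<in> A. M i i)"
proof -
  have "(\<Prod>i \<in> A. M i (p i)) = 0" if p: "p permutes A" and "p \<noteq> id" for p
  proof (rule ccontr)
    assume "(\<Prod>i \<in> A. M i (p i)) \<noteq> 0"
    then have nz: "M i (p i) \<noteq> 0" if "i \<in> A" for i using that fin by auto
    have lt: "r i < r (p i)" if "i \<in> A" "p i \<noteq> i" for i
      using tri[of i "p i"] nz that p by (auto simp: permutes_in_image)
    obtain i where i: "p i \<noteq> i" using \<open>p \<noteq> id\<close> by (auto simp: fun_eq_iff)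
    then have "i \<in> A" using p permutes_not_in by metis
    have "(\<Sum>i \<in> A. r i) < (\<Sum>i \<in> A. r (p i))"
    proof (rule sum_strict_mono_ex1[OF fin])
      show "\<forall>i \<in> A. r i \<le> r (p i)" using lt by (metis less_imp_le order_refl)
    qed (use lt i \<open>i \<in> A\<close> in blast)
    also have "\<dots> = (\<Sum>i \<in> A. r i)" using sum.permute[OF p, of r] by (simp add: o_def)
    finally show False by simp
  qed
  then have "det_on A M = (\<Sum>p \<in> {id}. of_int (sign p) * (\<Prod>i \<in> A. M i (p i)))"
    unfolding det_on_def using fin
    by (intro sum.mono_neutral_right) (auto simp: finite_permutations permutes_id)
  then show ?thesis by simp
qed

lemma det_on_diagonal:
  fixes M :: "'a \<Rightarrow> 'a \<Rightarrow> 'b :: idom"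
  assumes "finite A" "\<And>i j. i \<in> A \<Longrightarrow> j \<in> A \<Longrightarrow> i \<noteq> j \<Longrightarrow> M i j = 0"
  shows "det_on A M = (\<Prod>i \<in> A. M i i)"
  by (rule det_on_triangular[where r = "\<lambda>_. 0"]) (use assms in auto)

text \<open>The new matrix is \<open>M\<close> times the identity matrix with column
  \<open>a\<close> replaced by \<open>x\<close>, and that factor is triangular with the only
  nontrivial diagonal entry \<open>x a\<close>.\<close>

lemma det_on_column_combination:
  fixes M :: "'a \<Rightarrow> 'a \<Rightarrow> 'b :: {idom, ring_char_0}"
  assumes fin: "finite A" and a: "a \<in> A"
  shows "det_on A (\<lambda>i j. if j = a then \<Sum>k \<in> A. M i k * x k else M i j) = x a * det_on A M"
proof -
  define T where "T = (\<lambda>k j. if j = a then x k else if k = j then 1 else 0 :: 'b)"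
  have "det_on A (\<lambda>i j. if j = a then \<Sum>k \<in> A. M i k * x k else M i j) =
      det_on A (\<lambda>i j. \<Sum>k \<in> A. M i k * T k j)"
  proof (rule det_on_cong)
    fix i j assume "j \<in> A"
    have "(\<Sum>k \<in> A. M i k * T k j) = (\<Sum>k \<in> A. if k = j then M i k else 0)" if "j \<noteq> a"
      using that by (intro sum.cong) (auto simp: T_def)
    then show "(if j = a then \<Sum>k \<in> A. M i k * x k else M i j) = (\<Sum>k \<in> A. M i k * T k j)"
      using fin \<open>j \<in> A\<close> by (simp add: T_def)
  qed
  also have "\<dots> = det_on A M * det_on A T" by (rule det_on_mult[OF fin])
  also have "det_on A T = (\<Prod>i \<in> A. T i i)"
    by (rule det_on_triangular[OF fin, where r = "\<lambda>i. if i = a then 1 else 0"]) (auto simp: T_def split: if_splits)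
  also have "\<dots> = x a" using fin a by (simp add: T_def prod.remove[OF fin a])
  finally show ?thesis by simp
qed

lemma det_on_unit_column:
  assumes fin: "finite A" and a: "a \<in> A" and "\<And>i. i \<in> A \<Longrightarrow> i \<noteq> a \<Longrightarrow> M i a = 0"
  shows "det_on A M = M a a * det_on (A - {a}) M"
proof -
  have "det_on ((A - {a}) \<union> {a}) M = det_on (A - {a}) M * det_on {a} M"
    by (rule det_on_block_triangular) (use assms in auto)
  moreover have "det_on {a} M = M a a" by (simp add: det_on_def)
  ultimately show ?thesis using a by (simp add: insert_absorb mult.commute)
qed

text \<open>With \<open>P\<close> adding all rows to the row \<open>r\<close> and \<open>Q\<close> adding multiples of the row \<open>r\<close> to the others,
  \<open>P (L + c c\<^sup>T) P\<^sup>T = Q L' Q\<^sup>T\<close>, where \<open>L'\<close> is \<open>L\<close> with the row and the column of \<open>r\<close> replaced by zeros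
  and the diagonal entry \<open>(\<Sum> c)\<^sup>2\<close>.\<close>

lemma det_on_rank_one_perturbation:
  fixes L :: "'a \<Rightarrow> 'a \<Rightarrow> 'b :: field_char_0"
  assumes fin: "finite A" and r: "r \<in> A" and s: "(\<Sum>k \<in> A. c k) \<noteq> 0"
    and rows: "\<And>i. i \<in> A \<Longrightarrow> (\<Sum>j \<in> A. L i j) = 0"
    and cols: "\<And>j. j \<in> A \<Longrightarrow> (\<Sum>i \<in> A. L i j) = 0"
  shows "det_on A (\<lambda>i j. L i j + c i * c j) = (\<Sum>k \<in> A. c k)\<^sup>2 * det_on (A - {r}) L"
proof -
  define s where "s = (\<Sum>k \<in> A. c k)"
  define P where "P = (\<lambda>i j. if i = j \<or> i = r then 1 else 0 :: 'b)"
  define Q where "Q = (\<lambda>i j. if i = j then 1 else if j = r then c i / s else 0)"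
  define L' where "L' = (\<lambda>i j. if i = r \<and> j = r then s\<^sup>2 else if i = r \<or> j = r then 0 else L i j)"
  have P: "det_on A P = 1"
    by (subst det_on_triangular[OF fin, where r = "\<lambda>i. if i = r then 0 else 1"])
      (auto simp: P_def split: if_splits)
  have Q: "det_on A Q = 1"
    by (subst det_on_triangular[OF fin, where r = "\<lambda>i. if i = r then 1 else 0"])
      (auto simp: Q_def split: if_splits)
  have Psum: "(\<Sum>k \<in> A. P i k * f k) = (if i = r then \<Sum>k \<in> A. f k else f i)" if "i \<in> A" for f i
  proof (cases "i = r")
    case False
    then have "(\<Sum>k \<in> A. P i k * f k) = (\<Sum>k \<in> A. if k = i then f k else 0)"
      by (intro sum.cong) (auto simp: P_def)
    then show ?thesis using False that fin by (simp add: sum.delta)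
  qed (simp add: P_def)
  have Qsum: "(\<Sum>k \<in> A. Q i k * f k) = (if i = r then f r else f i + c i / s * f r)" if "i \<in> A" for f i
  proof -
    have "(\<Sum>k \<in> A. Q i k * f k) =
        (\<Sum>k \<in> A. (if k = i then f k else 0) + (if k = r then (if i = r then 0 else c i / s * f k) else 0))"
      by (intro sum.cong) (auto simp: Q_def)
    then show ?thesis using that fin r by (simp add: sum.distrib sum.delta)
  qed
  have s0: "s \<noteq> 0" using s by (simp add: s_def)
  have PT: "det_on A (\<lambda>i j. \<Sum>k \<in> A. (\<Sum>l \<in> A. P i l * M l k) * P j k) = det_on A M" for M :: "'a \<Rightarrow> 'a \<Rightarrow> 'b"
    using det_on_mult[OF fin, of "\<lambda>i k. \<Sum>l \<in> A. P i l * M l k" "\<lambda>k j. P j k"]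
      det_on_mult[OF fin, of P M] det_on_transpose[OF fin, of P] P by simp
  have QT: "det_on A (\<lambda>i j. \<Sum>k \<in> A. (\<Sum>l \<in> A. Q i l * M l k) * Q j k) = det_on A M" for M :: "'a \<Rightarrow> 'a \<Rightarrow> 'b"
    using det_on_mult[OF fin, of "\<lambda>i k. \<Sum>l \<in> A. Q i l * M l k" "\<lambda>k j. Q j k"]
      det_on_mult[OF fin, of Q M] det_on_transpose[OF fin, of Q] Q by simp
  \<comment> \<open>Both congruences give the entry \<open>s * s\<close> at the position of
    \<open>r\<close>, the multiples of \<open>c\<close> by \<open>s\<close> in the rest of its row
    and column, and \<open>L i j + c i * c j\<close> elsewhere. On the left the zero row and column
    sums remove \<open>L\<close> from the row and the column of \<open>r\<close>; on the right the
    division by \<open>s\<close> in \<open>Q\<close> compensates the square.\<close>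
  have "(\<Sum>k \<in> A. (\<Sum>l \<in> A. P i l * (L l k + c l * c k)) * P j k) =
      (\<Sum>k \<in> A. (\<Sum>l \<in> A. Q i l * L' l k) * Q j k)" if i: "i \<in> A" and j: "j \<in> A" for i j
  proof -
    have "(\<Sum>k \<in> A. (\<Sum>l \<in> A. P i l * (L l k + c l * c k)) * P j k) =
        (\<Sum>k \<in> A. P j k * (if i = r then s * c k else L i k + c i * c k))"
      using cols by (intro sum.cong refl)
        (simp add: Psum[OF i] sum.distrib sum_distrib_left[symmetric] sum_distrib_right[symmetric] s_def mult_ac)
    also have "\<dots> = (if j = r then (if i = r then s * s else c i * s)
        else if i = r then s * c j else L i j + c i * c j)"
      using rows[OF i] by (auto simp: Psum[OF j] sum.distrib sum_distrib_left[symmetric] s_def)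
    also have "\<dots> = (\<Sum>k \<in> A. Q j k * (if i = r then L' r k else L' i k + c i / s * L' r k))"
      unfolding Qsum[OF j] using s0
      by (cases "i = r"; cases "j = r") (simp_all add: L'_def power2_eq_square)
    also have "\<dots> = (\<Sum>k \<in> A. (\<Sum>l \<in> A. Q i l * L' l k) * Q j k)"
      unfolding Qsum[OF i] by (rule sum.cong[OF refl], rule mult.commute)
    finally show ?thesis .
  qed
  then have "det_on A (\<lambda>i j. L i j + c i * c j) = det_on A L'"
    unfolding PT[of "\<lambda>i j. L i j + c i * c j", symmetric] QT[of L', symmetric] by (rule det_on_cong)
  also have "\<dots> = L' r r * det_on (A - {r}) L'"
    by (rule det_on_unit_column[OF fin r]) (simp add: L'_def)
  also have "det_on (A - {r}) L' = det_on (A - {r}) L"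
    by (rule det_on_cong) (simp add: L'_def)
  finally show ?thesis by (simp add: L'_def s_def)
qed


section \<open>Evaluation of polynomials\<close>

definition monom_eval :: "('e \<Rightarrow> 'b :: comm_ring_1) \<Rightarrow> ('e \<Rightarrow>\<^sub>0 nat) \<Rightarrow> 'b" where
  "monom_eval \<sigma> m = (\<Prod>e \<in> Poly_Mapping.keys m. \<sigma> e ^ Poly_Mapping.lookup m e)"

lemma monom_eval_superset:
  assumes "finite K" "Poly_Mapping.keys m \<subseteq> K"
  shows "monom_eval \<sigma> m = (\<Prod>e \<in> K. \<sigma> e ^ Poly_Mapping.lookup m e)"
  unfolding monom_eval_def using assms
  by (intro prod.mono_neutral_left) (auto simp: in_keys_iff)

lemma monom_eval_zero [simp]: "monom_eval \<sigma> 0 = 1"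
  by (simp add: monom_eval_def)

lemma monom_eval_add: "monom_eval \<sigma> (m + n) = monom_eval \<sigma> m * monom_eval \<sigma> n"
proof -
  define K where "K = Poly_Mapping.keys m \<union> Poly_Mapping.keys n"
  have K: "finite K" "Poly_Mapping.keys m \<subseteq> K" "Poly_Mapping.keys n \<subseteq> K" "Poly_Mapping.keys (m + n) \<subseteq> K"
    using Poly_Mapping.keys_add[of m n] by (auto simp: K_def)
  show ?thesis
    using K by (simp add: monom_eval_superset[of K] lookup_add power_add prod.distrib)
qed

lemma monom_eval_one: "monom_eval (\<lambda>_. 1) m = 1"
  by (simp add: monom_eval_def)

lemma poly_mapping_as_sum: "P = (\<Sum>m \<in> Poly_Mapping.keys P. Poly_Mapping.single m (Poly_Mapping.lookup P m))"
  by (rule poly_mapping_eqI)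
    (auto simp: lookup_sum lookup_single when_def in_keys_iff sum.delta' cong: if_cong)

text \<open>Two evaluations share this theory: integral polynomials through \<open>of_int\<close>,
  used both for the substitution of variables and for real points, and real polynomials through the
  identity.\<close>

locale coefficient_hom =
  fixes \<phi> :: "'a :: comm_ring_1 \<Rightarrow> 'b :: comm_ring_1"
  assumes hom_one: "\<phi> 1 = 1" and hom_add: "\<phi> (a + b) = \<phi> a + \<phi> b" and hom_mult: "\<phi> (a * b) = \<phi> a * \<phi> b"
begin

lemma hom_zero: "\<phi> 0 = 0"
  using hom_add[of 0 0] by simp

definition eval :: "('e \<Rightarrow> 'b) \<Rightarrow> ('e, 'a) mpoly \<Rightarrow> 'b" where
  "eval \<sigma> P = (\<Sum>m \<in> Poly_Mapping.keys P. \<phi> (Poly_Mapping.lookup P m) * monom_eval \<sigma> m)"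

lemma eval_superset:
  assumes "finite K" "Poly_Mapping.keys P \<subseteq> K"
  shows "eval \<sigma> P = (\<Sum>m \<in> K. \<phi> (Poly_Mapping.lookup P m) * monom_eval \<sigma> m)"
  unfolding eval_def using assms
  by (intro sum.mono_neutral_left) (auto simp: in_keys_iff hom_zero)

lemma eval_zero [simp]: "eval \<sigma> 0 = 0"
  by (simp add: eval_def)

lemma eval_single: "eval \<sigma> (Poly_Mapping.single m c) = \<phi> c * monom_eval \<sigma> m"
  by (simp add: eval_def hom_zero)

lemma eval_Const: "eval \<sigma> (Const c) = \<phi> c"
  by (simp add: Const_def eval_single)

lemma eval_one [simp]: "eval \<sigma> 1 = 1"
  using eval_single[of \<sigma> 0 1] by (simp add: hom_one)

lemma eval_Var: "eval \<sigma> (Var e) = \<sigma> e"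
  by (simp add: Var_def eval_single hom_one monom_eval_def)

lemma eval_add: "eval \<sigma> (P + Q) = eval \<sigma> P + eval \<sigma> Q"
proof -
  define K where "K = Poly_Mapping.keys P \<union> Poly_Mapping.keys Q"
  have K: "finite K" "Poly_Mapping.keys P \<subseteq> K" "Poly_Mapping.keys Q \<subseteq> K" "Poly_Mapping.keys (P + Q) \<subseteq> K"
    using Poly_Mapping.keys_add[of P Q] by (auto simp: K_def)
  show ?thesis
    using K by (simp add: eval_superset[of K] lookup_add hom_add algebra_simps sum.distrib)
qed

lemma eval_sum: "eval \<sigma> (\<Sum>i \<in> I. P i) = (\<Sum>i \<in> I. eval \<sigma> (P i))"
  by (induction I rule: infinite_finite_induct) (simp_all add: eval_add)

lemma eval_mult: "eval \<sigma> (P * Q) = eval \<sigma> P * eval \<sigma> Q"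
proof -
  have "P * Q = (\<Sum>m \<in> Poly_Mapping.keys P. \<Sum>n \<in> Poly_Mapping.keys Q.
      Poly_Mapping.single (m + n) (Poly_Mapping.lookup P m * Poly_Mapping.lookup Q n))"
    by (subst poly_mapping_as_sum[of P], subst poly_mapping_as_sum[of Q])
      (simp add: sum_product mult_single)
  then show ?thesis
    by (simp add: eval_sum eval_single hom_mult monom_eval_add sum_product eval_def[of \<sigma> P]
        eval_def[of \<sigma> Q] mult_ac)
qed

lemma eval_prod: "eval \<sigma> (\<Prod>i \<in> I. P i) = (\<Prod>i \<in> I. eval \<sigma> (P i))"
  by (induction I rule: infinite_finite_induct) (simp_all add: eval_mult)

end

interpretation int_coeff: coefficient_hom "of_int :: int \<Rightarrow> 'b :: comm_ring_1"
  by standard simp_all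

interpretation real_coeff: coefficient_hom "\<lambda>c :: real. c"
  by standard simp_all

lemma substitute_eq_eval: "substitute \<sigma> P = int_coeff.eval \<sigma> P"
  by (simp add: substitute_def int_coeff.eval_def monom_eval_def)

lemma real_eval_real_mpoly: "real_coeff.eval x (real_mpoly P) = int_coeff.eval x P"
proof -
  have lk: "Poly_Mapping.lookup (real_mpoly P) m = real_of_int (Poly_Mapping.lookup P m)" for m
    by (simp add: real_mpoly_def Poly_Mapping.map.rep_eq when_def)
  then have "Poly_Mapping.keys (real_mpoly P) = Poly_Mapping.keys P"
    by (auto simp: in_keys_iff)
  then show ?thesis by (simp add: int_coeff.eval_def real_coeff.eval_def lk)
qed

text \<open>Evaluations at monomials are distinct characters of the multiplicative monoid of points;
  this is Dedekind's argument for their linear independence.\<close>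

lemma monom_evals_independent:
  fixes c :: "('e \<Rightarrow>\<^sub>0 nat) \<Rightarrow> real"
  assumes "finite K" "\<And>x. (\<And>e. 0 < x e) \<Longrightarrow> (\<Sum>m \<in> K. c m * monom_eval x m) = 0" "m \<in> K"
  shows "c m = 0"
  using assms
proof (induction K arbitrary: c m)
  case (insert k K)
  have other: "c m = 0" if m: "m \<in> K" for m
  proof -
    have "m \<noteq> k" using m insert.hyps by auto
    then obtain e where e: "Poly_Mapping.lookup m e \<noteq> Poly_Mapping.lookup k e"
      by (meson poly_mapping_eqI)
    \<comment> \<open>Doubling the single variable \<open>e\<close> keeps the point positive and
      separates \<open>m\<close> from \<open>k\<close>, because different powers of 2 are
      different.\<close>
    define y where "y = (\<lambda>e'. if e' = e then 2 else 1 :: real)"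
    have y: "monom_eval y n = 2 ^ Poly_Mapping.lookup n e" for n
    proof -
      have "monom_eval y n = (\<Prod>e' \<in> insert e (Poly_Mapping.keys n). y e' ^ Poly_Mapping.lookup n e')"
        by (rule monom_eval_superset) auto
      also have "\<dots> = (\<Prod>e' \<in> insert e (Poly_Mapping.keys n). if e' = e then 2 ^ Poly_Mapping.lookup n e' else 1)"
        by (rule prod.cong) (auto simp: y_def)
      finally show ?thesis by (simp add: prod.delta)
    qed
    \<comment> \<open>The relation at the point \<open>x * y\<close> minus
      \<open>monom_eval y k\<close> times the relation at \<open>x\<close>: the term of
      \<open>k\<close> cancels, which leaves a relation over the smaller set
      \<open>K\<close>.\<close>
    define c' where "c' = (\<lambda>n. c n * (monom_eval y n - monom_eval y k))"
    have "(\<Sum>n \<in> K. c' n * monom_eval x n) = 0" if x: "\<And>e. 0 < x e" for x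
    proof -
      have "0 < x e * y e" for e using x[of e] by (simp add: y_def)
      then have "(\<Sum>n \<in> insert k K. c n * monom_eval (\<lambda>e. x e * y e) n) = 0"
        using insert.prems(1)[of "\<lambda>e. x e * y e"] by simp
      moreover have "monom_eval (\<lambda>e. x e * y e) n = monom_eval x n * monom_eval y n" for n
        by (simp add: monom_eval_def power_mult_distrib prod.distrib)
      ultimately have "0 = (\<Sum>n \<in> insert k K. c n * (monom_eval x n * monom_eval y n)) -
          monom_eval y k * (\<Sum>n \<in> insert k K. c n * monom_eval x n)"
        using insert.prems(1)[OF x] by simp
      also have "\<dots> = (\<Sum>n \<in> insert k K. c' n * monom_eval x n)"
        by (simp only: sum_distrib_left sum_subtractf[symmetric] c'_def) (simp add: algebra_simps)
      also have "\<dots> = (\<Sum>n \<in> K. c' n * monom_eval x n)"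
        using insert.hyps by (simp add: c'_def)
      finally show ?thesis by simp
    qed
    then have "c' m = 0" using insert.IH m by blast
    then show ?thesis using e by (simp add: c'_def y)
  qed
  show ?case
  proof (cases "m = k")
    case True
    have "(\<Sum>n \<in> insert k K. c n * monom_eval (\<lambda>_. 1) n) = c k"
      using insert.hyps other by (simp add: monom_eval_one)
    then show ?thesis using True insert.prems(1)[of "\<lambda>_. 1"] by simp
  qed (use insert.prems other in auto)
qed simp

text \<open>Testing at positive points only makes the edge weights \<open>1 / x e\<close> available
  in the comparison of the two sides.\<close>

lemma mpoly_eqI_positive:
  fixes P Q :: "('e, real) mpoly"
  assumes "\<And>x. (\<And>e. 0 < x e) \<Longrightarrow> real_coeff.eval x P = real_coeff.eval x Q"
  shows "P = Q"
proof (rule poly_mapping_eqI)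
  fix m
  define K where "K = insert m (Poly_Mapping.keys P \<union> Poly_Mapping.keys Q)"
  have K: "finite K" "Poly_Mapping.keys P \<subseteq> K" "Poly_Mapping.keys Q \<subseteq> K" "m \<in> K"
    by (auto simp: K_def)
  have "Poly_Mapping.lookup P m - Poly_Mapping.lookup Q m = 0"
  proof (rule monom_evals_independent[OF K(1) _ K(4)])
    fix x :: "'e \<Rightarrow> real" assume "\<And>e. 0 < x e"
    then have "real_coeff.eval x P - real_coeff.eval x Q = 0" using assms by simp
    then show "(\<Sum>m \<in> K. (Poly_Mapping.lookup P m - Poly_Mapping.lookup Q m) * monom_eval x m) = 0"
      using K by (simp add: real_coeff.eval_superset[of K] left_diff_distrib sum_subtractf)
  qed
  then show "Poly_Mapping.lookup P m = Poly_Mapping.lookup Q m" by simp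
qed


section \<open>Characters of finite abelian groups\<close>

definition characters :: "('g, 'm) monoid_scheme \<Rightarrow> ('g \<Rightarrow> complex) set" where
  "characters G = hom G complex_units \<inter> extensional (carrier G)"

text \<open>A character that is given only on \<open>K\<close>, the object which is enlarged step by
  step in the extension argument.\<close>

definition multiplicative_on :: "('g, 'm) monoid_scheme \<Rightarrow> 'g set \<Rightarrow> ('g \<Rightarrow> complex) \<Rightarrow> bool" where
  "multiplicative_on G K \<chi> \<longleftrightarrow>
     (\<forall>x \<in> K. \<chi> x \<noteq> 0) \<and> (\<forall>x \<in> K. \<forall>y \<in> K. \<chi> (x \<otimes>\<^bsub>G\<^esub> y) = \<chi> x * \<chi> y)"

lemma nontrivial_characters_eq: "nontrivial_characters G = characters G - {\<lambda>g \<in> carrier G. 1}"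
  by (simp add: nontrivial_characters_def characters_def)

lemma characters_iff:
  "\<rho> \<in> characters G \<longleftrightarrow> multiplicative_on G (carrier G) \<rho> \<and> \<rho> \<in> extensional (carrier G)"
  by (auto simp: characters_def hom_def complex_units_def multiplicative_on_def)

lemma (in monoid) trivial_character: "(\<lambda>g \<in> carrier G. 1) \<in> characters G"
  by (simp add: characters_iff multiplicative_on_def)

section \<open>Extension, separation and orthogonality of characters\<close>

context comm_group
begin

lemma character_mult: "\<rho> \<in> characters G \<Longrightarrow> x \<in> carrier G \<Longrightarrow> y \<in> carrier G \<Longrightarrow> \<rho> (x \<otimes> y) = \<rho> x * \<rho> y"
  by (simp add: characters_iff multiplicative_on_def)

lemma multiplicative_on_one:
  assumes "subgroup K G" "multiplicative_on G K \<chi>"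
  shows "\<chi> \<one> = 1"
proof -
  have "\<one> \<in> K" using assms(1) by (rule subgroup.one_closed)
  then have "\<chi> \<one> * \<chi> \<one> = \<chi> \<one>" "\<chi> \<one> \<noteq> 0"
    using assms(2) unfolding multiplicative_on_def by (metis one_closed r_one)+
  then show ?thesis by simp
qed

lemma subgroup_nat_pow_closed: "subgroup K G \<Longrightarrow> x \<in> K \<Longrightarrow> x [^] (n :: nat) \<in> K"
  by (induction n) (auto simp: subgroup.one_closed subgroup.m_closed)

lemma multiplicative_on_nat_pow:
  assumes "subgroup K G" "multiplicative_on G K \<chi>" "x \<in> K"
  shows "\<chi> (x [^] (n :: nat)) = \<chi> x ^ n"
  using assms subgroup_nat_pow_closed[OF assms(1,3)]
  by (induction n) (auto simp: multiplicative_on_one multiplicative_on_def)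

lemma character_one: "\<rho> \<in> characters G \<Longrightarrow> \<rho> \<one> = 1"
  using multiplicative_on_one[OF subgroup_self] by (simp add: characters_iff)

lemma character_pow_order: "\<rho> \<in> characters G \<Longrightarrow> x \<in> carrier G \<Longrightarrow> \<rho> x ^ order G = 1"
  using multiplicative_on_nat_pow[OF subgroup_self, of \<rho> x "order G"]
  by (simp add: pow_order_eq_1 characters_iff character_one)

text \<open>The extension must send \<open>k \<otimes> b [^] i\<close> to
  \<open>\<chi> k * \<zeta> ^ i\<close>. This is well defined: by minimality of \<open>m\<close>, a
  power of \<open>b\<close> lies in \<open>K\<close> only if its exponent is a multiple of
  \<open>m\<close>, and for these exponents the condition on \<zeta> is exactly the required
  compatibility.\<close>

lemma multiplicative_on_extend_cyclic:
  fixes \<zeta> :: complex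
  assumes fin: "finite (carrier G)" and K: "subgroup K G" and \<chi>: "multiplicative_on G K \<chi>"
    and b: "b \<in> carrier G" and m: "0 < m" "b [^] m \<in> K" "\<And>i. 0 < i \<Longrightarrow> b [^] i \<in> K \<Longrightarrow> m \<le> i"
    and \<zeta>: "\<zeta> ^ m = \<chi> (b [^] m)"
  obtains K' \<chi>' where "subgroup K' G" "K \<subseteq> K'" "b \<in> K'" "multiplicative_on G K' \<chi>'"
    "\<And>x. x \<in> K \<Longrightarrow> \<chi>' x = \<chi> x" "\<chi>' b = \<zeta>"
proof -
  have Kc: "x \<in> carrier G" if "x \<in> K" for x using subgroup.subset[OF K] that by blast
  have \<zeta>_pow: "\<zeta> ^ n = \<chi> (b [^] n)" if n: "b [^] n \<in> K" for n
  proof -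
    have split: "b [^] n = (b [^] m) [^] (n div m) \<otimes> b [^] (n mod m)"
      using b by (simp add: nat_pow_pow nat_pow_mult)
    have q: "(b [^] m) [^] (n div m) \<in> K" using subgroup_nat_pow_closed[OF K m(2)] .
    have "b [^] (n mod m) = inv ((b [^] m) [^] (n div m)) \<otimes> b [^] n"
      using b split by (simp add: m_assoc[symmetric])
    then have "b [^] (n mod m) \<in> K"
      using K q n by (simp add: subgroup.m_closed subgroup.m_inv_closed)
    then have "n mod m = 0" using m(1) m(3)[of "n mod m"] by (meson mod_less_divisor not_le not_gr_zero)
    then have n: "n = m * (n div m)" by auto
    have "\<chi> (b [^] n) = \<chi> (b [^] m) ^ (n div m)"
      using multiplicative_on_nat_pow[OF K \<chi> m(2)] b n nat_pow_pow by metis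
    then show ?thesis using \<zeta> n by (metis power_mult)
  qed
  \<comment> \<open>Ordering the exponents keeps \<open>j - i\<close> a natural number; the other
    order follows by symmetry.\<close>
  have wd: "\<chi> k * \<zeta> ^ i = \<chi> k' * \<zeta> ^ j"
    if k: "k \<in> K" "k' \<in> K" and eq: "k \<otimes> b [^] i = k' \<otimes> b [^] j" and le: "i \<le> j" for k k' i j
  proof -
    have "k \<otimes> b [^] i = k' \<otimes> b [^] (j - i) \<otimes> b [^] i"
      using eq b k Kc le by (simp add: m_assoc nat_pow_mult)
    then have keq: "k = k' \<otimes> b [^] (j - i)" using b k Kc by simp
    then have "b [^] (j - i) = inv k' \<otimes> k" using b k Kc by (simp add: m_assoc[symmetric])
    then have bK: "b [^] (j - i) \<in> K" using K k by (simp add: subgroup.m_closed subgroup.m_inv_closed)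
    have "\<chi> k = \<chi> k' * \<zeta> ^ (j - i)"
      using \<chi> k bK \<zeta>_pow[OF bK] keq by (simp add: multiplicative_on_def)
    then show ?thesis using le by (simp add: power_add[symmetric])
  qed
  define K' where "K' = {k \<otimes> b [^] i | k i :: nat. k \<in> K}"
  define \<chi>' where "\<chi>' = (\<lambda>x. SOME z. \<exists>k i. k \<in> K \<and> x = k \<otimes> b [^] (i :: nat) \<and> z = \<chi> k * \<zeta> ^ i)"
  have \<chi>': "\<chi>' (k \<otimes> b [^] i) = \<chi> k * \<zeta> ^ i" if "k \<in> K" for k i
  proof -
    have "\<exists>k' j. k' \<in> K \<and> k \<otimes> b [^] i = k' \<otimes> b [^] (j :: nat) \<and> \<chi>' (k \<otimes> b [^] i) = \<chi> k' * \<zeta> ^ j"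
      unfolding \<chi>'_def by (rule someI_ex) (use that in blast)
    then show ?thesis using wd that by (metis nat_le_linear)
  qed
  have prod: "(k \<otimes> b [^] i) \<otimes> (k' \<otimes> b [^] j) = (k \<otimes> k') \<otimes> b [^] (i + j)"
    if "k \<in> K" "k' \<in> K" for k k' and i j :: nat
    using b Kc that by (simp add: nat_pow_mult[symmetric] m_ac)
  have KK': "k \<in> K'" if "k \<in> K" for k
    unfolding K'_def using that Kc by (intro CollectI exI[of _ k] exI[of _ 0]) simp
  have bK': "b \<in> K'"
    unfolding K'_def using b subgroup.one_closed[OF K] by (intro CollectI exI[of _ \<one>] exI[of _ 1]) simp
  show ?thesis
  proof (rule that)
    show "subgroup K' G"
    proof (rule subgroupI)
      show "K' \<subseteq> carrier G" using b Kc by (auto simp: K'_def)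
      show "K' \<noteq> {}" using bK' by blast
    next
      fix x assume "x \<in> K'"
      then obtain k i where x: "k \<in> K" "x = k \<otimes> b [^] (i :: nat)" by (auto simp: K'_def)
      have N: "order G = Suc (order G - 1)" using fin order_gt_0_iff_finite by simp
      have "b [^] (order G - 1) \<otimes> b = \<one>"
        using b pow_order_eq_1[OF b] N by (metis nat_pow_Suc)
      \<comment> \<open>The inverse of \<open>b\<close> is a natural power by finiteness, so
        nonnegative exponents already give a subgroup.\<close>
      then have "inv b = b [^] (order G - 1)" using b inv_unique' by (metis inv_equality nat_pow_closed)
      then have "inv (b [^] i) = (b [^] (order G - 1)) [^] i"
        using nat_pow_inv[OF b, of i] by argo
      then have "inv (b [^] i) = b [^] ((order G - 1) * i)"
        by (simp only: nat_pow_pow[OF b])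
      then have "inv x = inv k \<otimes> b [^] ((order G - 1) * i)"
        using x b Kc by (simp add: inv_mult)
      moreover have "inv k \<in> K" using x(1) K by (simp add: subgroup.m_inv_closed)
      ultimately show "inv x \<in> K'" unfolding K'_def by blast
    next
      fix x y assume "x \<in> K'" "y \<in> K'"
      then obtain k i k' j where "k \<in> K" "x = k \<otimes> b [^] (i :: nat)" "k' \<in> K" "y = k' \<otimes> b [^] (j :: nat)"
        by (auto simp: K'_def)
      then have "x \<otimes> y = (k \<otimes> k') \<otimes> b [^] (i + j)" "k \<otimes> k' \<in> K"
        using prod subgroup.m_closed[OF K] by auto
      then show "x \<otimes> y \<in> K'" unfolding K'_def by blast
    qed
    show "multiplicative_on G K' \<chi>'"
      unfolding multiplicative_on_def
    proof (intro conjI ballI)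
      fix x assume "x \<in> K'"
      then obtain k i where x: "k \<in> K" "x = k \<otimes> b [^] (i :: nat)" by (auto simp: K'_def)
      have "\<zeta> \<noteq> 0" using \<zeta> \<chi> m by (auto simp: multiplicative_on_def zero_power)
      then show "\<chi>' x \<noteq> 0" using x \<chi> by (simp add: \<chi>' multiplicative_on_def)
    next
      fix x y assume "x \<in> K'" "y \<in> K'"
      then obtain k i k' j where *: "k \<in> K" "x = k \<otimes> b [^] (i :: nat)" "k' \<in> K" "y = k' \<otimes> b [^] (j :: nat)"
        by (auto simp: K'_def)
      then show "\<chi>' (x \<otimes> y) = \<chi>' x * \<chi>' y"
        using \<chi> by (simp add: \<chi>' prod subgroup.m_closed[OF K] multiplicative_on_def power_add)
    qed
    show "\<chi>' x = \<chi> x" if "x \<in> K" for x using \<chi>'[OF that, of 0] Kc that by simp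
    show "\<chi>' b = \<zeta>"
      using \<chi>'[OF subgroup.one_closed[OF K], of 1] b multiplicative_on_one[OF K \<chi>] by simp
  qed (use KK' bK' in auto)
qed

lemma least_power_in_subgroup:
  assumes fin: "finite (carrier G)" and K: "subgroup K G" and b: "b \<in> carrier G"
  obtains m :: nat where "0 < m" "b [^] m \<in> K" "\<And>i. 0 < i \<Longrightarrow> b [^] i \<in> K \<Longrightarrow> m \<le> i"
proof -
  have "0 < order G \<and> b [^] order G \<in> K"
    using fin b K by (simp add: order_gt_0_iff_finite pow_order_eq_1 subgroup.one_closed)
  then have "\<exists>m :: nat. 0 < m \<and> b [^] m \<in> K" by blast
  then have "0 < (LEAST m :: nat. 0 < m \<and> b [^] m \<in> K) \<and> b [^] (LEAST m :: nat. 0 < m \<and> b [^] m \<in> K) \<in> K"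
    by (rule LeastI_ex[of "\<lambda>m :: nat. 0 < m \<and> b [^] m \<in> K"])
  then show ?thesis using that Least_le[of "\<lambda>m :: nat. 0 < m \<and> b [^] m \<in> K"] by blast
qed

text \<open>The multiplicative group of the complex numbers is divisible: an m-th root of the
  prescribed value at \<open>b [^] m\<close> always exists, so an element outside \<open>K\<close>
  can be adjoined until the whole group is reached.\<close>

lemma multiplicative_on_extend:
  assumes fin: "finite (carrier G)"
  shows "subgroup K G \<Longrightarrow> multiplicative_on G K \<chi> \<Longrightarrow>
    \<exists>\<rho> \<in> characters G. \<forall>x \<in> K. \<rho> x = \<chi> x"
proof (induction "order G - card K" arbitrary: K \<chi> rule: less_induct)
  case less
  note K = less.prems(1) and \<chi> = less.prems(2)
  show ?case
  proof (cases "K = carrier G")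
    case True
    have "restrict \<chi> (carrier G) \<in> characters G"
      using \<chi> True by (simp add: characters_iff multiplicative_on_def)
    then show ?thesis using True by (intro bexI[of _ "restrict \<chi> (carrier G)"]) auto
  next
    case False
    then obtain b where b: "b \<in> carrier G" "b \<notin> K" using subgroup.subset[OF K] by blast
    obtain m :: nat where m: "0 < m" "b [^] m \<in> K" "\<And>i. 0 < i \<Longrightarrow> b [^] i \<in> K \<Longrightarrow> m \<le> i"
      using least_power_in_subgroup[OF fin K b(1)] by blast
    define z where "z = \<chi> (b [^] m)"
    have "rcis (NthRoot.root m (cmod z)) (Arg z / real m) ^ m = z"
      using m(1) by (simp add: DeMoivre2 real_root_pow_pos2 rcis_cmod_Arg)
    then obtain \<zeta> where \<zeta>: "\<zeta> ^ m = \<chi> (b [^] m)" unfolding z_def by blast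
    obtain K' \<chi>' where K': "subgroup K' G" "K \<subseteq> K'" "b \<in> K'" "multiplicative_on G K' \<chi>'"
      "\<And>x. x \<in> K \<Longrightarrow> \<chi>' x = \<chi> x"
      using multiplicative_on_extend_cyclic[OF fin K \<chi> b(1) m \<zeta>] by blast
    have "card K < card K'"
      using K' b finite_subset[OF subgroup.subset[OF K'(1)] fin] by (intro psubset_card_mono) auto
    moreover have "card K' \<le> order G"
      using subgroup.subset[OF K'(1)] fin by (simp add: order_def card_mono)
    ultimately have "\<exists>\<rho> \<in> characters G. \<forall>x \<in> K'. \<rho> x = \<chi>' x"
      by (intro less.hyps[OF _ K'(1,4)]) linarith
    then show ?thesis using K' by (metis subsetD)
  qed
qed

text \<open>Extending the trivial character of \<open>H\<close> to \<open>a\<close> leaves the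
  freedom to choose any m-th root of unity as the value at \<open>a\<close>, where \<open>m\<close>
  is the order of \<open>a\<close> modulo \<open>H\<close>. Since \<open>a\<close> is not in
  \<open>H\<close>, this order exceeds 1 and a root different from 1 exists.\<close>

lemma character_separation:
  assumes fin: "finite (carrier G)" and H: "subgroup H G" and a: "a \<in> carrier G" "a \<notin> H"
  obtains \<rho> where "\<rho> \<in> characters G" "\<And>x. x \<in> H \<Longrightarrow> \<rho> x = 1" "\<rho> a \<noteq> 1"
proof -
  obtain m :: nat where m: "0 < m" "a [^] m \<in> H" "\<And>i. 0 < i \<Longrightarrow> a [^] i \<in> H \<Longrightarrow> m \<le> i"
    using least_power_in_subgroup[OF fin H a(1)] by blast
  have "m \<noteq> 1" using m(2) a by auto
  then have "\<not> {z :: complex. z ^ m = 1} \<subseteq> {1}"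
    using m(1) card_roots_unity_eq[OF m(1)] card_mono[of "{1 :: complex}" "{z. z ^ m = 1}"] by auto
  then obtain \<zeta> :: complex where \<zeta>: "\<zeta> ^ m = 1" "\<zeta> \<noteq> 1" by auto
  have triv: "multiplicative_on G H (\<lambda>_. 1)" by (simp add: multiplicative_on_def)
  obtain K \<chi> where K: "subgroup K G" "H \<subseteq> K" "a \<in> K" "multiplicative_on G K \<chi>"
    "\<And>x. x \<in> H \<Longrightarrow> \<chi> x = 1" "\<chi> a = \<zeta>"
    using multiplicative_on_extend_cyclic[OF fin H triv a(1) m] \<zeta>(1) by metis
  obtain \<rho> where \<rho>: "\<rho> \<in> characters G" "\<forall>x \<in> K. \<rho> x = \<chi> x"
    using multiplicative_on_extend[OF fin K(1,4)] by blast
  show thesis by (rule that[of \<rho>]) (use \<rho> K \<zeta> in auto)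
qed

lemma finite_characters:
  assumes fin: "finite (carrier G)"
  shows "finite (characters G)"
proof (rule finite_subset)
  show "characters G \<subseteq> carrier G \<rightarrow>\<^sub>E {z. z ^ order G = 1}"
    by (auto simp: PiE_def Pi_def character_pow_order) (simp add: characters_iff)
  show "finite (carrier G \<rightarrow>\<^sub>E {z :: complex. z ^ order G = 1})"
    using fin order_gt_0_iff_finite by (intro finite_PiE finite_roots_unity) auto
qed

lemma norm_character:
  assumes "finite (carrier G)" "\<rho> \<in> characters G" "x \<in> carrier G"
  shows "cmod (\<rho> x) = 1"
proof -
  have "cmod (\<rho> x) ^ order G = 1"
    using character_pow_order[OF assms(2,3)] by (metis norm_one norm_power)
  then show ?thesis
    using order_gt_0_iff_finite assms(1) power_eq_imp_eq_base[of "cmod (\<rho> x)" "order G" 1] by simp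
qed

lemma cnj_character_mult:
  assumes "finite (carrier G)" "\<rho> \<in> characters G" "x \<in> carrier G"
  shows "cnj (\<rho> x) * \<rho> x = 1"
  using norm_character[OF assms] complex_norm_square[of "\<rho> x"] by (simp add: mult.commute)

lemma character_inv:
  assumes "finite (carrier G)" "\<rho> \<in> characters G" "x \<in> carrier G"
  shows "\<rho> (inv x) = cnj (\<rho> x)"
proof -
  have "\<rho> (inv x) * \<rho> x = 1"
    using assms character_mult[of \<rho> "inv x" x] by (simp add: character_one)
  then have "\<rho> (inv x) * (cnj (\<rho> x) * \<rho> x) = cnj (\<rho> x)" by (simp add: mult_ac)
  then show ?thesis using cnj_character_mult[OF assms] by simp
qed

lemma character_finprod:
  assumes "\<rho> \<in> characters G" "finite A" "f \<in> A \<rightarrow> carrier G"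
  shows "\<rho> (finprod G f A) = (\<Prod>a \<in> A. \<rho> (f a))"
  using assms(2,3) by (induction A) (auto simp: character_one[OF assms(1)] character_mult[OF assms(1)])

lemma character_eqI:
  assumes "\<rho> \<in> characters G" "\<sigma> \<in> characters G" "\<And>x. x \<in> carrier G \<Longrightarrow> \<rho> x = \<sigma> x"
  shows "\<rho> = \<sigma>"
  by (rule extensionalityI[of _ "carrier G"]) (use assms in \<open>auto simp: characters_iff\<close>)

lemma sum_translate:
  assumes "a \<in> carrier G"
  shows "(\<Sum>x \<in> carrier G. f (a \<otimes> x)) = (\<Sum>x \<in> carrier G. f x)"
  by (rule sum.reindex_bij_witness[where i = "\<lambda>x. inv a \<otimes> x" and j = "\<lambda>x. a \<otimes> x"])
    (use assms in \<open>auto simp: m_assoc[symmetric]\<close>)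

lemma character_orthogonality:
  assumes fin: "finite (carrier G)" and \<rho>: "\<rho> \<in> characters G" and \<sigma>: "\<sigma> \<in> characters G"
  shows "(\<Sum>x \<in> carrier G. \<rho> x * cnj (\<sigma> x)) = (if \<rho> = \<sigma> then of_nat (order G) else 0)"
proof (cases "\<rho> = \<sigma>")
  case True
  then show ?thesis
    using cnj_character_mult[OF fin \<sigma>] by (simp add: order_def mult.commute)
next
  case False
  then obtain a where a: "a \<in> carrier G" "\<rho> a \<noteq> \<sigma> a" using character_eqI[OF \<rho> \<sigma>] by blast
  define S where "S = (\<Sum>x \<in> carrier G. \<rho> x * cnj (\<sigma> x))"
  have "S = (\<Sum>x \<in> carrier G. \<rho> (a \<otimes> x) * cnj (\<sigma> (a \<otimes> x)))"
    unfolding S_def by (rule sum_translate[OF a(1), symmetric])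
  also have "\<dots> = \<rho> a * cnj (\<sigma> a) * S"
    unfolding S_def sum_distrib_left
    by (intro sum.cong) (use a \<rho> \<sigma> in \<open>auto simp: character_mult mult_ac\<close>)
  finally have "\<sigma> a * S = \<sigma> a * (\<rho> a * cnj (\<sigma> a) * S)" by (rule arg_cong)
  also have "\<dots> = \<rho> a * (cnj (\<sigma> a) * \<sigma> a) * S" by (simp only: mult_ac)
  finally have "\<sigma> a * S = \<rho> a * S" using cnj_character_mult[OF fin \<sigma> a(1)] by simp
  then have "S = 0" using a by simp
  then show ?thesis using False by (simp add: S_def)
qed

text \<open>The values \<open>\<rho> x\<close> with \<rho> in the annihilator and x in the group are
  summed in both orders. For fixed \<rho> only the trivial character contributes, giving the order
  of the group. For fixed x outside \<open>H\<close> the sum vanishes, as multiplication by a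
  character separating x from \<open>H\<close> permutes the annihilator; each x in \<open>H\<close>
  contributes the size of the annihilator.\<close>

lemma card_annihilator:
  assumes fin: "finite (carrier G)" and H: "subgroup H G"
  shows "card {\<rho> \<in> characters G. \<rho> ` H = {1}} = order G div card H"
proof -
  define K where "K = {\<rho> \<in> characters G. \<rho> ` H = {1}}"
  define \<tau> where "\<tau> = (\<lambda>g \<in> carrier G. 1 :: complex)"
  have Hc: "H \<subseteq> carrier G" and one: "\<one> \<in> H"
    using H by (auto simp: subgroup.subset subgroup.one_closed)
  have ann: "\<rho> \<in> K \<longleftrightarrow> \<rho> \<in> characters G \<and> (\<forall>x \<in> H. \<rho> x = 1)" for \<rho>
    using one by (auto simp: K_def image_iff)
  have finK: "finite K" using finite_characters[OF fin] by (simp add: K_def)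
  have \<tau>: "\<tau> \<in> characters G" "\<tau> \<in> K"
    using trivial_character Hc ann by (auto simp: \<tau>_def)
  have sumG: "(\<Sum>x \<in> carrier G. \<rho> x) = (if \<rho> = \<tau> then of_nat (order G) else 0)" if "\<rho> \<in> K" for \<rho>
    using character_orthogonality[OF fin _ \<tau>(1), of \<rho>] that ann by (simp add: \<tau>_def)
  have sumK: "(\<Sum>\<rho> \<in> K. \<rho> x) = (if x \<in> H then of_nat (card K) else 0)" if x: "x \<in> carrier G" for x
  proof (cases "x \<in> H")
    case False
    obtain \<sigma> where \<sigma>: "\<sigma> \<in> characters G" "\<And>y. y \<in> H \<Longrightarrow> \<sigma> y = 1" "\<sigma> x \<noteq> 1"
      using character_separation[OF fin H x False] by blast
    have shift: "(\<lambda>y \<in> carrier G. \<sigma>' y * \<rho> y) \<in> K" if "\<rho> \<in> K" "\<sigma>' \<in> K" for \<rho> \<sigma>'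
      using that Hc by (auto simp: ann characters_iff multiplicative_on_def mult_ac)
    have cnjK: "(\<lambda>y \<in> carrier G. cnj (\<sigma> y)) \<in> K"
      using \<sigma> Hc by (auto simp: ann characters_iff multiplicative_on_def)
    have \<sigma>K: "\<sigma> \<in> K" using \<sigma> ann by blast
    have inv: "(\<lambda>y \<in> carrier G. cnj (\<sigma> y) * (\<lambda>y \<in> carrier G. \<sigma> y * \<rho> y) y) = \<rho>"
      "(\<lambda>y \<in> carrier G. \<sigma> y * (\<lambda>y \<in> carrier G. cnj (\<sigma> y) * \<rho> y) y) = \<rho>" if "\<rho> \<in> K" for \<rho>
      using that ann cnj_character_mult[OF fin \<sigma>(1)]
      by (auto simp: fun_eq_iff characters_iff extensional_def restrict_def mult.assoc[symmetric]
          mult.commute[of "\<sigma> _" "cnj _"])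
    have shift': "(\<lambda>y \<in> carrier G. cnj (\<sigma> y) * \<rho> y) \<in> K" if "\<rho> \<in> K" for \<rho>
      using shift[OF that cnjK] by (simp add: restrict_def cong: if_cong)
    have "(\<Sum>\<rho> \<in> K. \<rho> x) = (\<Sum>\<rho> \<in> K. \<sigma> x * \<rho> x)"
      by (rule sum.reindex_bij_witness[where j = "\<lambda>\<rho>. \<lambda>y \<in> carrier G. cnj (\<sigma> y) * \<rho> y"
            and i = "\<lambda>\<rho>. \<lambda>y \<in> carrier G. \<sigma> y * \<rho> y"])
        (use inv shift \<sigma>K shift' x cnj_character_mult[OF fin \<sigma>(1) x] in
          \<open>auto simp: mult.assoc[symmetric] mult.commute[of "\<sigma> x"]\<close>)
    also have "\<dots> = \<sigma> x * (\<Sum>\<rho> \<in> K. \<rho> x)" by (simp only: sum_distrib_left)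
    finally have "(\<Sum>\<rho> \<in> K. \<rho> x) = \<sigma> x * (\<Sum>\<rho> \<in> K. \<rho> x)" .
    moreover have "t = 0" if "t = \<sigma> x * t" for t using that \<sigma>(3) by simp
    ultimately have "(\<Sum>\<rho> \<in> K. \<rho> x) = 0" by blast
    then show ?thesis using False by simp
  qed (use ann in simp)
  have "of_nat (order G) = (\<Sum>\<rho> \<in> K. \<Sum>x \<in> carrier G. \<rho> x)"
    using finK \<tau> by (simp add: sumG sum.delta)
  also have "\<dots> = (\<Sum>x \<in> carrier G. if x \<in> H then of_nat (card K) else 0)"
    by (subst sum.swap) (simp add: sumK)
  also have "\<dots> = (of_nat (card H * card K) :: complex)"
    using fin Hc by (simp add: sum.If_cases Int_absorb1)
  finally have "order G = card H * card K" using of_nat_eq_iff by blast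
  moreover have "card H > 0" using one Hc fin by (metis card_gt_0_iff empty_iff finite_subset)
  ultimately show ?thesis by (simp add: K_def)
qed

lemma card_characters: "finite (carrier G) \<Longrightarrow> card (characters G) = order G"
  using card_annihilator[OF _ triv_subgroup] character_one
  by (simp add: Collect_conj_eq Collect_mem_eq cong: conj_cong)

end


section \<open>Incidence matrices of connected graphs\<close>

context half_edge_graph
begin

lemma edge_eq_iff:
  assumes "h \<in> half_edges X" "k \<in> half_edges X"
  shows "{h, opp X h} = {k, opp X k} \<longleftrightarrow> k = h \<or> k = opp X h"
  using assms opp_opp by (auto simp: doubleton_eq_iff)

lemma edge_opp: "h \<in> half_edges X \<Longrightarrow> {opp X h, opp X (opp X h)} = {h, opp X h}"
  using opp_opp by auto

lemma edge_in_edges: "h \<in> half_edges X \<Longrightarrow> {h, opp X h} \<in> edges X"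
  by (simp add: edges_def)

lemma finite_edges: "finite (edges X)"
  using finite_half_edges by (simp add: edges_def)

lemma adjacency_sym: "sym (adjacency X)"
proof (rule symI)
  fix u v assume "(u, v) \<in> adjacency X"
  then obtain h where h: "h \<in> half_edges X" "u = root X h" "v = root X (opp X h)"
    by (auto simp: adjacency_def)
  then show "(v, u) \<in> adjacency X"
    unfolding adjacency_def using opp_closed[OF h(1)] opp_opp[OF h(1)]
    by (intro CollectI exI[of _ "opp X h"]) auto
qed

lemma reachable_sym: "(u, v) \<in> (adjacency X)\<^sup>* \<Longrightarrow> (v, u) \<in> (adjacency X)\<^sup>*"
  using sym_rtrancl[OF adjacency_sym] by (auto dest: symD)

lemma in_deleted_iff:
  assumes "h \<in> half_edges X" "F \<subseteq> edges X"
  shows "h \<in> \<Union>F \<longleftrightarrow> {h, opp X h} \<in> F"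
proof
  assume "h \<in> \<Union>F"
  then obtain k where k: "k \<in> half_edges X" "{k, opp X k} \<in> F" "h \<in> {k, opp X k}"
    using assms(2) by (fastforce simp: edges_def)
  then show "{h, opp X h} \<in> F" using edge_opp[of k] by auto
qed auto

lemma half_edges_delete_edges:
  "F \<subseteq> edges X \<Longrightarrow> half_edges (delete_edges X F) = {h \<in> half_edges X. {h, opp X h} \<notin> F}"
  using in_deleted_iff by (auto simp: delete_edges_def)

lemma delete_edges_simps [simp]:
  "verts (delete_edges X F) = verts X" "opp (delete_edges X F) = opp X" "root (delete_edges X F) = root X"
  by (simp_all add: delete_edges_def)

lemma half_edge_graph_delete_edges:
  assumes F: "F \<subseteq> edges X"
  shows "half_edge_graph (delete_edges X F)"
proof
  fix h assume "h \<in> half_edges (delete_edges X F)"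
  then have h: "h \<in> half_edges X" "{h, opp X h} \<notin> F" using half_edges_delete_edges[OF F] by auto
  then show "opp (delete_edges X F) h \<in> half_edges (delete_edges X F)"
    using half_edges_delete_edges[OF F] edge_opp[OF h(1)] opp_closed by simp
  show "opp (delete_edges X F) (opp (delete_edges X F) h) = h" "opp (delete_edges X F) h \<noteq> h"
    "root (delete_edges X F) h \<in> verts (delete_edges X F)"
    using h opp_opp opp_neq root_closed by auto
qed (auto simp: finite_verts half_edges_delete_edges[OF F] finite_half_edges)

text \<open>\<open>d\<close> is the distance from \<open>r\<close>, and \<open>hp v\<close> starts a
  shortest path from \<open>v\<close> to \<open>r\<close>; the parent edges thus form a
  breadth-first spanning tree. The decrease of \<open>d\<close> along them later yields both
  injectivity and triangularity.\<close>

lemma parent_half_edges: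
  assumes "r \<in> verts X" "\<And>v. v \<in> verts X \<Longrightarrow> (r, v) \<in> (adjacency X)\<^sup>*"
  obtains d :: "'v \<Rightarrow> nat" and hp where
    "\<And>v. v \<in> verts X - {r} \<Longrightarrow> hp v \<in> half_edges X"
    "\<And>v. v \<in> verts X - {r} \<Longrightarrow> root X (hp v) = v"
    "\<And>v. v \<in> verts X - {r} \<Longrightarrow> d (root X (opp X (hp v))) < d v"
proof -
  define d where "d = (\<lambda>v. LEAST n. (r, v) \<in> adjacency X ^^ n)"
  have "\<exists>h. h \<in> half_edges X \<and> root X h = v \<and> d (root X (opp X h)) < d v" if v: "v \<in> verts X - {r}" for v
  proof -
    have "\<exists>n. (r, v) \<in> adjacency X ^^ n" using assms(2) v rtrancl_imp_relpow by fast
    then have dv: "(r, v) \<in> adjacency X ^^ d v" unfolding d_def by (rule LeastI_ex)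
    then obtain m where m: "d v = Suc m" using v by (cases "d v") auto
    then obtain u where u: "(r, u) \<in> adjacency X ^^ m" "(u, v) \<in> adjacency X"
      using dv by auto
    obtain h where h: "h \<in> half_edges X" "u = root X h" "v = root X (opp X h)"
      using u(2) by (auto simp: adjacency_def)
    have "d u \<le> m" unfolding d_def using u(1) by (rule Least_le)
    then show ?thesis
      using h m opp_closed[OF h(1)] opp_opp[OF h(1)] by (intro exI[of _ "opp X h"]) auto
  qed
  then show ?thesis using that[of _ d] by metis
qed

text \<open>A shortest path from the far end of \<open>k\<close> to its root that avoids this edge
  repeats no vertex, and \<open>k\<close> closes it to a cycle. The path has length 0 if
  \<open>k\<close> is a loop.\<close>

lemma cycle_through:
  assumes k: "k \<in> half_edges X"
    and path: "(root X (opp X k), root X k) \<in> (adjacency (delete_edges X {{k, opp X k}}))\<^sup>*"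
  shows "\<exists>c. is_cycle X c"
proof -
  define A where "A = adjacency (delete_edges X {{k, opp X k}})"
  define n where "n = (LEAST n. (root X (opp X k), root X k) \<in> A ^^ n)"
  have pathn: "(root X (opp X k), root X k) \<in> A ^^ n"
    unfolding n_def using rtrancl_imp_relpow[OF path] unfolding A_def by (rule LeastI_ex)
  have min: "n \<le> m" if "(root X (opp X k), root X k) \<in> A ^^ m" for m
    unfolding n_def using that by (rule Least_le)
  obtain f where f: "f 0 = root X (opp X k)" "f n = root X k"
    and step: "\<And>i. i < n \<Longrightarrow> (f i, f (Suc i)) \<in> A"
    using pathn unfolding relpow_fun_conv by blast
  have sub: "(f i, f j) \<in> A ^^ (j - i)" if "i \<le> j" "j \<le> n" for i j
    unfolding relpow_fun_conv using step that by (intro exI[of _ "\<lambda>l. f (i + l)"]) auto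
  have inj: "i = j" if "f i = f j" "i \<le> j" "j \<le> n" for i j
  proof (rule ccontr)
    assume "i \<noteq> j"
    have "(f 0, f n) \<in> A ^^ (i + (n - j))"
      unfolding relpow_add using sub[of 0 i] sub[of j n] that by auto
    then have "n \<le> i + (n - j)" using min f by simp
    then show False using that \<open>i \<noteq> j\<close> by simp
  qed
  have inj: "i = j" if "f i = f j" "i \<le> n" "j \<le> n" for i j
    using inj that by (metis nat_le_linear)
  have kE: "{{k, opp X k}} \<subseteq> edges X" using k edge_in_edges by simp
  have "\<exists>h. h \<in> half_edges X \<and> {h, opp X h} \<noteq> {k, opp X k} \<and> root X h = f i \<and> root X (opp X h) = f (Suc i)"
    if "i < n" for i
    using step[OF that] half_edges_delete_edges[OF kE] by (auto simp: A_def adjacency_def)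
  then obtain h where h: "\<And>i. i < n \<Longrightarrow> h i \<in> half_edges X" "\<And>i. i < n \<Longrightarrow> {h i, opp X (h i)} \<noteq> {k, opp X k}"
    "\<And>i. i < n \<Longrightarrow> root X (h i) = f i" "\<And>i. i < n \<Longrightarrow> root X (opp X (h i)) = f (Suc i)"
    by metis
  define c where "c = k # map h [0..<n]"
  have "is_cycle X c"
    unfolding is_cycle_def
  proof (intro conjI allI impI)
    show "distinct (map (root X) c)"
      using inj h(3) f(2) by (fastforce simp: c_def distinct_map inj_on_def)
    have "inj_on (\<lambda>i. {h i, opp X (h i)}) {0..<n}"
    proof (rule inj_onI)
      fix i j assume ij: "i \<in> {0..<n}" "j \<in> {0..<n}" and "{h i, opp X (h i)} = {h j, opp X (h j)}"
      then have "h j = h i \<or> h j = opp X (h i)" using edge_eq_iff h(1) by simp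
      then show "i = j"
      proof
        assume "h j = h i"
        then show ?thesis using h(3)[of i] h(3)[of j] ij inj[of i j] by simp
      next
        \<comment> \<open>Traversing one edge in both directions would give \<open>j = i + 1\<close>
          and \<open>i = j + 1\<close> by injectivity of \<open>f\<close>.\<close>
        assume eq: "h j = opp X (h i)"
        then have "f j = f (Suc i)" "f (Suc j) = f i"
          using h(1,3,4)[of i] h(3,4)[of j] ij opp_opp by auto
        then show ?thesis using inj[of j "Suc i"] inj[of "Suc j" i] ij by simp
      qed
    qed
    then show "distinct (map (\<lambda>h. {h, opp X h}) c)"
      using h(2) by (auto simp: c_def distinct_map comp_def inj_on_def; metis)
    fix i assume i: "i < length c"
    show "root X (opp X (c ! i)) = root X (c ! ((i + 1) mod length c))"
    proof (cases i)
      case 0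
      then show ?thesis using f h(3)[of 0] by (cases "n = 0") (auto simp: c_def nth_Cons')
    next
      case (Suc j)
      then have "root X (opp X (c ! i)) = f (Suc j)" using i h(4)[of j] by (simp add: c_def)
      moreover have "root X (c ! ((i + 1) mod length c)) = f (Suc j)"
        using Suc i f(2) h(3)[of "Suc j"] by (cases "Suc j = n") (auto simp: c_def)
      ultimately show ?thesis by simp
    qed
  qed (use k h(1) in \<open>auto simp: c_def\<close>)
  then show ?thesis by blast
qed

lemma cycle_half_edges:
  assumes "is_cycle X c"
  shows "c \<noteq> []" "i < length c \<Longrightarrow> c ! i \<in> half_edges X" "distinct c"
    "i < length c \<Longrightarrow> j < length c \<Longrightarrow> {c ! i, opp X (c ! i)} = {c ! j, opp X (c ! j)} \<Longrightarrow> i = j"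
    "i < length c \<Longrightarrow> root X (opp X (c ! i)) = root X (c ! ((i + 1) mod length c))"
proof -
  note c = assms[unfolded is_cycle_def]
  show "c \<noteq> []" using c by blast
  show "i < length c \<Longrightarrow> c ! i \<in> half_edges X" using c by auto
  show "distinct c" using c by (auto simp: distinct_map)
  show "i < length c \<Longrightarrow> j < length c \<Longrightarrow> {c ! i, opp X (c ! i)} = {c ! j, opp X (c ! j)} \<Longrightarrow> i = j"
    using c nth_eq_iff_index_eq[of "map (\<lambda>h. {h, opp X h}) c" i j] by simp
  show "i < length c \<Longrightarrow> root X (opp X (c ! i)) = root X (c ! ((i + 1) mod length c))"
    using c by blast
qed

text \<open>The rest of the cycle is a detour between the ends of the deleted edge.\<close>

lemma connected_delete_cycle_edge:
  assumes conn: "connected_graph X" and c: "is_cycle X c"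
  shows "connected_graph (delete_edges X {{c ! 0, opp X (c ! 0)}})"
proof -
  define k where "k = c ! 0"
  define X' where "X' = delete_edges X {{k, opp X k}}"
  define A where "A = adjacency X'"
  have k: "k \<in> half_edges X" using cycle_half_edges[OF c] by (simp add: k_def)
  have kE: "{{k, opp X k}} \<subseteq> edges X" using edge_in_edges[OF k] by simp
  interpret X': half_edge_graph X' unfolding X'_def by (rule half_edge_graph_delete_edges[OF kE])
  have AI: "(root X h, root X (opp X h)) \<in> A" if "h \<in> half_edges X" "{h, opp X h} \<noteq> {k, opp X k}" for h
    unfolding A_def adjacency_def X'_def using that half_edges_delete_edges[OF kE] by auto
  have "(root X (opp X k), root X (c ! ((j + 1) mod length c))) \<in> A\<^sup>*" if "j < length c" for j
    using that
  proof (induction j)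
    case 0
    then show ?case using cycle_half_edges(5)[OF c, of 0] by (simp add: k_def)
  next
    case (Suc j)
    have "{c ! Suc j, opp X (c ! Suc j)} \<noteq> {k, opp X k}"
      using cycle_half_edges(4)[OF c, of "Suc j" 0] cycle_half_edges(1)[OF c] Suc.prems by (auto simp: k_def)
    then have "(root X (c ! Suc j), root X (opp X (c ! Suc j))) \<in> A"
      using AI cycle_half_edges(2)[OF c] Suc.prems by blast
    then show ?case
      using Suc cycle_half_edges(5)[OF c, of "Suc j"] by (auto intro: rtrancl_into_rtrancl)
  qed
  from this[of "length c - 1"] have "(root X (opp X k), root X k) \<in> A\<^sup>*"
    using cycle_half_edges(1)[OF c] by (simp add: k_def)
  moreover from X'.reachable_sym[of "root X (opp X k)" "root X k"] this
  have "(root X k, root X (opp X k)) \<in> A\<^sup>*" by (simp add: A_def)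
  ultimately have "adjacency X \<subseteq> A\<^sup>*"
    using AI edge_eq_iff[OF k] opp_opp[OF k] by (fastforce simp: adjacency_def)
  then have "(adjacency X)\<^sup>* \<subseteq> A\<^sup>*" by (metis rtrancl_idemp rtrancl_mono)
  then show ?thesis
    using conn by (auto simp: connected_graph_def A_def X'_def k_def)
qed

end

section \<open>Minors of voltage-twisted incidence matrices\<close>

definition incidence :: "('v, 'h) hgraph \<Rightarrow> ('h \<Rightarrow> complex) \<Rightarrow> 'v \<Rightarrow> 'h \<Rightarrow> complex" where
  "incidence X \<omega> v h = of_bool (root X h = v) - \<omega> h * of_bool (root X (opp X h) = v)"

text \<open>For voltages of modulus 1 the conjugate is the inverse, so opposite half-edges carry
  inverse voltages.\<close>

definition extend_voltage :: "('v, 'h) hgraph \<Rightarrow> 'h set \<Rightarrow> ('h \<Rightarrow> complex) \<Rightarrow> 'h \<Rightarrow> complex" where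
  "extend_voltage X Or \<omega> h = (if h \<in> Or then \<omega> h else cnj (\<omega> (opp X h)))"

definition oriented :: "('v, 'h) hgraph \<Rightarrow> 'h set \<Rightarrow> 'h \<Rightarrow> 'h" where
  "oriented X Or h = (if h \<in> Or then h else opp X h)"

text \<open>Instantiated with the constant voltage 1 for spanning trees and with
  \<open>\<rho> (\<eta> h)\<close> for a character \<rho>.\<close>

locale voltage_graph = half_edge_graph X for X :: "('v, 'h) hgraph" +
  fixes Or :: "'h set" and \<omega> :: "'h \<Rightarrow> complex"
  assumes orientation: "orientation X Or"
    and norm_voltage: "h \<in> Or \<Longrightarrow> cmod (\<omega> h) = 1"
begin

lemma Or_half_edges: "h \<in> Or \<Longrightarrow> h \<in> half_edges X"
  using orientation by (auto simp: orientation_def)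

lemma finite_Or: "finite Or"
  using orientation finite_half_edges finite_subset by (auto simp: orientation_def)

lemma opp_in_Or_iff: "h \<in> half_edges X \<Longrightarrow> opp X h \<in> Or \<longleftrightarrow> h \<notin> Or"
  using orientation by (auto simp: orientation_def)

lemma oriented_in_Or: "h \<in> half_edges X \<Longrightarrow> oriented X Or h \<in> Or"
  by (simp add: oriented_def opp_in_Or_iff)

lemma oriented_eq_iff:
  assumes "h \<in> half_edges X" "k \<in> half_edges X"
  shows "oriented X Or h = oriented X Or k \<longleftrightarrow> k = h \<or> k = opp X h"
  using assms opp_in_Or_iff opp_opp unfolding oriented_def by (smt (verit))

lemma bij_betw_Or_edges: "bij_betw (\<lambda>h. {h, opp X h}) Or (edges X)"
  unfolding bij_betw_def
proof
  show "inj_on (\<lambda>h. {h, opp X h}) Or"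
    using edge_eq_iff Or_half_edges opp_in_Or_iff by (intro inj_onI) blast
  show "(\<lambda>h. {h, opp X h}) ` Or = edges X"
  proof
    show "(\<lambda>h. {h, opp X h}) ` Or \<subseteq> edges X" using Or_half_edges edge_in_edges by auto
    show "edges X \<subseteq> (\<lambda>h. {h, opp X h}) ` Or"
    proof
      fix e assume "e \<in> edges X"
      then obtain h where h: "h \<in> half_edges X" "e = {h, opp X h}" by (auto simp: edges_def)
      then have "e = {oriented X Or h, opp X (oriented X Or h)}"
        using edge_opp by (simp add: oriented_def)
      then show "e \<in> (\<lambda>h. {h, opp X h}) ` Or" using oriented_in_Or h by blast
    qed
  qed
qed

lemma card_edges: "card (edges X) = card Or"
  using bij_betw_same_card[OF bij_betw_Or_edges] by simp

lemma cnj_voltage_mult: "h \<in> Or \<Longrightarrow> cnj (\<omega> h) * \<omega> h = 1"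
  using norm_voltage[of h] complex_norm_square[of "\<omega> h"] by (simp add: mult.commute)

text \<open>Reversing an edge multiplies its column by a unit. Moduli of minors are therefore
  insensitive to the orientation, and a column may be written in the direction in which its edge is
  traversed.\<close>

lemma incidence_oriented:
  assumes h: "h \<in> half_edges X"
  obtains \<tau> where "cmod \<tau> = 1"
    "\<And>v. incidence X \<omega> v (oriented X Or h) * \<tau> =
       of_bool (root X h = v) - extend_voltage X Or \<omega> h * of_bool (root X (opp X h) = v)"
proof (cases "h \<in> Or")
  case True
  then show ?thesis using that[of 1] by (simp add: incidence_def oriented_def extend_voltage_def)
next
  case False
  then have o: "opp X h \<in> Or" using opp_in_Or_iff h by simp
  show ?thesis
  proof (rule that)
    show "cmod (- cnj (\<omega> (opp X h))) = 1" using norm_voltage[OF o] by simp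
    show "incidence X \<omega> v (oriented X Or h) * - cnj (\<omega> (opp X h)) =
       of_bool (root X h = v) - extend_voltage X Or \<omega> h * of_bool (root X (opp X h) = v)" for v
      using False opp_opp[OF h] cnj_voltage_mult[OF o]
      by (simp add: incidence_def oriented_def extend_voltage_def algebra_simps)
  qed
qed

text \<open>If two vertices shared their parent edge, each of them would be nearer to the root than
  the other.\<close>

lemma oriented_parent_inj:
  fixes d :: "'v \<Rightarrow> nat"
  assumes hp: "\<And>v. v \<in> A \<Longrightarrow> hp v \<in> half_edges X" "\<And>v. v \<in> A \<Longrightarrow> root X (hp v) = v"
    "\<And>v. v \<in> A \<Longrightarrow> d (root X (opp X (hp v))) < d v"
  shows "inj_on (\<lambda>v. oriented X Or (hp v)) A"
proof (rule inj_onI)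
  fix u v assume uv: "u \<in> A" "v \<in> A" "oriented X Or (hp u) = oriented X Or (hp v)"
  then have "hp v = hp u \<or> hp v = opp X (hp u)" using oriented_eq_iff hp(1) by blast
  then show "u = v"
  proof
    assume eq: "hp v = opp X (hp u)"
    then have "root X (opp X (hp u)) = v" "root X (opp X (hp v)) = u"
      using hp(1,2) uv opp_opp by metis+
    then show ?thesis using hp(3)[OF uv(1)] hp(3)[OF uv(2)] by simp
  qed (use hp(2) uv in metis)
qed

lemma card_verts_le:
  assumes conn: "connected_graph X"
  shows "card (verts X) \<le> card Or + 1"
proof -
  obtain r where r: "r \<in> verts X" using conn by (auto simp: connected_graph_def)
  obtain d :: "'v \<Rightarrow> nat" and hp where hp: "\<And>v. v \<in> verts X - {r} \<Longrightarrow> hp v \<in> half_edges X"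
    "\<And>v. v \<in> verts X - {r} \<Longrightarrow> root X (hp v) = v"
    "\<And>v. v \<in> verts X - {r} \<Longrightarrow> d (root X (opp X (hp v))) < d v"
    using parent_half_edges[OF r] conn r unfolding connected_graph_def by metis
  have "card (verts X - {r}) \<le> card Or"
    using oriented_parent_inj[of "verts X - {r}" hp d, OF hp] oriented_in_Or hp(1) finite_Or
    by (intro card_inj_on_le[of "\<lambda>v. oriented X Or (hp v)"]) auto
  then show ?thesis using r finite_verts by (simp add: card_Diff_singleton_if)
qed

text \<open>The columns of a tree are indexed by the parent edges of the vertices other than the root;
  the matrix is then triangular with respect to the distance from the root.\<close>

lemma norm_det_incidence_tree:
  assumes conn: "connected_graph X" and r: "r \<in> verts X" and f: "bij_betw f (verts X - {r}) Or"
  shows "cmod (det_on (verts X - {r}) (\<lambda>i j. incidence X \<omega> i (f j))) = 1"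
proof -
  let ?A = "verts X - {r}"
  obtain d :: "'v \<Rightarrow> nat" and hp where hp: "\<And>v. v \<in> verts X - {r} \<Longrightarrow> hp v \<in> half_edges X"
    "\<And>v. v \<in> verts X - {r} \<Longrightarrow> root X (hp v) = v"
    "\<And>v. v \<in> verts X - {r} \<Longrightarrow> d (root X (opp X (hp v))) < d v"
    using parent_half_edges[OF r] conn r unfolding connected_graph_def by metis
  define g where "g = (\<lambda>v. oriented X Or (hp v))"
  have finA: "finite ?A" using finite_verts by simp
  have "inj_on g ?A" unfolding g_def using oriented_parent_inj[of "verts X - {r}" hp d, OF hp] by simp
  moreover have "g ` ?A \<subseteq> Or" using oriented_in_Or hp(1) by (auto simp: g_def)
  moreover have "card (g ` ?A) = card Or"
    using card_image[OF \<open>inj_on g ?A\<close>] bij_betw_same_card[OF f] by simp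
  ultimately have g: "bij_betw g ?A Or"
    using finite_Or card_subset_eq[of Or "g ` ?A"] by (simp add: bij_betw_def)
  \<comment> \<open>Parent edges are not loops: at a loop the two terms of \<open>incidence\<close>
    fall on the same vertex, and the diagonal entry would not be a unit.\<close>
  have hpd: "root X (opp X (hp v)) \<noteq> v" if "v \<in> ?A" for v using hp(3)[OF that] by force
  have "det_on ?A (\<lambda>i j. incidence X \<omega> i (g j)) = (\<Prod>i \<in> ?A. incidence X \<omega> i (g i))"
  proof (rule det_on_triangular[OF finA])
    fix i j assume ij: "i \<in> ?A" "j \<in> ?A" "i \<noteq> j" "incidence X \<omega> i (g j) \<noteq> 0"
    obtain \<tau> where \<tau>: "cmod \<tau> = 1" "incidence X \<omega> i (g j) * \<tau> =
       of_bool (root X (hp j) = i) - extend_voltage X Or \<omega> (hp j) * of_bool (root X (opp X (hp j)) = i)"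
      unfolding g_def using incidence_oriented[OF hp(1)[OF ij(2)]] by metis
    have "\<tau> \<noteq> 0" using \<tau>(1) by auto
    then have "incidence X \<omega> i (g j) * \<tau> \<noteq> 0" using ij(4) by (metis mult_eq_0_iff)
    moreover have "root X (hp j) \<noteq> i" using hp(2)[OF ij(2)] ij(3) by simp
    ultimately have "root X (opp X (hp j)) = i" using \<tau>(2) by (cases "root X (opp X (hp j)) = i") auto
    then show "d i < d j" using hp(3)[OF ij(2)] by simp
  qed
  moreover have "cmod (incidence X \<omega> i (g i)) = 1" if i: "i \<in> ?A" for i
  proof -
    obtain \<tau> where \<tau>: "cmod \<tau> = 1" "incidence X \<omega> i (g i) * \<tau> =
       of_bool (root X (hp i) = i) - extend_voltage X Or \<omega> (hp i) * of_bool (root X (opp X (hp i)) = i)"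
      unfolding g_def using incidence_oriented[OF hp(1)[OF i]] by metis
    then have "incidence X \<omega> i (g i) * \<tau> = 1" using hp(2)[OF i] hpd[OF i] by simp
    then show ?thesis using \<tau>(1) by (metis mult.right_neutral norm_mult norm_one)
  qed
  ultimately have "cmod (det_on ?A (\<lambda>i j. incidence X \<omega> i (g j))) = 1"
    by (simp add: prod_norm[symmetric])
  then show ?thesis using norm_det_on_column_indexing[OF finA f g, of "incidence X \<omega>"] by simp
qed

text \<open>Around a cycle \<open>c\<close> the columns of its edges, weighted by the partial products of the voltages,
  telescope to a multiple of the unit vector at the initial vertex.\<close>

lemma det_incidence_cycle:
  assumes c: "is_cycle X c" and A: "finite A" and f: "bij_betw f A Or"
    and a: "a \<in> A" "f a = oriented X Or (c ! 0)"
  obtains z where "cmod z = 1"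
    "z * det_on A (\<lambda>i j. incidence X \<omega> i (f j)) =
       det_on A (\<lambda>i j. if j = a then (1 - (\<Prod>h \<in> set c. extend_voltage X Or \<omega> h)) * of_bool (root X (c ! 0) = i)
                       else incidence X \<omega> i (f j))"
proof -
  let ?n = "length c" and ?w = "extend_voltage X Or \<omega>"
  note cyc = cycle_half_edges[OF c]
  define W where "W = (\<lambda>i. \<Prod>j<i. ?w (c ! j))"
  have "\<exists>\<tau>. cmod \<tau> = 1 \<and> (\<forall>v. incidence X \<omega> v (oriented X Or (c ! i)) * \<tau> =
       of_bool (root X (c ! i) = v) - ?w (c ! i) * of_bool (root X (opp X (c ! i)) = v))" if "i < ?n" for i
    using incidence_oriented[OF cyc(2)[OF that]] by metis
  then obtain \<tau> where \<tau>: "\<And>i. i < ?n \<Longrightarrow> cmod (\<tau> i) = 1"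
    "\<And>i v. i < ?n \<Longrightarrow> incidence X \<omega> v (oriented X Or (c ! i)) * \<tau> i =
       of_bool (root X (c ! i) = v) - ?w (c ! i) * of_bool (root X (opp X (c ! i)) = v)"
    by metis
  \<comment> \<open>At most one position of the cycle uses the edge of a given column; written as a
    sum, the coefficient is automatically 0 for the edges off the cycle. The unit \<tau> corrects
    the direction of travel.\<close>
  define x where "x = (\<lambda>u. \<Sum>i | i < ?n \<and> oriented X Or (c ! i) = f u. W i * \<tau> i)"
  \<comment> \<open>Only position 0 uses the column \<open>a\<close>, and the partial product
    \<open>W 0\<close> is empty, so the coefficient of this column is a unit.\<close>
  have "{i. i < ?n \<and> oriented X Or (c ! i) = f a} = {0}"
    using a(2) oriented_eq_iff[OF cyc(2) cyc(2)] edge_eq_iff[OF cyc(2) cyc(2)] cyc(1,4) by auto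
  then have xa: "x a = \<tau> 0" by (simp add: x_def W_def)
  have n0: "0 < ?n" using cyc(1) by simp
  have "(\<Sum>u \<in> A. incidence X \<omega> v (f u) * x u) =
      (1 - (\<Prod>h \<in> set c. ?w h)) * of_bool (root X (c ! 0) = v)" for v
  proof -
    have "(\<Sum>u \<in> A. incidence X \<omega> v (f u) * x u) =
        (\<Sum>k \<in> Or. incidence X \<omega> v k * (\<Sum>i | i < ?n \<and> oriented X Or (c ! i) = k. W i * \<tau> i))"
      unfolding x_def by (rule sum.reindex_bij_betw[OF f])
    also have "\<dots> = (\<Sum>k \<in> Or. \<Sum>i | i \<in> {..<?n} \<and> oriented X Or (c ! i) = k.
        W i * (incidence X \<omega> v (oriented X Or (c ! i)) * \<tau> i))"
      by (simp add: sum_distrib_left mult_ac)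
    also have "\<dots> = (\<Sum>i<?n. W i * (incidence X \<omega> v (oriented X Or (c ! i)) * \<tau> i))"
      by (rule sum.group) (use finite_Or oriented_in_Or cyc(2) in auto)
    \<comment> \<open>Reducing the index modulo the length makes the last vertex coincide with the
      first, so that the telescoped sum lives at one vertex.\<close>
    also have "\<dots> = (\<Sum>i<?n. W i * of_bool (root X (c ! (i mod ?n)) = v) -
        W (Suc i) * of_bool (root X (c ! (Suc i mod ?n)) = v))"
    proof (intro sum.cong refl)
      fix i assume "i \<in> {..<?n}"
      then have i: "i < ?n" by simp
      show "W i * (incidence X \<omega> v (oriented X Or (c ! i)) * \<tau> i) =
          W i * of_bool (root X (c ! (i mod ?n)) = v) - W (Suc i) * of_bool (root X (c ! (Suc i mod ?n)) = v)"
        unfolding \<tau>(2)[OF i] cyc(5)[OF i] using i by (simp only: W_def) (simp add: right_diff_distrib)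
    qed
    also have "\<dots> = W 0 * of_bool (root X (c ! (0 mod ?n)) = v) -
        W ?n * of_bool (root X (c ! (?n mod ?n)) = v)"
      by (rule sum_lessThan_telescope')
    also have "W ?n = (\<Prod>h \<in> set c. ?w h)"
      unfolding W_def using prod.reindex_bij_betw[OF bij_betw_nth[OF cyc(3) refl refl], of ?w] by simp
    finally show ?thesis by (simp add: W_def algebra_simps)
  qed
  then have "det_on A (\<lambda>i j. if j = a then (1 - (\<Prod>h \<in> set c. ?w h)) * of_bool (root X (c ! 0) = i)
      else incidence X \<omega> i (f j)) = x a * det_on A (\<lambda>i j. incidence X \<omega> i (f j))"
    using det_on_column_combination[OF A a(1), of "\<lambda>i j. incidence X \<omega> i (f j)" x]
    by (simp cong: if_cong)
  then show ?thesis using that[of "\<tau> 0"] xa \<tau>(1)[OF n0] by simp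
qed

text \<open>There are fewer parent edges than vertices, so some edge \<open>k\<close> is not a
  parent edge. The parent edges alone still connect its two ends, and \<open>k\<close> closes such a
  path.\<close>

lemma exists_cycle:
  assumes conn: "connected_graph X" and card: "card (verts X) \<le> card Or"
  shows "\<exists>c. is_cycle X c"
proof -
  obtain r where r: "r \<in> verts X" using conn by (auto simp: connected_graph_def)
  obtain d :: "'v \<Rightarrow> nat" and hp where hp: "\<And>v. v \<in> verts X - {r} \<Longrightarrow> hp v \<in> half_edges X"
    "\<And>v. v \<in> verts X - {r} \<Longrightarrow> root X (hp v) = v"
    "\<And>v. v \<in> verts X - {r} \<Longrightarrow> d (root X (opp X (hp v))) < d v"
    using parent_half_edges[OF r] conn r unfolding connected_graph_def by metis
  have "card ((\<lambda>v. oriented X Or (hp v)) ` (verts X - {r})) \<le> card (verts X - {r})"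
    using finite_verts by (intro card_image_le) simp
  also have "\<dots> < card (verts X)" using r finite_verts by (intro psubset_card_mono) auto
  finally obtain k where k: "k \<in> Or" "k \<notin> (\<lambda>v. oriented X Or (hp v)) ` (verts X - {r})"
    using card card_mono[of "(\<lambda>v. oriented X Or (hp v)) ` (verts X - {r})" Or] finite_verts by fastforce
  have kH: "k \<in> half_edges X" using k Or_half_edges by blast
  have kE: "{{k, opp X k}} \<subseteq> edges X" using edge_in_edges[OF kH] by simp
  define X' where "X' = delete_edges X {{k, opp X k}}"
  interpret X': half_edge_graph X' unfolding X'_def by (rule half_edge_graph_delete_edges[OF kE])
  have reach: "(r, v) \<in> (adjacency X')\<^sup>*" if "v \<in> verts X" for v
    using that
  proof (induction "d v" arbitrary: v rule: less_induct)
    case less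
    show ?case
    proof (cases "v = r")
      case False
      then have v: "v \<in> verts X - {r}" using less.prems by simp
      let ?u = "root X (opp X (hp v))"
      have "oriented X Or (hp v) \<noteq> oriented X Or k" using k v by (auto simp: oriented_def)
      then have "{hp v, opp X (hp v)} \<noteq> {k, opp X k}"
        using oriented_eq_iff[OF hp(1)[OF v] kH] edge_eq_iff[OF hp(1)[OF v] kH] by blast
      then have "hp v \<in> half_edges X'"
        using hp(1)[OF v] half_edges_delete_edges[OF kE] by (simp add: X'_def)
      then have "(v, ?u) \<in> adjacency X'"
        using hp(2)[OF v] unfolding adjacency_def X'_def delete_edges_simps
        by (intro CollectI exI[of _ "hp v"]) simp
      then have "(?u, v) \<in> adjacency X'" using X'.adjacency_sym by (rule symD[rotated])
      moreover have "(r, ?u) \<in> (adjacency X')\<^sup>*"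
        using less.hyps[OF hp(3)[OF v]] root_closed opp_closed hp(1)[OF v] by blast
      ultimately show ?thesis by simp
    qed simp
  qed
  have "(root X (opp X k), root X k) \<in> (adjacency X')\<^sup>*"
    using reach[of "root X k"] X'.reachable_sym[OF reach[of "root X (opp X k)"]] root_closed kH opp_closed
    by (meson rtrancl_trans)
  then show ?thesis using cycle_through[OF kH] by (simp add: X'_def)
qed

end

context half_edge_graph
begin

text \<open>With trivial voltages a cycle would turn one column of the reduced incidence matrix into
  a multiple by \<open>1 - 1\<close> of a unit vector, so the determinant would vanish; but
  connectedness and the edge count give it modulus 1.\<close>

lemma tree_no_cycle:
  assumes conn: "connected_graph X" and Or: "orientation X Or" and card: "card (verts X) = card Or + 1"
  shows "\<not> is_cycle X c"
proof
  assume c: "is_cycle X c"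
  interpret voltage_graph X Or "\<lambda>_. 1" by standard (use Or in auto)
  obtain r where r: "r \<in> verts X" using conn by (auto simp: connected_graph_def)
  let ?A = "verts X - {r}"
  have "card ?A = card Or" using card r finite_verts by simp
  then obtain f where f: "bij_betw f ?A Or"
    using finite_verts finite_Or finite_same_card_bij by (metis finite_Diff)
  have "oriented X Or (c ! 0) \<in> Or" using cycle_half_edges[OF c] oriented_in_Or by simp
  then obtain a where a: "a \<in> ?A" "f a = oriented X Or (c ! 0)" using f by (metis bij_betw_iff_bijections)
  have finA: "finite ?A" using finite_verts by simp
  have one: "(\<Prod>h \<in> set c. extend_voltage X Or (\<lambda>_. 1) h) = 1"
    by (simp add: extend_voltage_def cong: if_cong)
  let ?M = "\<lambda>i j. if j = a then (1 - (\<Prod>h \<in> set c. extend_voltage X Or (\<lambda>_. 1) h)) *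
      of_bool (root X (c ! 0) = i) else incidence X (\<lambda>_. 1) i (f j)"
  obtain z where z: "cmod z = 1" "z * det_on ?A (\<lambda>i j. incidence X (\<lambda>_. 1) i (f j)) = det_on ?A ?M"
    using det_incidence_cycle[OF c finA f a] by blast
  have "det_on ?A ?M = ?M a a * det_on (?A - {a}) ?M"
    by (rule det_on_unit_column[OF finA a(1)]) (simp add: one)
  then have "det_on ?A ?M = 0" by (simp add: one)
  then have "det_on ?A (\<lambda>i j. incidence X (\<lambda>_. 1) i (f j)) = 0" using z by auto
  then show False using norm_det_incidence_tree[OF conn r f] by simp
qed

text \<open>Replaces acyclicity by an edge count, which is the condition that the squareness of an
  incidence block expresses.\<close>

lemma is_tree_iff:
  assumes Or: "orientation X Or"
  shows "is_tree X \<longleftrightarrow> connected_graph X \<and> card (verts X) = card Or + 1"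
proof -
  interpret voltage_graph X Or "\<lambda>_. 1" by standard (use Or in auto)
  show ?thesis
    using tree_no_cycle[OF _ Or] exists_cycle card_verts_le unfolding is_tree_def by fastforce
qed

end

context voltage_graph
begin

text \<open>The columns of the cycle combine to the stated factor times the unit vector at the root
  of its first edge. Expanding along this column deletes that edge and that vertex, and what remains
  is the reduced incidence matrix of a spanning tree.\<close>

lemma norm_det_incidence_unicyclic:
  assumes conn: "connected_graph X" and f: "bij_betw f (verts X) Or" and c: "is_cycle X c"
  shows "cmod (det_on (verts X) (\<lambda>i j. incidence X \<omega> i (f j))) =
    cmod (1 - (\<Prod>h \<in> set c. extend_voltage X Or \<omega> h))"
proof -
  define k where "k = c ! 0"
  define v where "v = root X k"
  define X' where "X' = delete_edges X {{k, opp X k}}"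
  let ?k = "oriented X Or k"
  have k: "k \<in> half_edges X" using cycle_half_edges[OF c] by (simp add: k_def)
  have kE: "{{k, opp X k}} \<subseteq> edges X" using edge_in_edges[OF k] by simp
  have v: "v \<in> verts X" using root_closed[OF k] by (simp add: v_def)
  have kO: "?k \<in> Or" using oriented_in_Or[OF k] .
  have HX': "h \<in> half_edges X' \<longleftrightarrow> h \<in> half_edges X \<and> h \<noteq> k \<and> h \<noteq> opp X k" for h
    using half_edges_delete_edges[OF kE] edge_eq_iff[OF k, of h] by (auto simp: X'_def)
  have O': "Or - {?k} = {h \<in> Or. h \<in> half_edges X'}"
    using HX' Or_half_edges opp_in_Or_iff[OF k] by (auto simp: oriented_def)
  interpret X': half_edge_graph X' unfolding X'_def by (rule half_edge_graph_delete_edges[OF kE])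
  interpret X': voltage_graph X' "Or - {?k}" \<omega>
  proof
    show "orientation X' (Or - {?k})"
      unfolding orientation_def O' using opp_in_Or_iff HX' X'.opp_closed by (auto simp: X'_def)
  qed (use norm_voltage in auto)
  have "card (verts X - {v}) = card (Or - {?k})"
    using bij_betw_same_card[OF f] v kO by simp
  then obtain g where g: "bij_betw g (verts X - {v}) (Or - {?k})"
    using finite_verts finite_Or finite_same_card_bij by (metis finite_Diff)
  \<comment> \<open>The cycle edge is matched with its own root \<open>v\<close>, so the telescoped
    column has its nonzero entry on the diagonal.\<close>
  define g' where "g' = g(v := ?k)"
  have g': "bij_betw g' (verts X) Or"
  proof -
    have "bij_betw g' (verts X - {v}) (Or - {?k})"
      using g by (rule bij_betw_cong[THEN iffD1, rotated]) (simp add: g'_def)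
    then have "bij_betw g' (insert v (verts X - {v})) (insert (g' v) (Or - {?k}))"
      using notIn_Un_bij_betw[of v "verts X - {v}" g' "Or - {?k}"] by (simp add: g'_def)
    then show ?thesis using v kO by (simp add: insert_absorb g'_def)
  qed
  let ?u = "1 - (\<Prod>h \<in> set c. extend_voltage X Or \<omega> h)"
  obtain z where z: "cmod z = 1" "z * det_on (verts X) (\<lambda>i j. incidence X \<omega> i (g' j)) =
      det_on (verts X) (\<lambda>i j. if j = v then ?u * of_bool (v = i) else incidence X \<omega> i (g' j))"
    using det_incidence_cycle[OF c finite_verts g' v] unfolding v_def k_def
    by (simp add: g'_def k_def v_def) blast
  note z(2)
  also have "\<dots> = ?u * det_on (verts X - {v}) (\<lambda>i j. if j = v then ?u * of_bool (v = i) else incidence X \<omega> i (g' j))"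
    by (subst det_on_unit_column[OF finite_verts v]) auto
  also have "det_on (verts X - {v}) (\<lambda>i j. if j = v then ?u * of_bool (v = i) else incidence X \<omega> i (g' j)) =
      det_on (verts X' - {v}) (\<lambda>i j. incidence X' \<omega> i (g j))"
    unfolding X'_def delete_edges_simps by (rule det_on_cong) (auto simp: g'_def incidence_def)
  finally have "cmod z * cmod (det_on (verts X) (\<lambda>i j. incidence X \<omega> i (g' j))) =
      cmod ?u * cmod (det_on (verts X' - {v}) (\<lambda>i j. incidence X' \<omega> i (g j)))"
    by (metis norm_mult)
  moreover have "cmod (det_on (verts X' - {v}) (\<lambda>i j. incidence X' \<omega> i (g j))) = 1"
    using X'.norm_det_incidence_tree[of v g] connected_delete_cycle_edge[OF conn c] v g
    by (simp add: X'_def k_def)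
  ultimately show ?thesis
    using z(1) norm_det_on_column_indexing[OF finite_verts f g', of "incidence X \<omega>"] by simp
qed

end


section \<open>Components and the matrix-tree theorem\<close>

lemma is_cycle_half_edges: "is_cycle X c \<Longrightarrow> set c \<subseteq> half_edges X"
  by (simp add: is_cycle_def)

definition component_of :: "('v, 'h) hgraph \<Rightarrow> 'v \<Rightarrow> ('v, 'h) hgraph" where
  "component_of X v = X\<lparr>verts := {u. (v, u) \<in> (adjacency X)\<^sup>*},
     half_edges := {h \<in> half_edges X. (v, root X h) \<in> (adjacency X)\<^sup>*}\<rparr>"

lemma components_eq: "components X = component_of X ` verts X"
  by (simp add: components_def component_of_def Let_def)

lemma component_of_simps [simp]:
  "verts (component_of X v) = {u. (v, u) \<in> (adjacency X)\<^sup>*}"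
  "half_edges (component_of X v) = {h \<in> half_edges X. (v, root X h) \<in> (adjacency X)\<^sup>*}"
  "opp (component_of X v) = opp X" "root (component_of X v) = root X"
  by (simp_all add: component_of_def)

section \<open>Connected components\<close>

context half_edge_graph
begin

lemma reachable_in_verts: "(v, u) \<in> (adjacency X)\<^sup>* \<Longrightarrow> v \<in> verts X \<Longrightarrow> u \<in> verts X"
  by (induction rule: rtrancl_induct) (auto simp: adjacency_def root_closed opp_closed)

lemma edge_reachable:
  "h \<in> half_edges X \<Longrightarrow> (v, root X (opp X h)) \<in> (adjacency X)\<^sup>* \<longleftrightarrow> (v, root X h) \<in> (adjacency X)\<^sup>*"
proof -
  assume h: "h \<in> half_edges X"
  then have "(root X h, root X (opp X h)) \<in> adjacency X" by (auto simp: adjacency_def)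
  moreover from this have "(root X (opp X h), root X h) \<in> adjacency X" using adjacency_sym by (auto dest: symD)
  ultimately show ?thesis by (meson rtrancl_into_rtrancl)
qed

lemma component_of_eq_iff:
  assumes "u \<in> verts X" "v \<in> verts X"
  shows "component_of X u = component_of X v \<longleftrightarrow> (v, u) \<in> (adjacency X)\<^sup>*"
proof
  assume "component_of X u = component_of X v"
  then have "verts (component_of X u) = verts (component_of X v)" by simp
  then show "(v, u) \<in> (adjacency X)\<^sup>*" by auto
next
  assume "(v, u) \<in> (adjacency X)\<^sup>*"
  then have "(u, w) \<in> (adjacency X)\<^sup>* \<longleftrightarrow> (v, w) \<in> (adjacency X)\<^sup>*" for w
    using reachable_sym by (meson rtrancl_trans)
  then show "component_of X u = component_of X v" by (simp add: component_of_def)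
qed

lemma component_verts_iff:
  assumes "Y \<in> components X" "v \<in> verts X"
  shows "v \<in> verts Y \<longleftrightarrow> component_of X v = Y"
proof -
  obtain w where w: "w \<in> verts X" "Y = component_of X w" using assms(1) by (auto simp: components_eq)
  then show ?thesis using component_of_eq_iff[OF assms(2) w(1)] by simp
qed

lemma component_half_edges_iff:
  assumes "Y \<in> components X" "h \<in> half_edges X"
  shows "h \<in> half_edges Y \<longleftrightarrow> component_of X (root X h) = Y"
proof -
  obtain w where w: "w \<in> verts X" "Y = component_of X w" using assms(1) by (auto simp: components_eq)
  then show ?thesis using component_of_eq_iff[OF root_closed[OF assms(2)] w(1)] assms(2) by simp
qed

lemma component_facts:
  assumes "Y \<in> components X"
  shows "opp Y = opp X" "root Y = root X" "verts Y \<subseteq> verts X" "half_edges Y \<subseteq> half_edges X"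
  using assms reachable_in_verts by (auto simp: components_eq)

lemma component_of_opp:
  assumes "h \<in> half_edges X"
  shows "component_of X (root X (opp X h)) = component_of X (root X h)"
  using component_of_eq_iff[of "root X (opp X h)" "root X h"] assms root_closed opp_closed
  by (auto simp: adjacency_def)

lemma finite_components: "finite (components X)"
  using finite_verts by (simp add: components_eq)

lemma half_edge_graph_component:
  assumes "Y \<in> components X"
  shows "half_edge_graph Y"
proof -
  obtain v where v: "v \<in> verts X" "Y = component_of X v" using assms by (auto simp: components_eq)
  show ?thesis
    unfolding v(2)
  proof
    show "finite (verts (component_of X v))"
      using component_facts(3)[OF assms] v finite_verts finite_subset by blast
    show "finite (half_edges (component_of X v))"
      using component_facts(4)[OF assms] v finite_half_edges finite_subset by blast
  qed (use edge_reachable opp_closed opp_opp opp_neq in auto)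
qed

lemma connected_component:
  assumes "Y \<in> components X"
  shows "connected_graph Y"
proof -
  obtain v where v: "v \<in> verts X" "Y = component_of X v" using assms by (auto simp: components_eq)
  interpret Y: half_edge_graph Y by (rule half_edge_graph_component[OF assms])
  have "(v, u) \<in> (adjacency Y)\<^sup>*" if "(v, u) \<in> (adjacency X)\<^sup>*" for u
    using that
  proof (induction rule: rtrancl_induct)
    case (step u w)
    then obtain h where h: "h \<in> half_edges X" "u = root X h" "w = root X (opp X h)"
      by (auto simp: adjacency_def)
    then have "h \<in> half_edges Y" using step.hyps(1) v(2) by simp
    then have "(u, w) \<in> adjacency Y" using h v(2) by (auto simp: adjacency_def)
    then show ?case using step.IH by simp
  qed simp
  then show ?thesis
    unfolding connected_graph_def using Y.reachable_sym v
    by (auto intro: rtrancl_trans)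
qed

lemma components_connected:
  assumes "connected_graph X"
  shows "components X = {X}"
proof -
  have "component_of X v = X" if v: "v \<in> verts X" for v
  proof -
    have reach: "(v, u) \<in> (adjacency X)\<^sup>* \<longleftrightarrow> u \<in> verts X" for u
      using assms v reachable_in_verts unfolding connected_graph_def by blast
    have "{h \<in> half_edges X. root X h \<in> verts X} = half_edges X" using root_closed by blast
    then show ?thesis unfolding component_of_def reach by simp
  qed
  moreover have "verts X \<noteq> {}" using assms by (simp add: connected_graph_def)
  ultimately show ?thesis unfolding components_eq by (auto simp: image_def)
qed

end

text \<open>The squared modulus of the determinant of the incidence matrix of a connected graph \<open>Y\<close> with
  rows indexed by the vertices in \<open>U\<close>, or \<open>0\<close> if this matrix is not square.\<close>

definition block_weight :: "'v set \<Rightarrow> 'h set \<Rightarrow> ('h \<Rightarrow> complex) \<Rightarrow> ('v, 'h) hgraph \<Rightarrow> real" where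
  "block_weight U Or \<omega> Y =
     (if card (edges Y) \<noteq> card (U \<inter> verts Y) then 0
      else if verts Y \<subseteq> U
        then (cmod (1 - (\<Prod>h \<in> set (SOME c. is_cycle Y c). extend_voltage Y Or \<omega> h)))\<^sup>2
      else 1)"

section \<open>Minors as products over components and the matrix-tree theorems\<close>

context voltage_graph
begin

lemma voltage_graph_component:
  assumes Y: "Y \<in> components X"
  shows "voltage_graph Y (Or \<inter> half_edges Y) \<omega>"
proof -
  interpret Y: half_edge_graph Y by (rule half_edge_graph_component[OF Y])
  show ?thesis
  proof
    show "orientation Y (Or \<inter> half_edges Y)"
      unfolding orientation_def using Y.opp_closed component_facts[OF Y] opp_in_Or_iff by auto
  qed (use norm_voltage in simp)
qed

lemma voltage_graph_delete_edges:
  assumes F: "F \<subseteq> edges X"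
  shows "voltage_graph (delete_edges X F) {h \<in> Or. {h, opp X h} \<notin> F} \<omega>"
proof -
  interpret D: half_edge_graph "delete_edges X F" by (rule half_edge_graph_delete_edges[OF F])
  show ?thesis
  proof
    show "orientation (delete_edges X F) {h \<in> Or. {h, opp X h} \<notin> F}"
      unfolding orientation_def delete_edges_simps half_edges_delete_edges[OF F]
      using opp_in_Or_iff edge_opp Or_half_edges by auto
  qed (use norm_voltage in simp)
qed

text \<open>A connected graph has at most one vertex more than edges, so a square matrix either has
  a row for every vertex, which forces a cycle, or misses exactly one vertex, which is the case of a
  tree.\<close>

lemma norm_det_incidence_connected:
  assumes conn: "connected_graph X" and f: "bij_betw f (U \<inter> verts X) Or"
  shows "(cmod (det_on (U \<inter> verts X) (\<lambda>i j. incidence X \<omega> i (f j))))\<^sup>2 = block_weight U Or \<omega> X"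
proof -
  have card: "card (edges X) = card (U \<inter> verts X)"
    using bij_betw_same_card[OF f] card_edges by simp
  show ?thesis
  proof (cases "verts X \<subseteq> U")
    case True
    then have U: "U \<inter> verts X = verts X" by blast
    have "\<exists>c. is_cycle X c"
      by (rule exists_cycle[OF conn]) (use bij_betw_same_card[OF f] U in simp)
    then have "is_cycle X (SOME c. is_cycle X c)" by (rule someI_ex)
    then have "cmod (det_on (verts X) (\<lambda>i j. incidence X \<omega> i (f j))) =
        cmod (1 - (\<Prod>h \<in> set (SOME c. is_cycle X c). extend_voltage X Or \<omega> h))"
      using norm_det_incidence_unicyclic[OF conn] f U by simp
    then show ?thesis using True U card by (simp add: block_weight_def)
  next
    case False
    then obtain r where r: "r \<in> verts X" "r \<notin> U" by blast
    have "card (verts X - {r}) \<le> card (U \<inter> verts X)"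
      using card_verts_le[OF conn] bij_betw_same_card[OF f] r finite_verts by simp
    then have U: "U \<inter> verts X = verts X - {r}"
      using r finite_verts by (intro card_seteq) auto
    then show ?thesis
      using norm_det_incidence_tree[OF conn r(1)] f False card by (simp add: block_weight_def)
  qed
qed

text \<open>The chosen cycle runs inside \<open>Y\<close>, so only the orientation of the half-edges
  of \<open>Y\<close> enters. That there is a cycle to choose follows from the edge count in the one
  case of \<open>block_weight\<close> that uses it.\<close>

lemma block_weight_Int_half_edges:
  assumes Y: "Y \<in> components X"
  shows "block_weight U (Or \<inter> half_edges Y) \<omega> Y = block_weight U Or \<omega> Y"
proof -
  interpret Y: voltage_graph Y "Or \<inter> half_edges Y" \<omega> by (rule voltage_graph_component[OF Y])
  have "(\<Prod>h \<in> set (SOME c. is_cycle Y c). extend_voltage Y (Or \<inter> half_edges Y) \<omega> h) =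
      (\<Prod>h \<in> set (SOME c. is_cycle Y c). extend_voltage Y Or \<omega> h)"
    if "card (edges Y) = card (U \<inter> verts Y)" "verts Y \<subseteq> U"
  proof -
    have "U \<inter> verts Y = verts Y" using that(2) by blast
    then have "\<exists>c. is_cycle Y c"
      using Y.exists_cycle[OF connected_component[OF Y]] Y.card_edges that(1) by simp
    then have "is_cycle Y (SOME c. is_cycle Y c)" by (rule someI_ex)
    then have "set (SOME c. is_cycle Y c) \<subseteq> half_edges Y" by (rule is_cycle_half_edges)
    then show ?thesis by (intro prod.cong) (auto simp: extend_voltage_def)
  qed
  then show ?thesis by (simp add: block_weight_def)
qed

lemma card_Or_component: "Y \<in> components X \<Longrightarrow> card (edges Y) = card (Or \<inter> half_edges Y)"
  using voltage_graph.card_edges[OF voltage_graph_component] by blast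

lemma card_Or_eq_sum_components: "card Or = (\<Sum>Y \<in> components X. card (Or \<inter> half_edges Y))"
proof -
  have "card Or = (\<Sum>Y \<in> components X. card {h \<in> Or. component_of X (root X h) = Y})"
    unfolding card_eq_sum
    by (rule sum.group[symmetric]) (use finite_Or finite_components root_closed Or_half_edges in \<open>auto simp: components_eq\<close>)
  also have "\<dots> = (\<Sum>Y \<in> components X. card (Or \<inter> half_edges Y))"
    using component_half_edges_iff Or_half_edges by (intro sum.cong refl arg_cong[where f = card]) auto
  finally show ?thesis .
qed

lemma card_eq_sum_components:
  assumes U: "U \<subseteq> verts X"
  shows "card U = (\<Sum>Y \<in> components X. card (U \<inter> verts Y))"
proof -
  have "card U = (\<Sum>Y \<in> components X. card {v \<in> U. component_of X v = Y})"
    unfolding card_eq_sum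
    by (rule sum.group[symmetric]) (use U finite_subset[OF U finite_verts] finite_components in \<open>auto simp: components_eq\<close>)
  also have "\<dots> = (\<Sum>Y \<in> components X. card (U \<inter> verts Y))"
    using component_verts_iff U by (intro sum.cong refl arg_cong[where f = card]) auto
  finally show ?thesis .
qed

lemma incidence_nonzero:
  assumes "h \<in> half_edges X" "incidence X \<omega> v h \<noteq> 0"
  shows "component_of X v = component_of X (root X h)"
proof -
  have "root X h = v \<or> root X (opp X h) = v"
    using assms(2) by (auto simp: incidence_def)
  then show ?thesis using component_of_opp[OF assms(1)] by auto
qed

lemma prod_block_weight_zero:
  assumes "Y \<in> components X" "card (edges Y) \<noteq> card (U \<inter> verts Y)"
  shows "(\<Prod>Y \<in> components X. block_weight U Or \<omega> Y) = 0"
  using assms finite_components by (intro prod_zero) (auto simp: block_weight_def)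

text \<open>A nonzero term of the determinant injects the rows of each component into its edges. As
  the totals agree, all these injections are bijections; hence one block that is not square makes
  both sides 0. If all blocks are square, the columns can be matched within each component, which
  makes the matrix block diagonal.\<close>

lemma norm_det_incidence:
  assumes U: "U \<subseteq> verts X" and f: "bij_betw f U Or"
  shows "(cmod (det_on U (\<lambda>i j. incidence X \<omega> i (f j))))\<^sup>2 = (\<Prod>Y \<in> components X. block_weight U Or \<omega> Y)"
proof (cases "\<forall>Y \<in> components X. card (U \<inter> verts Y) = card (Or \<inter> half_edges Y)")
  case False
  have finU: "finite U" using U finite_verts finite_subset by blast
  have "(\<Prod>i \<in> U. incidence X \<omega> i (f (p i))) = 0" if p: "p permutes U" for p
  proof (rule ccontr)
    assume "(\<Prod>i \<in> U. incidence X \<omega> i (f (p i))) \<noteq> 0"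
    then have nz: "incidence X \<omega> i (f (p i)) \<noteq> 0" if "i \<in> U" for i using that finU by auto
    have fp: "bij_betw (\<lambda>i. f (p i)) U Or"
      using bij_betw_trans[OF permutes_imp_bij[OF p] f] by (simp add: o_def)
    have "card (U \<inter> verts Y) \<le> card (Or \<inter> half_edges Y)" if Y: "Y \<in> components X" for Y
    proof (rule card_inj_on_le)
      show "inj_on (\<lambda>i. f (p i)) (U \<inter> verts Y)"
        using fp by (auto simp: bij_betw_def inj_on_def)
      show "(\<lambda>i. f (p i)) ` (U \<inter> verts Y) \<subseteq> Or \<inter> half_edges Y"
      proof
        fix h assume "h \<in> (\<lambda>i. f (p i)) ` (U \<inter> verts Y)"
        then obtain i where i: "i \<in> U" "i \<in> verts Y" "h = f (p i)" by auto
        then have h: "h \<in> Or" using bij_betwE[OF fp] by blast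
        then have "component_of X (root X h) = Y"
          using incidence_nonzero[OF Or_half_edges[OF h], of i] nz i component_verts_iff[OF Y] U by auto
        then show "h \<in> Or \<inter> half_edges Y" using h component_half_edges_iff[OF Y Or_half_edges[OF h]] by simp
      qed
    qed (use finite_Or in simp)
    moreover have "(\<Sum>Y \<in> components X. card (U \<inter> verts Y)) = (\<Sum>Y \<in> components X. card (Or \<inter> half_edges Y))"
      using card_eq_sum_components[OF U] card_Or_eq_sum_components bij_betw_same_card[OF f] by simp
    ultimately show False using False sum_mono_inv[OF _ _ _ finite_components] by (metis (no_types, lifting))
  qed
  then have "det_on U (\<lambda>i j. incidence X \<omega> i (f j)) = 0" by (simp add: det_on_def)
  moreover obtain Y where "Y \<in> components X" "card (edges Y) \<noteq> card (U \<inter> verts Y)"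
    using False card_Or_component by fastforce
  ultimately show ?thesis using prod_block_weight_zero by simp
next
  case True
  have finU: "finite U" using U finite_verts finite_subset by blast
  have "\<exists>g. bij_betw g (U \<inter> verts Y) (Or \<inter> half_edges Y)" if "Y \<in> components X" for Y
    using True that finU finite_Or by (intro finite_same_card_bij) auto
  then obtain g where g: "\<And>Y. Y \<in> components X \<Longrightarrow> bij_betw (g Y) (U \<inter> verts Y) (Or \<inter> half_edges Y)"
    by metis
  define g' where "g' = (\<lambda>v. g (component_of X v) v)"
  have comp: "component_of X v \<in> components X" if "v \<in> U" for v using that U by (auto simp: components_eq)
  have g'_in: "g' v \<in> Or" "component_of X (root X (g' v)) = component_of X v" if v: "v \<in> U" for v
  proof -
    have "v \<in> verts (component_of X v)" by simp
    then have "g' v \<in> Or \<inter> half_edges (component_of X v)"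
      unfolding g'_def using bij_betwE[OF g[OF comp[OF v]]] v by blast
    then show "g' v \<in> Or" "component_of X (root X (g' v)) = component_of X v"
      using component_half_edges_iff[OF comp[OF v]] Or_half_edges by auto
  qed
  have "inj_on g' U"
  proof (rule inj_onI)
    fix u v assume uv: "u \<in> U" "v \<in> U" "g' u = g' v"
    then have eq: "component_of X u = component_of X v" using g'_in(2) by metis
    moreover have "v \<in> verts (component_of X v)" "u \<in> verts (component_of X u)" by simp_all
    ultimately show "u = v"
      using uv g[OF comp[OF uv(2)]] unfolding g'_def bij_betw_def inj_on_def by (metis IntI)
  qed
  moreover have "card (g' ` U) = card Or"
    using card_image[OF \<open>inj_on g' U\<close>] bij_betw_same_card[OF f] by simp
  moreover have "g' ` U \<subseteq> Or" using g'_in by auto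
  ultimately have g': "bij_betw g' U Or"
    using finite_Or card_subset_eq[of Or "g' ` U"] by (simp add: bij_betw_def)
  have "det_on U (\<lambda>i j. incidence X \<omega> i (g' j)) =
      (\<Prod>Y \<in> components X. det_on {v \<in> U. component_of X v = Y} (\<lambda>i j. incidence X \<omega> i (g' j)))"
  proof (rule det_on_block_diagonal[OF finU finite_components])
    show "component_of X ` U \<subseteq> components X" using comp by auto
    fix i j assume "i \<in> U" "j \<in> U" "component_of X i \<noteq> component_of X j"
    then show "incidence X \<omega> i (g' j) = 0"
      using incidence_nonzero[of "g' j" i] g'_in[of j] Or_half_edges by auto
  qed
  then have "(cmod (det_on U (\<lambda>i j. incidence X \<omega> i (g' j))))\<^sup>2 =
      (\<Prod>Y \<in> components X. (cmod (det_on {v \<in> U. component_of X v = Y} (\<lambda>i j. incidence X \<omega> i (g' j))))\<^sup>2)"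
    by (simp add: prod_norm[symmetric] prod_power_distrib)
  also have "\<dots> = (\<Prod>Y \<in> components X. block_weight U Or \<omega> Y)"
  proof (rule prod.cong[OF refl])
    fix Y assume Y: "Y \<in> components X"
    interpret Y: voltage_graph Y "Or \<inter> half_edges Y" \<omega> by (rule voltage_graph_component[OF Y])
    have eq: "{v \<in> U. component_of X v = Y} = U \<inter> verts Y" using component_verts_iff[OF Y] U by auto
    have "det_on {v \<in> U. component_of X v = Y} (\<lambda>i j. incidence X \<omega> i (g' j)) =
        det_on (U \<inter> verts Y) (\<lambda>i j. incidence Y \<omega> i (g Y j))"
      unfolding eq[symmetric]
      by (rule det_on_cong) (auto simp: g'_def incidence_def component_facts[OF Y])
    then show "(cmod (det_on {v \<in> U. component_of X v = Y} (\<lambda>i j. incidence X \<omega> i (g' j))))\<^sup>2 =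
        block_weight U Or \<omega> Y"
      using Y.norm_det_incidence_connected[OF connected_component[OF Y] g[OF Y]]
        block_weight_Int_half_edges[OF Y] by simp
  qed
  finally show ?thesis
    using norm_det_on_column_indexing[OF finU f g', of "incidence X \<omega>"] by simp
qed

text \<open>The Laplacian factors as incidence matrix times weights times adjoint. By Cauchy-Binet
  its determinant is a sum over the sets of retained edges; the second minor is the conjugate of the
  first, so only squared moduli remain. The index \<open>F\<close> is the set of deleted edges, the
  role it has in the weight polynomial.\<close>

theorem matrix_tree:
  fixes y :: "'h set \<Rightarrow> real"
  assumes U: "U \<subseteq> verts X"
  shows "det_on U (\<lambda>u v. \<Sum>h \<in> Or. of_real (y {h, opp X h}) * incidence X \<omega> u h * cnj (incidence X \<omega> v h)) =
    of_real (\<Sum>F | F \<subseteq> edges X. (\<Prod>e \<in> edges X - F. y e) *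
      (\<Prod>Y \<in> components (delete_edges X F). block_weight U Or \<omega> Y))"
proof -
  have finU: "finite U" using U finite_verts finite_subset by blast
  define Orm where "Orm = (\<lambda>F. {h \<in> Or. {h, opp X h} \<notin> F})"
  define w where "w = (\<lambda>F. \<Prod>Y \<in> components (delete_edges X F). block_weight U Or \<omega> Y)"
  have "\<exists>f. bij_betw f U S" if "S \<subseteq> Or" "card S = card U" for S
    using that finU finite_Or finite_subset by (metis finite_same_card_bij)
  then obtain f where f: "\<And>S. S \<subseteq> Or \<Longrightarrow> card S = card U \<Longrightarrow> bij_betw (f S) U S" by metis
  have wF: "w F = (if card (Orm F) = card U then (cmod (det_on U (\<lambda>i j. incidence X \<omega> i (f (Orm F) j))))\<^sup>2 else 0)"
    if F: "F \<subseteq> edges X" for F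
  proof -
    interpret D: voltage_graph "delete_edges X F" "Orm F" \<omega>
      unfolding Orm_def by (rule voltage_graph_delete_edges[OF F])
    have w: "w F = (\<Prod>Y \<in> components (delete_edges X F). block_weight U (Orm F) \<omega> Y)"
      unfolding w_def
    proof (rule prod.cong[OF refl])
      fix Y assume Y: "Y \<in> components (delete_edges X F)"
      have "Or \<inter> half_edges Y = Orm F \<inter> half_edges Y"
        using D.component_facts(4)[OF Y] half_edges_delete_edges[OF F] by (auto simp: Orm_def)
      then have "extend_voltage Y Or \<omega> h = extend_voltage Y (Orm F) \<omega> h" if "h \<in> half_edges Y" for h
        using that by (auto simp: extend_voltage_def)
      moreover have "set (SOME c. is_cycle Y c) \<subseteq> half_edges Y"
        if "card (edges Y) = card (U \<inter> verts Y)" "verts Y \<subseteq> U"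
      proof -
        interpret Y: voltage_graph Y "Orm F \<inter> half_edges Y" \<omega> by (rule D.voltage_graph_component[OF Y])
        have "U \<inter> verts Y = verts Y" using that(2) by blast
        then have "\<exists>c. is_cycle Y c"
          using Y.exists_cycle[OF D.connected_component[OF Y]] Y.card_edges that(1) by simp
        then have "is_cycle Y (SOME c. is_cycle Y c)" by (rule someI_ex)
        then show ?thesis by (rule is_cycle_half_edges)
      qed
      ultimately have "(\<Prod>h \<in> set (SOME c. is_cycle Y c). extend_voltage Y Or \<omega> h) =
          (\<Prod>h \<in> set (SOME c. is_cycle Y c). extend_voltage Y (Orm F) \<omega> h)"
        if "card (edges Y) = card (U \<inter> verts Y)" "verts Y \<subseteq> U"
        using that by (intro prod.cong) auto
      then show "block_weight U Or \<omega> Y = block_weight U (Orm F) \<omega> Y"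
        by (simp add: block_weight_def)
    qed
    show ?thesis
    proof (cases "card (Orm F) = card U")
      case True
      have "bij_betw (f (Orm F)) U (Orm F)" using f True by (auto simp: Orm_def)
      then show ?thesis
        using D.norm_det_incidence[of U "f (Orm F)"] U True w by (simp add: incidence_def)
    next
      case False
      have U': "U \<subseteq> verts (delete_edges X F)" using U by simp
      \<comment> \<open>The numbers of rows and columns add up over the components, so a matrix that
        is not square has a block that is not square, of weight 0.\<close>
      have "\<exists>Y \<in> components (delete_edges X F). card (edges Y) \<noteq> card (U \<inter> verts Y)"
      proof (rule ccontr)
        assume "\<not> ?thesis"
        then have "card (Orm F) = card U"
          using D.card_eq_sum_components[OF U'] D.card_Or_eq_sum_components D.card_Or_component by simp
        then show False using False by simp
      qed
      then show ?thesis using D.prod_block_weight_zero False w by auto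
    qed
  qed
  have "det_on U (\<lambda>u v. \<Sum>h \<in> Or. of_real (y {h, opp X h}) * incidence X \<omega> u h * cnj (incidence X \<omega> v h)) =
      (\<Sum>S | S \<subseteq> Or \<and> card S = card U.
         det_on U (\<lambda>i j. of_real (y {f S j, opp X (f S j)}) * incidence X \<omega> i (f S j)) *
         det_on U (\<lambda>i j. cnj (incidence X \<omega> j (f S i))))"
    by (rule det_on_Cauchy_Binet[OF finU finite_Or f])
  also have "\<dots> = (\<Sum>S | S \<subseteq> Or \<and> card S = card U.
      of_real ((\<Prod>h \<in> S. y {h, opp X h}) * (cmod (det_on U (\<lambda>i j. incidence X \<omega> i (f S j))))\<^sup>2))"
  proof (rule sum.cong[OF refl])
    fix S assume "S \<in> {S. S \<subseteq> Or \<and> card S = card U}"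
    then have fS: "bij_betw (f S) U S" using f by simp
    let ?D = "det_on U (\<lambda>i j. incidence X \<omega> i (f S j))"
    have "det_on U (\<lambda>i j. cnj (incidence X \<omega> j (f S i))) = det_on U (\<lambda>i j. cnj (incidence X \<omega> i (f S j)))"
      by (rule det_on_transpose[OF finU, where M = "\<lambda>i j. cnj (incidence X \<omega> i (f S j))"])
    also have "\<dots> = cnj ?D" by (simp add: det_on_def)
    finally have 1: "det_on U (\<lambda>i j. cnj (incidence X \<omega> j (f S i))) = cnj ?D" .
    have "(\<Prod>i \<in> U. y {f S (p i), opp X (f S (p i))}) = (\<Prod>h \<in> S. y {h, opp X h})" if p: "p permutes U" for p
      using prod.reindex_bij_betw[OF bij_betw_trans[OF permutes_imp_bij[OF p] fS], of "\<lambda>h. y {h, opp X h}"]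
      by simp
    then have "det_on U (\<lambda>i j. of_real (y {f S j, opp X (f S j)}) * incidence X \<omega> i (f S j)) =
        of_real (\<Prod>h \<in> S. y {h, opp X h}) * ?D"
      by (simp add: det_on_def prod.distrib sum_distrib_left mult_ac of_real_prod[symmetric] del: of_real_prod)
    then show "det_on U (\<lambda>i j. of_real (y {f S j, opp X (f S j)}) * incidence X \<omega> i (f S j)) *
         det_on U (\<lambda>i j. cnj (incidence X \<omega> j (f S i))) =
        of_real ((\<Prod>h \<in> S. y {h, opp X h}) * (cmod ?D)\<^sup>2)"
      unfolding 1 by (simp add: complex_norm_square[symmetric] mult.assoc)
  qed
  \<comment> \<open>Retained source half-edges \<open>S\<close> correspond to the complementary set
    \<open>F\<close> of deleted edges.\<close>
  also have "\<dots> = (\<Sum>F \<in> {F. F \<subseteq> edges X \<and> card (Orm F) = card U}. of_real ((\<Prod>e \<in> edges X - F. y e) * w F))"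
  proof (rule sum.reindex_bij_witness[where i = Orm and j = "\<lambda>S. edges X - (\<lambda>h. {h, opp X h}) ` S"])
    have im: "(\<lambda>h. {h, opp X h}) ` Or = edges X" and inj: "inj_on (\<lambda>h. {h, opp X h}) Or"
      using bij_betw_Or_edges by (auto simp: bij_betw_def)
    fix S assume S: "S \<in> {S. S \<subseteq> Or \<and> card S = card U}"
    show 1: "Orm (edges X - (\<lambda>h. {h, opp X h}) ` S) = S"
      using S im inj by (auto simp: Orm_def dest: inj_onD)
    show 2: "edges X - (\<lambda>h. {h, opp X h}) ` S \<in> {F. F \<subseteq> edges X \<and> card (Orm F) = card U}"
      using S 1 by auto
    have "edges X - (edges X - (\<lambda>h. {h, opp X h}) ` S) = (\<lambda>h. {h, opp X h}) ` S"
      using S im by blast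
    moreover have "(\<Prod>e \<in> (\<lambda>h. {h, opp X h}) ` S. y e) = (\<Prod>h \<in> S. y {h, opp X h})"
      using S inj by (subst prod.reindex) (auto intro: inj_on_subset)
    ultimately show "of_real ((\<Prod>e \<in> edges X - (edges X - (\<lambda>h. {h, opp X h}) ` S). y e) *
        w (edges X - (\<lambda>h. {h, opp X h}) ` S)) =
      of_real ((\<Prod>h \<in> S. y {h, opp X h}) * (cmod (det_on U (\<lambda>i j. incidence X \<omega> i (f S j))))\<^sup>2)"
      using wF[of "edges X - (\<lambda>h. {h, opp X h}) ` S"] S 1 by simp
  next
    have im: "(\<lambda>h. {h, opp X h}) ` Or = edges X" using bij_betw_Or_edges by (auto simp: bij_betw_def)
    fix F assume F: "F \<in> {F. F \<subseteq> edges X \<and> card (Orm F) = card U}"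
    have "(\<lambda>h. {h, opp X h}) ` Orm F = edges X - F" unfolding im[symmetric] by (auto simp: Orm_def)
    then show "edges X - (\<lambda>h. {h, opp X h}) ` Orm F = F" using F by auto
    show "Orm F \<in> {S. S \<subseteq> Or \<and> card S = card U}" using F by (auto simp: Orm_def)
  qed
  also have "\<dots> = (\<Sum>F | F \<subseteq> edges X. of_real ((\<Prod>e \<in> edges X - F. y e) * w F))"
    using wF finite_edges by (intro sum.mono_neutral_left) auto
  finally show ?thesis by (simp add: w_def)
qed

end

context half_edge_graph
begin

text \<open>A component without \<open>r\<close> would have weight 0, either because it is not
  square or because its cycle factor is \<open>1 - 1\<close>. So every component contains
  \<open>r\<close>, there is only one, and its edge count makes it a tree.\<close>

lemma matrix_tree_spanning_trees:
  fixes y :: "'h set \<Rightarrow> real"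
  assumes Or: "orientation X Or" and r: "r \<in> verts X"
  shows "det_on (verts X - {r}) (\<lambda>u v. \<Sum>h \<in> Or. of_real (y {h, opp X h}) *
      incidence X (\<lambda>_. 1) u h * cnj (incidence X (\<lambda>_. 1) v h)) =
    of_real (\<Sum>T \<in> spanning_trees X. \<Prod>e \<in> T. y e)"
proof -
  interpret voltage_graph X Or "\<lambda>_. 1" by standard (use Or in auto)
  let ?U = "verts X - {r}"
  have w: "(\<Prod>Y \<in> components (delete_edges X F). block_weight ?U Or (\<lambda>_. 1) Y) =
      of_bool (edges X - F \<in> spanning_trees X)" if F: "F \<subseteq> edges X" for F
  proof -
    let ?D = "delete_edges X F" and ?O = "{h \<in> Or. {h, opp X h} \<notin> F}"
    interpret D: voltage_graph ?D ?O "\<lambda>_. 1" by (rule voltage_graph_delete_edges[OF F])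
    have "edges X - (edges X - F) = F" using F by blast
    then have tree: "edges X - F \<in> spanning_trees X \<longleftrightarrow> is_tree ?D" by (simp add: spanning_trees_def)
    have one: "(\<Prod>h \<in> A. extend_voltage Y Or (\<lambda>_. 1) h) = 1" for A and Y :: "('v, 'h) hgraph"
      by (simp add: extend_voltage_def cong: if_cong)
    have cardU: "card (?U \<inter> verts ?D) + 1 = card (verts X)"
      using r finite_verts card_Suc_Diff1[of "verts X" r] by (simp add: Int_absorb2)
    show ?thesis
    proof (cases "is_tree ?D")
      case True
      then have conn: "connected_graph ?D" and card: "card (verts X) = card ?O + 1"
        using D.is_tree_iff[OF D.orientation] by auto
      then show ?thesis
        using True tree D.components_connected[OF conn] D.card_edges cardU r by (auto simp: block_weight_def)
    next
      case False
      have "\<exists>Y \<in> components ?D. block_weight ?U Or (\<lambda>_. 1) Y = 0"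
      proof (rule ccontr)
        assume "\<not> ?thesis"
        then have nz: "block_weight ?U Or (\<lambda>_. 1) Y \<noteq> 0" if "Y \<in> components ?D" for Y using that by blast
        have rY: "r \<in> verts Y" if Y: "Y \<in> components ?D" for Y
          using nz[OF Y] D.component_facts(3)[OF Y] by (auto simp: block_weight_def one split: if_splits)
        have same: "component_of ?D v = component_of ?D r" if "v \<in> verts X" for v
        proof -
          have Y: "component_of ?D v \<in> components ?D" using that by (auto simp: components_eq)
          show ?thesis using D.component_verts_iff[OF Y, of r] rY[OF Y] r by simp
        qed
        have reach: "(r, v) \<in> (adjacency ?D)\<^sup>*" if "v \<in> verts X" for v
          using D.component_of_eq_iff[of v r] same[OF that] that r by simp
        have conn: "connected_graph ?D"
          unfolding connected_graph_def delete_edges_simps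
          using r rtrancl_trans[OF D.reachable_sym[OF reach] reach] by blast
        have "block_weight ?U Or (\<lambda>_. 1) ?D \<noteq> 0" using nz D.components_connected[OF conn] by simp
        then have "card (edges ?D) = card (?U \<inter> verts ?D)" by (auto simp: block_weight_def split: if_splits)
        then show False
          using False conn cardU D.card_edges D.is_tree_iff[OF D.orientation] by simp
      qed
      then show ?thesis using False tree D.finite_components by (auto intro: prod_zero)
    qed
  qed
  have "(\<Sum>F | F \<subseteq> edges X. (\<Prod>e \<in> edges X - F. y e) *
      (\<Prod>Y \<in> components (delete_edges X F). block_weight ?U Or (\<lambda>_. 1) Y)) =
    (\<Sum>F | F \<subseteq> edges X \<and> edges X - F \<in> spanning_trees X. \<Prod>e \<in> edges X - F. y e)"
    using finite_edges by (intro sum.mono_neutral_cong_right) (auto simp: w)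
  also have "\<dots> = (\<Sum>T \<in> spanning_trees X. \<Prod>e \<in> T. y e)"
    by (rule sum.reindex_bij_witness[where i = "\<lambda>T. edges X - T" and j = "\<lambda>F. edges X - F"])
      (auto simp: spanning_trees_def double_diff)
  finally show ?thesis using matrix_tree[of ?U y] by simp
qed

end

text \<open>The two kinds of components of a basis are the two ways in which a connected block can
  be square: all its vertices index rows and the genus is one, or exactly one vertex, where \<rho>
  is nontrivial on \<open>D\<close>, is missing and the component is a tree.\<close>

lemma (in comm_group) matrix_tree_weight:
  fixes X :: "('v, 'h) hgraph" and y :: "'h set \<Rightarrow> real"
  assumes fin: "finite (carrier G)" and \<rho>: "\<rho> \<in> characters G" and X: "half_edge_graph X"
    and Or: "orientation X Or" and \<eta>: "\<eta> \<in> Or \<rightarrow> carrier G"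
  shows "det_on {v \<in> verts X. \<rho> ` D v = {1}} (\<lambda>u v. \<Sum>h \<in> Or. of_real (y {h, opp X h}) *
      incidence X (\<lambda>h. \<rho> (\<eta> h)) u h * cnj (incidence X (\<lambda>h. \<rho> (\<eta> h)) v h)) =
    of_real (\<Sum>F \<in> matroid_bases G D Or \<eta> \<rho> X. basis_weight G D Or \<eta> \<rho> X F * (\<Prod>e \<in> edges X - F. y e))"
proof -
  interpret half_edge_graph X by (rule X)
  interpret voltage_graph X Or "\<lambda>h. \<rho> (\<eta> h)"
    by standard (use Or norm_character[OF fin \<rho>] \<eta> in auto)
  let ?U = "{v \<in> verts X. \<rho> ` D v = {1}}" and ?\<omega> = "\<lambda>h. \<rho> (\<eta> h)"
  have w: "(\<Prod>Y \<in> components (delete_edges X F). block_weight ?U Or ?\<omega> Y) =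
      (if F \<in> matroid_bases G D Or \<eta> \<rho> X then basis_weight G D Or \<eta> \<rho> X F else 0)" if F: "F \<subseteq> edges X" for F
  proof -
    let ?D = "delete_edges X F" and ?O = "{h \<in> Or. {h, opp X h} \<notin> F}"
    interpret D: voltage_graph ?D ?O ?\<omega> by (rule voltage_graph_delete_edges[OF F])
    have bw: "block_weight ?U Or ?\<omega> Y =
        (if cyclic_type G D Or \<eta> \<rho> Y \<or> tree_type D \<rho> Y then component_weight G D Or \<eta> \<rho> Y else 0)"
      if Y: "Y \<in> components ?D" for Y
    proof -
      interpret Y: voltage_graph Y "?O \<inter> half_edges Y" ?\<omega> by (rule D.voltage_graph_component[OF Y])
      have conn: "connected_graph Y" by (rule D.connected_component[OF Y])
      have VY: "verts Y \<subseteq> verts X" using D.component_facts(3)[OF Y] by simp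
      have HY: "half_edges Y \<subseteq> half_edges X"
        using D.component_facts(4)[OF Y] half_edges_delete_edges[OF F] by auto
      have oY: "opp Y = opp X" using D.component_facts(1)[OF Y] by simp
      have genus: "genus Y = 1 \<longleftrightarrow> card (edges Y) = card (verts Y)" by (simp add: genus_def)
      have sub: "verts Y \<subseteq> ?U \<longleftrightarrow> (\<forall>v \<in> verts Y. \<rho> ` D v = {1})" using VY by auto
      have alive: "card (?U \<inter> verts Y) = card (verts Y)" if "verts Y \<subseteq> ?U"
        using that by (simp add: Int_absorb1)
      have voltage: "\<rho> (cycle_voltage G Y Or \<eta>) = (\<Prod>h \<in> set (SOME c. is_cycle Y c). extend_voltage Y Or ?\<omega> h)"
        if "card (edges Y) = card (verts Y)"
      proof -
        let ?c = "SOME c. is_cycle Y c"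
        have "\<exists>c. is_cycle Y c" using Y.exists_cycle[OF conn] Y.card_edges that by simp
        then have "is_cycle Y ?c" by (rule someI_ex)
        then have c: "set ?c \<subseteq> half_edges X" using is_cycle_half_edges HY by blast
        have hv: "half_edge_voltage G Y Or \<eta> h \<in> carrier G" "\<rho> (half_edge_voltage G Y Or \<eta> h) = extend_voltage Y Or ?\<omega> h"
          if "h \<in> half_edges X" for h
          using \<eta> opp_in_Or_iff[OF that] character_inv[OF fin \<rho>]
          by (auto simp: half_edge_voltage_def extend_voltage_def oY)
        show ?thesis
          unfolding cycle_voltage_def using c hv
          by (subst character_finprod[OF \<rho>]) (auto intro!: prod.cong)
      qed
      have tree: "tree_type D \<rho> Y \<longleftrightarrow> card (edges Y) = card (?U \<inter> verts Y) \<and> \<not> verts Y \<subseteq> ?U"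
      proof
        assume "tree_type D \<rho> Y"
        then obtain v where v: "v \<in> verts Y" "\<rho> ` D v \<noteq> {1}" "\<And>u. u \<in> verts Y \<Longrightarrow> \<rho> ` D u \<noteq> {1} \<Longrightarrow> u = v"
          and t: "is_tree Y" unfolding tree_type_def by blast
        have "?U \<inter> verts Y = verts Y - {v}" using v VY by blast
        moreover have "card (verts Y) = card (edges Y) + 1"
          using t Y.is_tree_iff[OF Y.orientation] Y.card_edges by simp
        ultimately show "card (edges Y) = card (?U \<inter> verts Y) \<and> \<not> verts Y \<subseteq> ?U"
          using v(1,2) Y.finite_verts by (intro conjI) (simp, blast)
      next
        assume a: "card (edges Y) = card (?U \<inter> verts Y) \<and> \<not> verts Y \<subseteq> ?U"
        then obtain v where v: "v \<in> verts Y" "v \<notin> ?U" by blast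
        have "card (verts Y - {v}) \<le> card (?U \<inter> verts Y)"
          using a Y.card_verts_le[OF conn] Y.card_edges v Y.finite_verts by simp
        then have eq: "?U \<inter> verts Y = verts Y - {v}"
          using v Y.finite_verts by (intro card_seteq) auto
        then have "card (verts Y) = card (edges Y) + 1"
          using a v Y.finite_verts card_Suc_Diff1[of "verts Y" v] by simp
        then have "is_tree Y" using Y.is_tree_iff[OF Y.orientation] conn Y.card_edges by simp
        moreover have "\<exists>!v. v \<in> verts Y \<and> \<rho> ` D v \<noteq> {1}"
          using v eq VY by (intro ex1I[of _ v]) auto
        ultimately show "tree_type D \<rho> Y" by (simp add: tree_type_def)
      qed
      have cyclic: "cyclic_type G D Or \<eta> \<rho> Y \<longleftrightarrow> card (edges Y) = card (?U \<inter> verts Y) \<and> verts Y \<subseteq> ?U \<and>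
          \<rho> (cycle_voltage G Y Or \<eta>) \<noteq> 1"
        unfolding cyclic_type_def genus sub[symmetric] using alive by auto
      show ?thesis
      proof (cases "card (edges Y) = card (?U \<inter> verts Y) \<and> verts Y \<subseteq> ?U")
        case True
        then have "block_weight ?U Or ?\<omega> Y = (cmod (1 - \<rho> (cycle_voltage G Y Or \<eta>)))\<^sup>2"
          using voltage alive by (simp add: block_weight_def)
        \<comment> \<open>If \<rho> takes the value 1 on the cycle, the component is of neither
          type, and the squared modulus is 0 as well.\<close>
        then show ?thesis using True tree cyclic by (auto simp: component_weight_def)
      next
        case False
        then show ?thesis using tree cyclic by (auto simp: block_weight_def component_weight_def)
      qed
    qed
    show ?thesis
    proof (cases "F \<in> matroid_bases G D Or \<eta> \<rho> X")
      case True
      then show ?thesis unfolding basis_weight_def by (auto simp: bw matroid_bases_def intro!: prod.cong)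
    next
      case False
      then obtain Y where "Y \<in> components ?D" "block_weight ?U Or ?\<omega> Y = 0"
        using F bw by (auto simp: matroid_bases_def)
      then show ?thesis using False D.finite_components by (auto intro: prod_zero)
    qed
  qed
  have "(\<Sum>F | F \<subseteq> edges X. (\<Prod>e \<in> edges X - F. y e) *
      (\<Prod>Y \<in> components (delete_edges X F). block_weight ?U Or ?\<omega> Y)) =
    (\<Sum>F \<in> matroid_bases G D Or \<eta> \<rho> X. basis_weight G D Or \<eta> \<rho> X F * (\<Prod>e \<in> edges X - F. y e))"
  proof (rule sum.mono_neutral_cong_right)
    show "matroid_bases G D Or \<eta> \<rho> X \<subseteq> {F. F \<subseteq> edges X}" by (auto simp: matroid_bases_def)
    then show "(\<Prod>e \<in> edges X - F. y e) *
        (\<Prod>Y \<in> components (delete_edges X F). block_weight ?U Or ?\<omega> Y) =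
        basis_weight G D Or \<eta> \<rho> X F * (\<Prod>e \<in> edges X - F. y e)"
      if "F \<in> matroid_bases G D Or \<eta> \<rho> X" for F
      using w[of F] that by auto
  qed (use finite_edges w in auto)
  then show ?thesis using matrix_tree[of ?U y] by simp
qed


section \<open>The Laplacian of the cover\<close>

lemma det_on_scale:
  assumes "finite A"
  shows "det_on A (\<lambda>i j. c * M i j) = c ^ card A * det_on A M"
  by (simp add: det_on_def prod.distrib sum_distrib_left mult_ac)

text \<open>The right-hand matrix is \<open>M\<close> conjugated by \<Psi>, and the product of the
  determinants of \<Psi> and of its adjoint is the Gram determinant. Hence only inner products of
  the new basis are ever computed; \<pi> serves to make \<Psi> a square matrix.\<close>

lemma det_on_gram_transform:
  fixes \<Psi> :: "'i \<Rightarrow> 'w \<Rightarrow> complex"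
  assumes I: "finite I" and \<pi>: "bij_betw \<pi> I W"
  shows "det_on I (\<lambda>i j. \<Sum>w \<in> W. \<Psi> i w * cnj (\<Psi> j w)) * det_on W M =
    det_on I (\<lambda>i j. \<Sum>w \<in> W. \<Sum>w' \<in> W. \<Psi> i w * M w w' * cnj (\<Psi> j w'))"
proof -
  have sum: "(\<Sum>w \<in> W. f w) = (\<Sum>k \<in> I. f (\<pi> k))" for f :: "'w \<Rightarrow> complex"
    using sum.reindex_bij_betw[OF \<pi>, of f] by simp
  have "det_on I (\<lambda>i j. \<Sum>w \<in> W. \<Sum>w' \<in> W. \<Psi> i w * M w w' * cnj (\<Psi> j w')) =
      det_on I (\<lambda>i j. \<Sum>l \<in> I. (\<Sum>k \<in> I. \<Psi> i (\<pi> k) * M (\<pi> k) (\<pi> l)) * cnj (\<Psi> j (\<pi> l)))"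
    unfolding sum by (subst sum.swap) (simp add: sum_distrib_right)
  also have "\<dots> = det_on I (\<lambda>i j. \<Psi> i (\<pi> j)) * det_on I (\<lambda>i j. M (\<pi> i) (\<pi> j)) *
      det_on I (\<lambda>i j. cnj (\<Psi> j (\<pi> i)))"
    using det_on_mult[OF I, of "\<lambda>i l. \<Sum>k \<in> I. \<Psi> i (\<pi> k) * M (\<pi> k) (\<pi> l)" "\<lambda>l j. cnj (\<Psi> j (\<pi> l))"]
      det_on_mult[OF I, of "\<lambda>i k. \<Psi> i (\<pi> k)" "\<lambda>k l. M (\<pi> k) (\<pi> l)"] by simp
  also have "det_on I (\<lambda>i j. M (\<pi> i) (\<pi> j)) = det_on W M" by (rule det_on_reindex[OF I \<pi>])
  also have "det_on I (\<lambda>i j. \<Psi> i (\<pi> j)) * det_on W M * det_on I (\<lambda>i j. cnj (\<Psi> j (\<pi> i))) =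
      det_on I (\<lambda>i j. \<Sum>l \<in> I. \<Psi> i (\<pi> l) * cnj (\<Psi> j (\<pi> l))) * det_on W M"
    using det_on_mult[OF I, of "\<lambda>i l. \<Psi> i (\<pi> l)" "\<lambda>l j. cnj (\<Psi> j (\<pi> l))"] by simp
  finally show ?thesis unfolding sum by simp
qed

text \<open>Supplies the zero row and column sums that \<open>det_on_rank_one_perturbation\<close>
  requires of a Laplacian.\<close>

lemma gram_sums_zero:
  fixes b :: "'v \<Rightarrow> 'h \<Rightarrow> complex"
  assumes "\<And>h. h \<in> S \<Longrightarrow> (\<Sum>v \<in> A. b v h) = 0"
  shows "(\<Sum>u \<in> A. \<Sum>h \<in> S. y h * b v h * cnj (b u h)) = 0"
    and "(\<Sum>v \<in> A. \<Sum>h \<in> S. y h * b v h * cnj (b u h)) = 0"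
proof -
  have "(\<Sum>u \<in> A. \<Sum>h \<in> S. y h * b v h * cnj (b u h)) = (\<Sum>h \<in> S. y h * b v h * cnj (\<Sum>u \<in> A. b u h))"
    by (subst sum.swap) (simp add: sum_distrib_left)
  then show "(\<Sum>u \<in> A. \<Sum>h \<in> S. y h * b v h * cnj (b u h)) = 0" by (simp add: assms del: cnj_sum)
  have "(\<Sum>v \<in> A. \<Sum>h \<in> S. y h * b v h * cnj (b u h)) = (\<Sum>h \<in> S. y h * (\<Sum>v \<in> A. b v h) * cnj (b u h))"
    by (subst sum.swap) (simp add: sum_distrib_left sum_distrib_right)
  then show "(\<Sum>v \<in> A. \<Sum>h \<in> S. y h * b v h * cnj (b u h)) = 0" by (simp add: assms)
qed

text \<open>Only the explicit model of the cover enters from here on: vertex fibres indexed by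
  cosets through \<nu>, edge fibres by group elements through \<epsilon>. The action of the group is
  contained in these indexings.\<close>

locale voltage_cover = comm_group G + base: half_edge_graph X + cover: half_edge_graph Xt
  for G :: "('g, 'm) monoid_scheme" (structure) and X :: "('v, 'h) hgraph" and Xt :: "('w, 'k) hgraph" +
  fixes pV :: "'w \<Rightarrow> 'v" and pH :: "'k \<Rightarrow> 'h" and Or :: "'h set" and \<eta> :: "'h \<Rightarrow> 'g"
    and D :: "'v \<Rightarrow> 'g set" and \<nu> :: "'v \<Rightarrow> 'g set \<Rightarrow> 'w" and \<epsilon> :: "'h \<Rightarrow> 'g \<Rightarrow> 'k"
  assumes fin: "finite (carrier G)" and Or: "orientation X Or" and \<eta>: "\<eta> \<in> Or \<rightarrow> carrier G"
    and D: "v \<in> verts X \<Longrightarrow> subgroup (D v) G"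
    and pV: "w \<in> verts Xt \<Longrightarrow> pV w \<in> verts X"
    and pH: "k \<in> half_edges Xt \<Longrightarrow> pH k \<in> half_edges X"
    and pH_opp: "k \<in> half_edges Xt \<Longrightarrow> pH (opp Xt k) = opp X (pH k)"
    and \<nu>: "v \<in> verts X \<Longrightarrow> bij_betw (\<nu> v) (rcosets D v) {w \<in> verts Xt. pV w = v}"
    and \<epsilon>: "h \<in> Or \<Longrightarrow> bij_betw (\<epsilon> h) (carrier G) {k \<in> half_edges Xt. pH k = h}"
    and root_\<epsilon>: "h \<in> Or \<Longrightarrow> a \<in> carrier G \<Longrightarrow> root Xt (\<epsilon> h a) = \<nu> (root X h) (D (root X h) #> a)"
    and root_opp_\<epsilon>: "h \<in> Or \<Longrightarrow> a \<in> carrier G \<Longrightarrow>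
      root Xt (opp Xt (\<epsilon> h a)) = \<nu> (root X (opp X h)) (D (root X (opp X h)) #> (a \<otimes> \<eta> h))"
    and nonempty: "verts Xt \<noteq> {}"
begin

abbreviation Or_cover :: "'k set" where
  "Or_cover \<equiv> {k \<in> half_edges Xt. pH k \<in> Or}"

abbreviation trivial_char :: "'g \<Rightarrow> complex" where
  "trivial_char \<equiv> \<lambda>g \<in> carrier G. 1"

abbreviation alive :: "('g \<Rightarrow> complex) \<Rightarrow> 'v set" where
  "alive \<rho> \<equiv> {v \<in> verts X. \<rho> ` D v = {1}}"

lemma orientation_cover: "orientation Xt Or_cover"
  using Or pH pH_opp cover.opp_closed by (auto simp: orientation_def)

lemma Or_half_edges: "h \<in> Or \<Longrightarrow> h \<in> half_edges X"
  using Or by (auto simp: orientation_def)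

lemma finite_Or: "finite Or"
  using Or base.finite_half_edges finite_subset by (auto simp: orientation_def)

lemma D_carrier: "v \<in> verts X \<Longrightarrow> x \<in> D v \<Longrightarrow> x \<in> carrier G"
  using D subgroup.subset by blast

lemma card_D: "v \<in> verts X \<Longrightarrow> 0 < card (D v) \<and> card (D v) dvd order G"
  using D fin lagrange[of "D v"] subgroup.one_closed[OF D] finite_subset[OF subgroup.subset[OF D] fin]
  by (metis card_gt_0_iff dvd_triv_right empty_iff)

lemma sum_Or_cover: "(\<Sum>k \<in> Or_cover. f k) = (\<Sum>h \<in> Or. \<Sum>a \<in> carrier G. f (\<epsilon> h a))"
proof -
  have "(\<Sum>k \<in> Or_cover. f k) = (\<Sum>h \<in> Or. \<Sum>k \<in> {k \<in> Or_cover. pH k = h}. f k)"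
    by (rule sum.group[symmetric]) (use cover.finite_half_edges finite_Or in auto)
  also have "\<dots> = (\<Sum>h \<in> Or. \<Sum>a \<in> carrier G. f (\<epsilon> h a))"
  proof (rule sum.cong[OF refl])
    fix h assume h: "h \<in> Or"
    then have "{k \<in> Or_cover. pH k = h} = {k \<in> half_edges Xt. pH k = h}" by auto
    then show "(\<Sum>k \<in> {k \<in> Or_cover. pH k = h}. f k) = (\<Sum>a \<in> carrier G. f (\<epsilon> h a))"
      using sum.reindex_bij_betw[OF \<epsilon>[OF h], of f] by simp
  qed
  finally show ?thesis .
qed

lemma prod_Or_cover: "(\<Prod>k \<in> Or_cover. f k) = (\<Prod>h \<in> Or. \<Prod>a \<in> carrier G. f (\<epsilon> h a))"
proof -
  have "(\<Prod>k \<in> Or_cover. f k) = (\<Prod>h \<in> Or. \<Prod>k \<in> {k \<in> Or_cover. pH k = h}. f k)"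
    by (rule prod.group[symmetric]) (use cover.finite_half_edges finite_Or in auto)
  also have "\<dots> = (\<Prod>h \<in> Or. \<Prod>a \<in> carrier G. f (\<epsilon> h a))"
  proof (rule prod.cong[OF refl])
    fix h assume h: "h \<in> Or"
    then have "{k \<in> Or_cover. pH k = h} = {k \<in> half_edges Xt. pH k = h}" by auto
    then show "(\<Prod>k \<in> {k \<in> Or_cover. pH k = h}. f k) = (\<Prod>a \<in> carrier G. f (\<epsilon> h a))"
      using prod.reindex_bij_betw[OF \<epsilon>[OF h], of f] by simp
  qed
  finally show ?thesis .
qed

lemma pH_\<epsilon>:
  assumes "h \<in> Or" "a \<in> carrier G"
  shows "\<epsilon> h a \<in> half_edges Xt" "pH (\<epsilon> h a) = h" "pH (opp Xt (\<epsilon> h a)) = opp X h"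
proof -
  show 1: "\<epsilon> h a \<in> half_edges Xt" and 2: "pH (\<epsilon> h a) = h"
    using bij_betwE[OF \<epsilon>[OF assms(1)]] assms(2) by auto
  show "pH (opp Xt (\<epsilon> h a)) = opp X h" using pH_opp[OF 1] 2 by simp
qed

text \<open>A vertex of the fibre is met once for every element of its coset. This moves sums over a
  fibre to the group, where characters are orthogonal, and is the source of the factors
  \<open>card (D v)\<close>.\<close>

lemma sum_fiber:
  fixes f :: "'w \<Rightarrow> complex"
  assumes v: "v \<in> verts X"
  shows "(\<Sum>a \<in> carrier G. f (\<nu> v (D v #> a))) = of_nat (card (D v)) * (\<Sum>w | w \<in> verts Xt \<and> pV w = v. f w)"
proof -
  have "(\<Sum>a \<in> carrier G. f (\<nu> v (D v #> a))) =
      (\<Sum>C \<in> rcosets D v. \<Sum>a \<in> {a \<in> carrier G. D v #> a = C}. f (\<nu> v (D v #> a)))"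
    using fin by (intro sum.group[symmetric]) (auto simp: RCOSETS_def)
  also have "\<dots> = (\<Sum>C \<in> rcosets D v. of_nat (card (D v)) * f (\<nu> v C))"
  proof (rule sum.cong[OF refl])
    fix C assume C: "C \<in> rcosets D v"
    then obtain b where b: "b \<in> carrier G" "C = D v #> b" by (auto simp: RCOSETS_def)
    have "{a \<in> carrier G. D v #> a = C} = C"
    proof (intro Set.set_eqI iffI)
      fix a assume "a \<in> {a \<in> carrier G. D v #> a = C}"
      then show "a \<in> C" using rcos_self[OF _ D[OF v], of a] by blast
    next
      fix a assume a: "a \<in> C"
      then have "a \<in> carrier G" using r_coset_subset_G[OF subgroup.subset[OF D[OF v]] b(1)] b(2) by blast
      moreover have "D v #> a = C" using repr_independence[OF _ b(1) D[OF v], of a] a b(2) by simp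
      ultimately show "a \<in> {a \<in> carrier G. D v #> a = C}" by simp
    qed
    moreover have "(\<Sum>a \<in> {a \<in> carrier G. D v #> a = C}. f (\<nu> v (D v #> a))) =
        (\<Sum>a \<in> {a \<in> carrier G. D v #> a = C}. f (\<nu> v C))" by (rule sum.cong) auto
    ultimately show "(\<Sum>a \<in> {a \<in> carrier G. D v #> a = C}. f (\<nu> v (D v #> a))) = of_nat (card (D v)) * f (\<nu> v C)"
      using card_rcosets_equal[OF C subgroup.subset[OF D[OF v]]] by simp
  qed
  also have "\<dots> = of_nat (card (D v)) * (\<Sum>w | w \<in> verts Xt \<and> pV w = v. f w)"
    using sum.reindex_bij_betw[OF \<nu>[OF v], of f] by (simp add: sum_distrib_left[symmetric])
  finally show ?thesis .
qed

lemma card_fiber: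
  assumes v: "v \<in> verts X"
  shows "card {w \<in> verts Xt. pV w = v} = order G div card (D v)"
proof -
  have "card {w \<in> verts Xt. pV w = v} * card (D v) = order G"
    using bij_betw_same_card[OF \<nu>[OF v]] lagrange[OF D[OF v]] by simp
  then show ?thesis using card_D[OF v] by (metis div_mult_self_is_m)
qed

text \<open>The character transported to the fibre of \<open>v\<close> and extended by 0. The choice
  of the representative is immaterial when \<rho> is trivial on \<open>D v\<close>, that is, for the
  indices in \<open>char_index\<close>.\<close>

definition pullback :: "'v \<times> ('g \<Rightarrow> complex) \<Rightarrow> 'w \<Rightarrow> complex" where
  "pullback = (\<lambda>(v, \<rho>) w. if pV w = v then \<rho> (SOME a. a \<in> carrier G \<and> w = \<nu> v (D v #> a)) else 0)"

definition char_index :: "('v \<times> ('g \<Rightarrow> complex)) set" where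
  "char_index = {(v, \<rho>). \<rho> \<in> characters G \<and> v \<in> alive \<rho>}"

lemma char_indexD:
  assumes "(v, \<rho>) \<in> char_index"
  shows "v \<in> verts X" "\<rho> \<in> characters G" "\<And>x. x \<in> D v \<Longrightarrow> \<rho> x = 1"
  using assms by (auto simp: char_index_def)

lemma trivial_char_alive: "alive trivial_char = verts X"
  using D_carrier subgroup.one_closed[OF D] by (fastforce simp: image_iff)

lemma trivial_char_index: "v \<in> verts X \<Longrightarrow> (v, trivial_char) \<in> char_index"
  using trivial_char_alive trivial_character by (auto simp: char_index_def)

lemma finite_char_index: "finite char_index"
proof (rule finite_subset)
  show "char_index \<subseteq> verts X \<times> characters G" by (auto simp: char_index_def)
qed (use base.finite_verts finite_characters[OF fin] in simp)

lemma pullback_\<nu>: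
  assumes i: "(v, \<rho>) \<in> char_index" and u: "u \<in> verts X" and a: "a \<in> carrier G"
  shows "pullback (v, \<rho>) (\<nu> u (D u #> a)) = \<rho> a * of_bool (u = v)"
proof -
  have pu: "pV (\<nu> u (D u #> a)) = u"
    using bij_betwE[OF \<nu>[OF u]] rcosetsI[OF subgroup.subset[OF D[OF u]] a] by blast
  show ?thesis
  proof (cases "u = v")
    case True
    define b where "b = (SOME b. b \<in> carrier G \<and> \<nu> v (D v #> a) = \<nu> v (D v #> b))"
    have "b \<in> carrier G \<and> \<nu> v (D v #> a) = \<nu> v (D v #> b)"
      unfolding b_def by (rule someI[of _ a]) (use a in simp)
    then have b: "b \<in> carrier G" and eq: "\<nu> v (D v #> a) = \<nu> v (D v #> b)" by auto
    have v: "v \<in> verts X" using u True by simp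
    have "D v #> a = D v #> b"
      using eq \<nu>[OF v] rcosetsI[OF subgroup.subset[OF D[OF v]]] a b by (auto simp: bij_betw_def inj_on_def)
    then have "b \<in> D v #> a" using repr_independenceD[OF D[OF v] b] by simp
    then obtain d where d: "d \<in> D v" "b = d \<otimes> a" by (auto simp: r_coset_def)
    then have "\<rho> b = \<rho> a"
      using char_indexD[OF i] D_carrier[OF v d(1)] a by (simp add: character_mult)
    then show ?thesis using True pu by (simp add: pullback_def b_def)
  qed (use pu in \<open>simp add: pullback_def\<close>)
qed

lemma pullback_eq_0: "pV w \<noteq> v \<Longrightarrow> pullback (v, \<rho>) w = 0"
  by (simp add: pullback_def)

lemma pullback_orthogonality:
  assumes i: "(v, \<rho>) \<in> char_index" and j: "(u, \<sigma>) \<in> char_index"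
  shows "(\<Sum>w \<in> verts Xt. pullback (v, \<rho>) w * cnj (pullback (u, \<sigma>) w)) =
    (if v = u \<and> \<rho> = \<sigma> then of_nat (order G) / of_nat (card (D v)) else 0)"
proof (cases "u = v")
  case True
  note v = char_indexD(1)[OF i]
  let ?f = "\<lambda>w. pullback (v, \<rho>) w * cnj (pullback (v, \<sigma>) w)"
  have "(\<Sum>w \<in> verts Xt. ?f w) = (\<Sum>w | w \<in> verts Xt \<and> pV w = v. ?f w)"
    using cover.finite_verts pullback_eq_0 by (intro sum.mono_neutral_right) auto
  moreover have "of_nat (card (D v)) * (\<Sum>w | w \<in> verts Xt \<and> pV w = v. ?f w) = (\<Sum>a \<in> carrier G. \<rho> a * cnj (\<sigma> a))"
    unfolding sum_fiber[OF v, symmetric] using i j True by (intro sum.cong) (simp_all add: pullback_\<nu>[OF _ v])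
  ultimately show ?thesis
    using True card_D[OF v] character_orthogonality[OF fin char_indexD(2)[OF i] char_indexD(2)[OF j]]
    by (auto simp: field_simps)
next
  case False
  then have 0: "pullback (v, \<rho>) w * cnj (pullback (u, \<sigma>) w) = 0" for w
    using pullback_eq_0[of w v \<rho>] pullback_eq_0[of w u \<sigma>] by (cases "pV w = v") auto
  have "(\<Sum>w \<in> verts Xt. pullback (v, \<rho>) w * cnj (pullback (u, \<sigma>) w)) = 0"
    by (rule sum.neutral) (use 0 in blast)
  then show ?thesis using False by simp
qed

text \<open>The sum is the inner product with the pullback of the trivial character, which is the
  indicator of the fibre. Consequently the all-ones matrix is visible in the block of the trivial
  character only.\<close>

lemma sum_pullback:
  assumes i: "(v, \<rho>) \<in> char_index"
  shows "(\<Sum>w \<in> verts Xt. pullback (v, \<rho>) w) = of_bool (\<rho> = trivial_char) * (of_nat (order G) / of_nat (card (D v)))"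
proof -
  note v = char_indexD(1)[OF i]
  have "pullback (v, \<rho>) w = pullback (v, \<rho>) w * cnj (pullback (v, trivial_char) w)" if w: "w \<in> verts Xt" for w
  proof (cases "pV w = v")
    case True
    then have "w \<in> \<nu> v ` (rcosets D v)" using \<nu>[OF v] w by (auto simp: bij_betw_def)
    then obtain a where "a \<in> carrier G" "w = \<nu> v (D v #> a)" by (auto simp: RCOSETS_def)
    then show ?thesis using pullback_\<nu>[OF trivial_char_index[OF v] v] by simp
  qed (simp add: pullback_eq_0)
  then have "(\<Sum>w \<in> verts Xt. pullback (v, \<rho>) w) =
      (\<Sum>w \<in> verts Xt. pullback (v, \<rho>) w * cnj (pullback (v, trivial_char) w))"
    by (rule sum.cong[OF refl])
  then show ?thesis using pullback_orthogonality[OF i trivial_char_index[OF v]] by simp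
qed

text \<open>The ends of the lift \<open>\<epsilon> h a\<close> carry the indices \<open>a\<close>
  and \<open>a \<otimes> \<eta> h\<close>; multiplicativity of \<rho> extracts
  \<open>\<rho> a\<close> and leaves the voltage of the base edge. In this way the untwisted
  incidence matrix of the cover becomes the twisted one of the base.\<close>

lemma sum_pullback_incidence:
  assumes i: "(v, \<rho>) \<in> char_index" and h: "h \<in> Or" and a: "a \<in> carrier G"
  shows "(\<Sum>w \<in> verts Xt. pullback (v, \<rho>) w * incidence Xt (\<lambda>_. 1) w (\<epsilon> h a)) =
    \<rho> a * incidence X (\<lambda>h. \<rho> (\<eta> h)) v h"
proof -
  let ?k = "\<epsilon> h a"
  have k: "?k \<in> half_edges Xt" using pH_\<epsilon>[OF h a] by simp
  have hX: "root X h \<in> verts X" "root X (opp X h) \<in> verts X" "\<eta> h \<in> carrier G"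
    using base.root_closed base.opp_closed Or_half_edges[OF h] \<eta> h by auto
  have "(\<Sum>w \<in> verts Xt. pullback (v, \<rho>) w * incidence Xt (\<lambda>_. 1) w ?k) =
      (\<Sum>w \<in> verts Xt. if w = root Xt ?k then pullback (v, \<rho>) w else 0) -
      (\<Sum>w \<in> verts Xt. if w = root Xt (opp Xt ?k) then pullback (v, \<rho>) w else 0)"
    unfolding sum_subtractf[symmetric] by (intro sum.cong) (auto simp: incidence_def)
  also have "\<dots> = pullback (v, \<rho>) (root Xt ?k) - pullback (v, \<rho>) (root Xt (opp Xt ?k))"
    using cover.finite_verts cover.root_closed cover.opp_closed k by (simp add: sum.delta)
  also have "\<dots> = \<rho> a * of_bool (root X h = v) - \<rho> (a \<otimes> \<eta> h) * of_bool (root X (opp X h) = v)"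
    unfolding root_\<epsilon>[OF h a] root_opp_\<epsilon>[OF h a] using pullback_\<nu>[OF i] hX a by simp
  also have "\<dots> = \<rho> a * incidence X (\<lambda>h. \<rho> (\<eta> h)) v h"
    using character_mult[OF char_indexD(2)[OF i] a hX(3)] by (simp add: incidence_def algebra_simps)
  finally show ?thesis .
qed

definition laplacian :: "('h set \<Rightarrow> real) \<Rightarrow> ('g \<Rightarrow> complex) \<Rightarrow> 'v \<Rightarrow> 'v \<Rightarrow> complex" where
  "laplacian y \<rho> u v = (\<Sum>h \<in> Or. of_real (y {h, opp X h}) *
     incidence X (\<lambda>h. \<rho> (\<eta> h)) u h * cnj (incidence X (\<lambda>h. \<rho> (\<eta> h)) v h))"

definition cover_laplacian :: "('h set \<Rightarrow> real) \<Rightarrow> 'w \<Rightarrow> 'w \<Rightarrow> complex" where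
  "cover_laplacian y u w = (\<Sum>k \<in> Or_cover. of_real (y (pH ` {k, opp Xt k})) *
     incidence Xt (\<lambda>_. 1) u k * cnj (incidence Xt (\<lambda>_. 1) w k))"

text \<open>The lifts of an edge differ only by the factors \<open>\<rho> a\<close> and
  \<open>cnj (\<sigma> a)\<close>, and orthogonality of characters evaluates their sum over the
  group.\<close>

lemma pullback_laplacian:
  assumes i: "(v, \<rho>) \<in> char_index" and j: "(u, \<sigma>) \<in> char_index"
  shows "(\<Sum>w \<in> verts Xt. \<Sum>w' \<in> verts Xt. pullback (v, \<rho>) w * cover_laplacian y w w' * cnj (pullback (u, \<sigma>) w')) =
    (if \<rho> = \<sigma> then of_nat (order G) * laplacian y \<rho> v u else 0)"
proof -
  let ?b = "\<lambda>w k. incidence Xt (\<lambda>_. 1) w k"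
  have "(\<Sum>w \<in> verts Xt. \<Sum>w' \<in> verts Xt. pullback (v, \<rho>) w * cover_laplacian y w w' * cnj (pullback (u, \<sigma>) w')) =
      (\<Sum>w \<in> verts Xt. \<Sum>w' \<in> verts Xt. \<Sum>k \<in> Or_cover. of_real (y (pH ` {k, opp Xt k})) *
        ((pullback (v, \<rho>) w * ?b w k) * cnj (pullback (u, \<sigma>) w' * ?b w' k)))"
    by (simp add: cover_laplacian_def sum_distrib_left sum_distrib_right mult_ac)
  also have "\<dots> = (\<Sum>w \<in> verts Xt. \<Sum>k \<in> Or_cover. \<Sum>w' \<in> verts Xt. of_real (y (pH ` {k, opp Xt k})) *
        ((pullback (v, \<rho>) w * ?b w k) * cnj (pullback (u, \<sigma>) w' * ?b w' k)))"
    by (intro sum.cong[OF refl] sum.swap)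
  also have "\<dots> = (\<Sum>k \<in> Or_cover. \<Sum>w \<in> verts Xt. \<Sum>w' \<in> verts Xt. of_real (y (pH ` {k, opp Xt k})) *
        ((pullback (v, \<rho>) w * ?b w k) * cnj (pullback (u, \<sigma>) w' * ?b w' k)))"
    by (rule sum.swap)
  also have "\<dots> = (\<Sum>k \<in> Or_cover. of_real (y (pH ` {k, opp Xt k})) *
      ((\<Sum>w \<in> verts Xt. pullback (v, \<rho>) w * ?b w k) * cnj (\<Sum>w' \<in> verts Xt. pullback (u, \<sigma>) w' * ?b w' k)))"
    unfolding cnj_sum sum_product by (simp only: sum_distrib_left)
  also have "\<dots> = (\<Sum>h \<in> Or. \<Sum>a \<in> carrier G. of_real (y {h, opp X h}) *
      ((\<rho> a * incidence X (\<lambda>h. \<rho> (\<eta> h)) v h) * cnj (\<sigma> a * incidence X (\<lambda>h. \<sigma> (\<eta> h)) u h)))"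
    unfolding sum_Or_cover
    by (intro sum.cong refl) (simp add: sum_pullback_incidence[OF i] sum_pullback_incidence[OF j] pH_\<epsilon>)
  also have "\<dots> = (\<Sum>h \<in> Or. of_real (y {h, opp X h}) * incidence X (\<lambda>h. \<rho> (\<eta> h)) v h *
      cnj (incidence X (\<lambda>h. \<sigma> (\<eta> h)) u h) * (\<Sum>a \<in> carrier G. \<rho> a * cnj (\<sigma> a)))"
    by (simp add: sum_distrib_left mult_ac)
  also have "\<dots> = (if \<rho> = \<sigma> then of_nat (order G) * laplacian y \<rho> v u else 0)"
    unfolding character_orthogonality[OF fin char_indexD(2)[OF i] char_indexD(2)[OF j]]
    by (simp add: laplacian_def sum_distrib_left mult_ac)
  finally show ?thesis .
qed

lemma sum_incidence_trivial:
  assumes "half_edge_graph Y" "k \<in> half_edges Y"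
  shows "(\<Sum>w \<in> verts Y. incidence Y (\<lambda>_. 1) w k) = 0"
proof -
  interpret Y: half_edge_graph Y by (rule assms)
  have "(\<Sum>w \<in> verts Y. of_bool (r = w)) = (1 :: complex)" if "r \<in> verts Y" for r
    using that Y.finite_verts by (simp add: of_bool_def sum.delta)
  then show ?thesis
    using Y.root_closed Y.opp_closed assms(2) by (simp add: incidence_def sum_subtractf)
qed

lemma laplacian_trivial:
  "laplacian y trivial_char = (\<lambda>u v. \<Sum>h \<in> Or. of_real (y {h, opp X h}) *
     incidence X (\<lambda>_. 1) u h * cnj (incidence X (\<lambda>_. 1) v h))"
proof -
  have "incidence X (\<lambda>h. trivial_char (\<eta> h)) v h = incidence X (\<lambda>_. 1) v h" if "h \<in> Or" for v h
    using \<eta> that by (auto simp: incidence_def Pi_iff)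
  then show ?thesis unfolding laplacian_def by (intro ext sum.cong refl) simp
qed

text \<open>Counted by vertices, the annihilator of \<open>D v\<close> is as large as the fibre, so
  the orthogonal pullbacks are numerous enough to form a basis. Counted by characters, the same
  number is the total size of the blocks.\<close>

lemma card_char_index: "card char_index = card (verts Xt)" "card char_index = (\<Sum>\<rho> \<in> characters G. card (alive \<rho>))"
  "card char_index = (\<Sum>v \<in> verts X. order G div card (D v))"
proof -
  have "char_index = Sigma (verts X) (\<lambda>v. {\<rho> \<in> characters G. \<rho> ` D v = {1}})"
    by (auto simp: char_index_def)
  then show 1: "card char_index = (\<Sum>v \<in> verts X. order G div card (D v))"
    using base.finite_verts finite_characters[OF fin] by (simp add: card_SigmaI card_annihilator[OF fin D])
  have "card (verts Xt) = (\<Sum>v \<in> verts X. card {w \<in> verts Xt. pV w = v})"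
    unfolding card_eq_sum
    by (rule sum.group[symmetric]) (use cover.finite_verts base.finite_verts pV in auto)
  then show "card char_index = card (verts Xt)" using 1 card_fiber by simp
  have "card char_index = (\<Sum>\<rho> \<in> characters G. card {i \<in> char_index. snd i = \<rho>})"
    unfolding card_eq_sum
    by (rule sum.group[symmetric]) (use finite_char_index finite_characters[OF fin] in \<open>auto simp: char_index_def\<close>)
  also have "\<dots> = (\<Sum>\<rho> \<in> characters G. card (alive \<rho>))"
  proof (rule sum.cong[OF refl])
    fix \<rho> assume "\<rho> \<in> characters G"
    then have "{i \<in> char_index. snd i = \<rho>} = (\<lambda>v. (v, \<rho>)) ` alive \<rho>" by (auto simp: char_index_def)
    then show "card {i \<in> char_index. snd i = \<rho>} = card (alive \<rho>)" by (simp add: card_image inj_on_def)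
  qed
  finally show "card char_index = (\<Sum>\<rho> \<in> characters G. card (alive \<rho>))" .
qed

text \<open>The first product is the diagonal Gram determinant of the pullbacks. A vertex
  \<open>v\<close> contributes once for every character trivial on \<open>D v\<close>, which
  explains the exponent of \<open>card (D v)\<close> in the factorization.\<close>

lemma prod_D_index:
  "(\<Prod>i \<in> char_index. of_nat (order G) / of_nat (card (D (fst i)))) *
     (\<Prod>v \<in> verts X. of_nat (card (D v)) ^ (order G div card (D v))) = (of_nat (order G) ^ card char_index :: complex)"
proof -
  let ?q = "\<lambda>v. of_nat (order G) / of_nat (card (D v)) :: complex"
  have eq: "char_index = Sigma (verts X) (\<lambda>v. {\<rho> \<in> characters G. \<rho> ` D v = {1}})"
    by (auto simp: char_index_def)
  have "(\<Prod>i \<in> char_index. ?q (fst i)) = (\<Prod>(v, \<rho>) \<in> char_index. ?q v)"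
    by (rule prod.cong) auto
  also have "\<dots> = (\<Prod>v \<in> verts X. \<Prod>\<rho> \<in> {\<rho> \<in> characters G. \<rho> ` D v = {1}}. ?q v)"
    unfolding eq using base.finite_verts finite_characters[OF fin] by (subst prod.Sigma) auto
  also have "\<dots> = (\<Prod>v \<in> verts X. ?q v ^ (order G div card (D v)))"
    by (simp add: card_annihilator[OF fin D])
  finally show ?thesis
    unfolding card_char_index(3) power_sum
    using card_D by (simp add: prod.distrib[symmetric] power_mult_distrib[symmetric])
qed

lemma det_laplacians:
  assumes r: "r \<in> verts X" and rt: "rt \<in> verts Xt"
  shows "of_nat (order G) * det_on (verts Xt - {rt}) (cover_laplacian y) =
    (\<Prod>v \<in> verts X. of_nat (card (D v)) ^ (order G div card (D v))) *
    det_on (verts X - {r}) (laplacian y trivial_char) *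
    (\<Prod>\<rho> \<in> nontrivial_characters G. det_on (alive \<rho>) (laplacian y \<rho>))"
proof -
  let ?N = "of_nat (order G) :: complex" and ?n = "of_nat (card (verts Xt)) :: complex"
  let ?q = "\<lambda>v. ?N / of_nat (card (D v))"
  define M where "M = (\<lambda>w w'. cover_laplacian y w w' + 1 * 1)"
  \<comment> \<open>The matrix of \<open>M\<close> in the basis of pullbacks: the Laplacian
    contributes the twisted blocks, the all-ones matrix the product of the two sums of
    pullbacks.\<close>
  define B where "B = (\<lambda>(v, \<rho>) (u, \<sigma>). (if \<rho> = \<sigma> then ?N * laplacian y \<rho> v u else 0) +
    of_bool (\<rho> = trivial_char) * ?q v * (of_bool (\<sigma> = trivial_char) * ?q u))"
  have N0: "?N \<noteq> 0" using fin order_gt_0_iff_finite by simp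
  have n0: "?n \<noteq> 0" using nonempty cover.finite_verts by simp
  have n2: "?n\<^sup>2 \<noteq> 0" using n0 by simp
  obtain \<pi> where \<pi>: "bij_betw \<pi> char_index (verts Xt)"
    using finite_same_card_bij[OF finite_char_index cover.finite_verts card_char_index(1)] by blast
  have gram: "det_on char_index (\<lambda>i j. \<Sum>w \<in> verts Xt. pullback i w * cnj (pullback j w)) =
      (\<Prod>i \<in> char_index. ?q (fst i))"
    by (subst det_on_diagonal[OF finite_char_index]) (auto simp: pullback_orthogonality intro!: prod.cong split: if_splits)
  have B: "(\<Sum>w \<in> verts Xt. \<Sum>w' \<in> verts Xt. pullback i w * M w w' * cnj (pullback j w')) = B i j"
    if ij: "i \<in> char_index" "j \<in> char_index" for i j
  proof -
    obtain v \<rho> u \<sigma> where i: "i = (v, \<rho>)" and j: "j = (u, \<sigma>)" by (cases i, cases j)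
    have "(\<Sum>w \<in> verts Xt. \<Sum>w' \<in> verts Xt. pullback i w * M w w' * cnj (pullback j w')) =
        (\<Sum>w \<in> verts Xt. \<Sum>w' \<in> verts Xt. pullback i w * cover_laplacian y w w' * cnj (pullback j w')) +
        (\<Sum>w \<in> verts Xt. pullback i w) * cnj (\<Sum>w' \<in> verts Xt. pullback j w')"
      by (simp add: M_def sum.distrib[symmetric] sum_product cnj_sum algebra_simps)
    then show ?thesis
      using ij unfolding i j by (simp add: pullback_laplacian sum_pullback B_def)
  qed
  have "(\<Prod>i \<in> char_index. ?q (fst i)) * det_on (verts Xt) M = det_on char_index B"
    using det_on_gram_transform[OF finite_char_index \<pi>, of pullback M] det_on_cong[OF B] gram by simp
  also have "\<dots> = (\<Prod>\<rho> \<in> characters G. det_on {i \<in> char_index. snd i = \<rho>} B)"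
    by (rule det_on_block_diagonal[OF finite_char_index finite_characters[OF fin]])
      (auto simp: char_index_def B_def)
  also have "\<dots> = (\<Prod>\<rho> \<in> characters G. det_on (alive \<rho>) (\<lambda>v u. B (v, \<rho>) (u, \<rho>)))"
  proof (rule prod.cong[OF refl])
    fix \<rho> assume "\<rho> \<in> characters G"
    then have "bij_betw (\<lambda>v. (v, \<rho>)) (alive \<rho>) {i \<in> char_index. snd i = \<rho>}"
      by (auto simp: bij_betw_def inj_on_def char_index_def)
    from det_on_reindex[OF _ this, of B] show "det_on {i \<in> char_index. snd i = \<rho>} B =
        det_on (alive \<rho>) (\<lambda>v u. B (v, \<rho>) (u, \<rho>))"
      using base.finite_verts by simp
  qed
  also have "\<dots> = det_on (verts X) (\<lambda>v u. B (v, trivial_char) (u, trivial_char)) *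
      (\<Prod>\<rho> \<in> nontrivial_characters G. det_on (alive \<rho>) (\<lambda>v u. B (v, \<rho>) (u, \<rho>)))"
    unfolding nontrivial_characters_eq prod.remove[OF finite_characters[OF fin] trivial_character]
      trivial_char_alive ..
  also have "(\<Prod>\<rho> \<in> nontrivial_characters G. det_on (alive \<rho>) (\<lambda>v u. B (v, \<rho>) (u, \<rho>))) =
      (\<Prod>\<rho> \<in> nontrivial_characters G. ?N ^ card (alive \<rho>) * det_on (alive \<rho>) (laplacian y \<rho>))"
    using base.finite_verts
    by (intro prod.cong refl) (simp add: B_def nontrivial_characters_eq det_on_scale)
  also have "det_on (verts X) (\<lambda>v u. B (v, trivial_char) (u, trivial_char)) =
      ?n\<^sup>2 * (?N ^ card (verts X - {r}) * det_on (verts X - {r}) (laplacian y trivial_char))"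
  proof -
    \<comment> \<open>\<open>?q v\<close> is the size of the fibre of \<open>v\<close>, so these
      entries sum to the number of vertices of the cover and the perturbation produces the same
      square \<open>?n\<^sup>2\<close> upstairs and downstairs.\<close>
    have sumq: "(\<Sum>v \<in> verts X. ?q v) = ?n"
    proof -
      have "?q v = of_nat (order G div card (D v))" if v: "v \<in> verts X" for v
      proof -
        obtain c where "order G = card (D v) * c" using card_D[OF v] by (auto elim: dvdE)
        then show ?thesis using card_D[OF v] by simp
      qed
      then have "(\<Sum>v \<in> verts X. ?q v) = of_nat (\<Sum>v \<in> verts X. order G div card (D v))"
        unfolding of_nat_sum by (rule sum.cong[OF refl])
      then show ?thesis unfolding card_char_index(3)[symmetric] card_char_index(1) .
    qed
    have sum0: "(\<Sum>v \<in> verts X. incidence X (\<lambda>_. 1) v h) = 0" if "h \<in> Or" for h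
      using sum_incidence_trivial[OF base.half_edge_graph_axioms Or_half_edges[OF that]] .
    have rows: "(\<Sum>u \<in> verts X. ?N * laplacian y trivial_char v u) = 0" for v
    proof -
      have "(\<Sum>u \<in> verts X. laplacian y trivial_char v u) = 0"
        unfolding laplacian_trivial by (rule gram_sums_zero(1)[OF sum0])
      then show ?thesis by (simp only: sum_distrib_left[symmetric] mult_zero_right)
    qed
    have cols: "(\<Sum>v \<in> verts X. ?N * laplacian y trivial_char v u) = 0" for u
    proof -
      have "(\<Sum>v \<in> verts X. laplacian y trivial_char v u) = 0"
        unfolding laplacian_trivial by (rule gram_sums_zero(2)[OF sum0])
      then show ?thesis by (simp only: sum_distrib_left[symmetric] mult_zero_right)
    qed
    have "det_on (verts X) (\<lambda>v u. B (v, trivial_char) (u, trivial_char)) =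
        det_on (verts X) (\<lambda>v u. ?N * laplacian y trivial_char v u + ?q v * ?q u)"
      by (simp add: B_def)
    also have "\<dots> = ?n\<^sup>2 * det_on (verts X - {r}) (\<lambda>v u. ?N * laplacian y trivial_char v u)"
      using det_on_rank_one_perturbation[OF base.finite_verts r, of ?q, OF _ rows cols] sumq n0 by simp
    also have "det_on (verts X - {r}) (\<lambda>v u. ?N * laplacian y trivial_char v u) =
        ?N ^ card (verts X - {r}) * det_on (verts X - {r}) (laplacian y trivial_char)"
      using base.finite_verts by (simp add: det_on_scale)
    finally show ?thesis .
  qed
  also have "det_on (verts Xt) M = ?n\<^sup>2 * det_on (verts Xt - {rt}) (cover_laplacian y)"
  proof -
    have sum0: "(\<Sum>w \<in> verts Xt. incidence Xt (\<lambda>_. 1) w k) = 0" if "k \<in> Or_cover" for k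
      using sum_incidence_trivial[OF cover.half_edge_graph_axioms] that by simp
    have rows: "(\<Sum>w' \<in> verts Xt. cover_laplacian y w w') = 0" for w
      unfolding cover_laplacian_def by (rule gram_sums_zero(1)[OF sum0])
    have cols: "(\<Sum>w \<in> verts Xt. cover_laplacian y w w') = 0" for w'
      unfolding cover_laplacian_def by (rule gram_sums_zero(2)[OF sum0])
    show ?thesis
      unfolding M_def
      using det_on_rank_one_perturbation[OF cover.finite_verts rt, of "\<lambda>_. 1", OF _ rows cols] n0 by simp
  qed
  finally have "?n\<^sup>2 * ((\<Prod>i \<in> char_index. ?q (fst i)) * det_on (verts Xt - {rt}) (cover_laplacian y)) =
      ?n\<^sup>2 * (?N ^ card (verts X - {r}) * det_on (verts X - {r}) (laplacian y trivial_char) *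
      ((\<Prod>\<rho> \<in> nontrivial_characters G. ?N ^ card (alive \<rho>)) *
       (\<Prod>\<rho> \<in> nontrivial_characters G. det_on (alive \<rho>) (laplacian y \<rho>))))"
    by (simp only: prod.distrib mult_ac)
  then have main: "(\<Prod>i \<in> char_index. ?q (fst i)) * det_on (verts Xt - {rt}) (cover_laplacian y) =
      ?N ^ card (verts X - {r}) * det_on (verts X - {r}) (laplacian y trivial_char) *
      ((\<Prod>\<rho> \<in> nontrivial_characters G. ?N ^ card (alive \<rho>)) *
       (\<Prod>\<rho> \<in> nontrivial_characters G. det_on (alive \<rho>) (laplacian y \<rho>)))"
    by (rule mult_left_cancel[OF n2, THEN iffD1])
  \<comment> \<open>The trivial block has lost the row \<open>r\<close>: the blocks carry one power
    of \<open>?N\<close> less than the Gram determinant, and this power becomes the factor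
    \<open>1 / N\<close> of the factorization.\<close>
  have "card char_index = Suc (card (verts X - {r})) + (\<Sum>\<rho> \<in> nontrivial_characters G. card (alive \<rho>))"
    unfolding card_char_index(2) nontrivial_characters_eq
      sum.remove[OF finite_characters[OF fin] trivial_character] trivial_char_alive
    using card_Suc_Diff1[OF base.finite_verts r] by simp
  then have expN: "?N ^ card char_index =
      ?N * (?N ^ card (verts X - {r}) * (\<Prod>\<rho> \<in> nontrivial_characters G. ?N ^ card (alive \<rho>)))"
    by (simp add: power_add power_sum)
  let ?P = "(\<Prod>v \<in> verts X. of_nat (card (D v)) ^ (order G div card (D v))) :: complex"
  let ?E = "?N ^ card (verts X - {r}) * (\<Prod>\<rho> \<in> nontrivial_characters G. ?N ^ card (alive \<rho>))"
  have E0: "?E \<noteq> 0" using N0 by (simp add: power_sum[symmetric])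
  have "?E * (?N * det_on (verts Xt - {rt}) (cover_laplacian y)) =
      ?P * ((\<Prod>i \<in> char_index. ?q (fst i)) * det_on (verts Xt - {rt}) (cover_laplacian y))"
    using prod_D_index expN by (simp only: mult_ac)
  also have "\<dots> = ?E * (?P * det_on (verts X - {r}) (laplacian y trivial_char) *
      (\<Prod>\<rho> \<in> nontrivial_characters G. det_on (alive \<rho>) (laplacian y \<rho>)))"
    unfolding main by (simp only: mult_ac)
  finally show ?thesis by (rule mult_left_cancel[OF E0, THEN iffD1])
qed

end

section \<open>From determinants to polynomials\<close>

context voltage_cover
begin

lemma spanning_tree_sums:
  fixes y :: "'h set \<Rightarrow> real"
  shows "real (order G) * (\<Sum>T \<in> spanning_trees Xt. \<Prod>e \<in> T. y (pH ` e)) =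
    (\<Prod>v \<in> verts X. real (card (D v)) ^ (order G div card (D v))) *
    (\<Sum>T \<in> spanning_trees X. \<Prod>e \<in> T. y e) *
    (\<Prod>\<rho> \<in> nontrivial_characters G. \<Sum>F \<in> matroid_bases G D Or \<eta> \<rho> X.
       basis_weight G D Or \<eta> \<rho> X F * (\<Prod>e \<in> edges X - F. y e))"
    (is "_ * ?\<tau>t = ?P * ?\<tau> * ?Q")
proof -
  obtain rt where rt: "rt \<in> verts Xt" using nonempty by blast
  then have r: "pV rt \<in> verts X" by (rule pV)
  have 1: "det_on (verts Xt - {rt}) (cover_laplacian y) = of_real ?\<tau>t"
    using cover.matrix_tree_spanning_trees[OF orientation_cover rt, of "\<lambda>e. y (pH ` e)"]
    by (simp add: cover_laplacian_def[abs_def])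
  have 2: "det_on (verts X - {pV rt}) (laplacian y trivial_char) = of_real ?\<tau>"
    using base.matrix_tree_spanning_trees[OF Or r, of y] by (simp only: laplacian_trivial)
  have 3: "det_on (alive \<rho>) (laplacian y \<rho>) = of_real (\<Sum>F \<in> matroid_bases G D Or \<eta> \<rho> X.
       basis_weight G D Or \<eta> \<rho> X F * (\<Prod>e \<in> edges X - F. y e))"
    if "\<rho> \<in> nontrivial_characters G" for \<rho>
    unfolding laplacian_def[abs_def]
    by (rule matrix_tree_weight[OF fin _ base.half_edge_graph_axioms Or \<eta>])
      (use that nontrivial_characters_eq in blast)
  have "(\<Prod>\<rho> \<in> nontrivial_characters G. det_on (alive \<rho>) (laplacian y \<rho>)) = of_real ?Q"
    unfolding of_real_prod by (rule prod.cong[OF refl]) (rule 3)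
  then have "of_nat (order G) * of_real ?\<tau>t =
      (\<Prod>v \<in> verts X. of_nat (card (D v)) ^ (order G div card (D v))) * of_real ?\<tau> * (of_real ?Q :: complex)"
    using det_laplacians[OF r rt, of y] by (simp only: 1 2)
  then have "(of_real (real (order G) * ?\<tau>t) :: complex) = of_real (?P * ?\<tau> * ?Q)"
    by (simp only: of_real_mult of_real_prod of_real_power of_real_of_nat_eq)
  then show ?thesis by (simp only: of_real_eq_iff)
qed

lemma prod_cover_edges:
  fixes x :: "'h set \<Rightarrow> real"
  shows "(\<Prod>e \<in> edges Xt. x (pH ` e)) = (\<Prod>e \<in> edges X. x e) ^ order G"
proof -
  interpret cover: voltage_graph Xt Or_cover "\<lambda>_. 1" by standard (use orientation_cover in auto)
  interpret base: voltage_graph X Or "\<lambda>_. 1" by standard (use Or in auto)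
  have "(\<Prod>e \<in> edges Xt. x (pH ` e)) = (\<Prod>k \<in> Or_cover. x (pH ` {k, opp Xt k}))"
    by (rule prod.reindex_bij_betw[OF cover.bij_betw_Or_edges, symmetric])
  also have "\<dots> = (\<Prod>h \<in> Or. \<Prod>a \<in> carrier G. x {h, opp X h})"
    unfolding prod_Or_cover by (intro prod.cong refl) (simp add: pH_\<epsilon>)
  also have "\<dots> = (\<Prod>h \<in> Or. x {h, opp X h}) ^ order G"
    by (simp add: order_def prod_power_distrib)
  also have "(\<Prod>h \<in> Or. x {h, opp X h}) = (\<Prod>e \<in> edges X. x e)"
    by (rule prod.reindex_bij_betw[OF base.bij_betw_Or_edges])
  finally show ?thesis .
qed

end

text \<open>Passes from monomials in the deleted edges, as in the polynomials, to the weights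
  \<open>1 / x e\<close> of the retained edges, as in the matrix-tree theorems.\<close>

lemma prod_complement:
  fixes x :: "'e \<Rightarrow> real"
  assumes "finite E" "T \<subseteq> E" "\<And>e. x e \<noteq> 0"
  shows "(\<Prod>e \<in> E - T. x e) = (\<Prod>e \<in> E. x e) * (\<Prod>e \<in> T. 1 / x e)"
proof -
  have "(\<Prod>e \<in> E. x e) = (\<Prod>e \<in> E - T. x e) * (\<Prod>e \<in> T. x e)"
    using prod.subset_diff[OF assms(2,1)] .
  moreover have "(\<Prod>e \<in> T. x e) * (\<Prod>e \<in> T. 1 / x e) = 1"
    by (simp add: prod.distrib[symmetric] assms(3))
  ultimately show ?thesis by (simp add: mult.assoc)
qed

lemma eval_jacobian_poly:
  "int_coeff.eval \<sigma> (jacobian_poly X) = (\<Sum>T \<in> spanning_trees X. \<Prod>e \<in> edges X - T. \<sigma> e)"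
  by (simp add: jacobian_poly_def int_coeff.eval_sum int_coeff.eval_prod int_coeff.eval_Var)

lemma eval_specialized_jacobian_poly:
  "int_coeff.eval x (specialized_jacobian_poly Xt pH) =
    (\<Sum>T \<in> spanning_trees Xt. \<Prod>e \<in> edges Xt - T. x (pH ` e))"
  by (simp add: specialized_jacobian_poly_def substitute_eq_eval eval_jacobian_poly
      int_coeff.eval_sum int_coeff.eval_prod int_coeff.eval_Var)

lemma eval_weight_poly:
  "real_coeff.eval x (weight_poly G D Or \<eta> \<rho> X) =
    (\<Sum>F \<in> matroid_bases G D Or \<eta> \<rho> X. basis_weight G D Or \<eta> \<rho> X F * (\<Prod>e \<in> F. x e))"
  by (simp add: weight_poly_def real_coeff.eval_sum real_coeff.eval_mult real_coeff.eval_Const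
      real_coeff.eval_prod real_coeff.eval_Var)

text \<open>With \<open>E\<close> the product of all variables, the weights \<open>1 / x e\<close>
  cost \<open>E ^ N\<close> on the left, because every edge has N lifts. On the right they cost one
  \<open>E\<close> for the Jacobian polynomial of \<open>X\<close> and one for each of the N - 1
  nontrivial characters, so the powers agree and \<open>spanning_tree_sums\<close> remains.\<close>

theorem (in voltage_cover) jacobian_factorization:
  "real_mpoly (specialized_jacobian_poly Xt pH) =
    Const (1 / real (order G) * (\<Prod>v \<in> verts X. real (card (D v)) ^ (order G div card (D v)))) *
    real_mpoly (jacobian_poly X) *
    (\<Prod>\<rho> \<in> nontrivial_characters G. weight_poly G D Or \<eta> \<rho> X)"
    (is "_ = Const ?c * _ * _")
proof (rule mpoly_eqI_positive)
  fix x :: "'h set \<Rightarrow> real" assume "\<And>e. 0 < x e"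
  then have x: "x e \<noteq> 0" for e by (metis less_irrefl)
  define y where "y = (\<lambda>e. 1 / x e)"
  define E where "E = (\<Prod>e \<in> edges X. x e)"
  let ?N = "order G"
  let ?W = "\<lambda>\<rho>. \<Sum>F \<in> matroid_bases G D Or \<eta> \<rho> X. basis_weight G D Or \<eta> \<rho> X F * (\<Prod>e \<in> edges X - F. y e)"
  have N: "?N > 0" using fin order_gt_0_iff_finite by simp
  have lhs: "real_coeff.eval x (real_mpoly (specialized_jacobian_poly Xt pH)) =
      E ^ ?N * (\<Sum>T \<in> spanning_trees Xt. \<Prod>e \<in> T. y (pH ` e))"
    unfolding real_eval_real_mpoly eval_specialized_jacobian_poly E_def prod_cover_edges[symmetric]
      sum_distrib_left y_def
    by (intro sum.cong refl prod_complement cover.finite_edges x) (auto simp: spanning_trees_def)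
  have base: "real_coeff.eval x (real_mpoly (jacobian_poly X)) =
      E * (\<Sum>T \<in> spanning_trees X. \<Prod>e \<in> T. y e)"
    unfolding real_eval_real_mpoly eval_jacobian_poly E_def sum_distrib_left y_def
    by (intro sum.cong refl prod_complement base.finite_edges x) (auto simp: spanning_trees_def)
  have weight: "real_coeff.eval x (weight_poly G D Or \<eta> \<rho> X) = E * ?W \<rho>" for \<rho>
  proof -
    have "(\<Prod>e \<in> F. x e) = E * (\<Prod>e \<in> edges X - F. y e)" if "F \<in> matroid_bases G D Or \<eta> \<rho> X" for F
    proof -
      have "F \<subseteq> edges X" using that by (simp add: matroid_bases_def)
      then have "F = edges X - (edges X - F)" by blast
      then show ?thesis
        using prod_complement[OF base.finite_edges, of "edges X - F" x] x by (simp add: E_def y_def)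
    qed
    then show ?thesis by (simp add: eval_weight_poly sum_distrib_left mult_ac)
  qed
  have "card (nontrivial_characters G) = ?N - 1"
    unfolding nontrivial_characters_eq
    using trivial_character finite_characters[OF fin] card_characters[OF fin] by simp
  then have "real_coeff.eval x (Const ?c * real_mpoly (jacobian_poly X) *
      (\<Prod>\<rho> \<in> nontrivial_characters G. weight_poly G D Or \<eta> \<rho> X)) =
    ?c * (E * (\<Sum>T \<in> spanning_trees X. \<Prod>e \<in> T. y e)) * (E ^ (?N - 1) * (\<Prod>\<rho> \<in> nontrivial_characters G. ?W \<rho>))"
    by (simp only: real_coeff.eval_mult real_coeff.eval_Const real_coeff.eval_prod base weight prod.distrib prod_constant)
  also have "\<dots> = E ^ Suc (?N - 1) / real ?N * ((\<Prod>v \<in> verts X. real (card (D v)) ^ (?N div card (D v))) *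
      (\<Sum>T \<in> spanning_trees X. \<Prod>e \<in> T. y e) * (\<Prod>\<rho> \<in> nontrivial_characters G. ?W \<rho>))"
    by simp
  also have "\<dots> = E ^ ?N * (\<Sum>T \<in> spanning_trees Xt. \<Prod>e \<in> T. y (pH ` e))"
    unfolding spanning_tree_sums[symmetric] using N by simp
  finally show "real_coeff.eval x (real_mpoly (specialized_jacobian_poly Xt pH)) =
      real_coeff.eval x (Const ?c * real_mpoly (jacobian_poly X) *
        (\<Prod>\<rho> \<in> nontrivial_characters G. weight_poly G D Or \<eta> \<rho> X))"
    using lhs by simp
qed

theorem theorem5p2:
  fixes G :: "('g, 'm) monoid_scheme" and N :: nat
    and Xt :: "('w, 'k) hgraph" and X :: "('v, 'h) hgraph"
    and pV :: "'w \<Rightarrow> 'v" and pH :: "'k \<Rightarrow> 'h"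
    and actV :: "'g \<Rightarrow> 'w \<Rightarrow> 'w" and actH :: "'g \<Rightarrow> 'k \<Rightarrow> 'k"
    and Or :: "'h set" and \<eta> :: "'h \<Rightarrow> 'g"
  assumes "comm_group G" and "finite (carrier G)" and "order G = N"
    and "harmonic_G_cover G Xt X pV pH actV actH"
    and "connected_graph Xt"
    and "orientation X Or"
    and "obtained_from_voltage G Xt X pV pH actV actH Or \<eta>"
  shows "real_mpoly (specialized_jacobian_poly Xt pH) =
    Const (1 / real N *
      (\<Prod>v \<in> verts X. real (card (dilation_group G Xt pV actV v)) ^
        (N div card (dilation_group G Xt pV actV v)))) *
    real_mpoly (jacobian_poly X) *
    (\<Prod>\<rho> \<in> nontrivial_characters G.
      weight_poly G (dilation_group G Xt pV actV) Or \<eta> \<rho> X)"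
proof -
  interpret G: comm_group G by fact
  interpret cov: harmonic_G_cover G Xt X pV pH actV actH by fact
  interpret cover: half_edge_graph Xt by (rule cov.cover_graph)
  interpret base: half_edge_graph X by (rule cov.base_graph)
  interpret AV: group_action G "verts Xt" actV by (rule cov.action_verts)
  let ?D = "dilation_group G Xt pV actV"
  have mor: "graph_morphism Xt X pV pH" using cov.harmonic by (auto simp: harmonic_morphism_def)
  obtain \<nu> \<epsilon> where \<nu>: "\<And>v. v \<in> verts X \<Longrightarrow> bij_betw (\<nu> v) (carrier (G Mod ?D v)) (vertex_fiber Xt pV v)"
    and \<epsilon>: "\<And>h. h \<in> Or \<Longrightarrow> bij_betw (\<epsilon> h) (carrier G) {k \<in> half_edges Xt. pH k = h}"
      "\<And>h a. h \<in> Or \<Longrightarrow> a \<in> carrier G \<Longrightarrow> root Xt (\<epsilon> h a) = \<nu> (root X h) (?D (root X h) #>\<^bsub>G\<^esub> a)"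
      "\<And>h a. h \<in> Or \<Longrightarrow> a \<in> carrier G \<Longrightarrow> root Xt (opp Xt (\<epsilon> h a)) =
        \<nu> (root X (opp X h)) (?D (root X (opp X h)) #>\<^bsub>G\<^esub> (a \<otimes>\<^bsub>G\<^esub> \<eta> h))"
    and \<eta>: "\<eta> \<in> Or \<rightarrow> carrier G"
    using assms(7) unfolding obtained_from_voltage_def Let_def by blast
  have D: "subgroup (?D v) G" if v: "v \<in> verts X" for v
  proof -
    \<comment> \<open>The fibre must be nonempty, since an intersection over the empty set would be
      the whole type instead of a subgroup. Its bijection with the set of cosets shows this.\<close>
    have "carrier (G Mod ?D v) \<noteq> {}" by (auto simp: FactGroup_def RCOSETS_def)
    then have "vertex_fiber Xt pV v \<noteq> {}" using \<nu>[OF v] by (metis bij_betw_empty2)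
    then show ?thesis
      unfolding dilation_group_def
      by (intro G.subgroups_Inter) (auto simp: vertex_fiber_def intro: AV.stabilizer_subgroup)
  qed
  interpret voltage_cover G X Xt pV pH Or \<eta> ?D \<nu> \<epsilon>
  proof (intro voltage_cover.intro voltage_cover_axioms.intro)
    show "bij_betw (\<nu> v) (rcosets\<^bsub>G\<^esub> ?D v) {w \<in> verts Xt. pV w = v}" if "v \<in> verts X" for v
      using \<nu>[OF that] by (simp add: FactGroup_def vertex_fiber_def)
    show "verts Xt \<noteq> {}" using assms(5) by (simp add: connected_graph_def)
    show "pV w \<in> verts X" if "w \<in> verts Xt" for w using mor that by (auto simp: graph_morphism_def)
    show "pH k \<in> half_edges X" "pH (opp Xt k) = opp X (pH k)" if "k \<in> half_edges Xt" for k
      using mor that by (auto simp: graph_morphism_def)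
  qed (fact assms(1) cov.base_graph cov.cover_graph assms(2) assms(6) \<eta> | rule D \<epsilon>; assumption)+
  show ?thesis using jacobian_factorization assms(3) by simp
qed

end
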